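(* Let $T$ be a rosy theory and let $p\in S(A)$ be a nonalgebraic type of rudimentarily finite thorn-weight. Then the thorn-weight of $p$ is finite and $p$ is thorn-equidominant with a finite free product of types of thorn-weight $1$. More precisely, there exist $a$, $A'\supseteq A$ and $(b_i)_{i<n}$ such that (i) $a,A',(b_i)_{i<n}$ witness that the thorn-weight of $p$ is at least $n$; (ii) $\mathrm{tp}(b_i/A')$ has thorn-weight $1$ for all $i<n$; (iii) $a$ and $b_0\cdots b_{n-1}$ are thorn-domination equivalent over $A'$.
   Context: $T$ is a complete first-order theory with $T=T^{eq}$; everything takes place in a monster model $\mathfrak C$; sets are small subsets of $\mathfrak C$; tuples are finite unless said otherwise. Thorn-forking. A formula $\varphi(x,b)$ strongly divides over $D$ if $b$ is not algebraic over $D$ and $\{\varphi(x,b') : b'\models \mathrm{tp}(b/D)\}$ is $k$-inconsistent for some $k\in\mathbb N$. It thorn-divides over $C$ if it strongly divides over some $D\supseteq C$. It thorn-forks over $C$ if it implies a finite disjunction of formulas each of which thorn-divides over $C$. A type thorn-forks over $A$ if it contains a formula that does. Write $a\downarrow^{\mathrm{th}}_A B$ if $\mathrm{tp}(a/AB)$ does not thorn-fork over $A$. A family $(b_i)_i$ is $A$-thorn-independent if $b_i\downarrow^{\mathrm{th}}_A \{b_j : j\ne i\}$ for all $i$. $T$ is rosy if it admits no infinite thorn-forking chains, in the sense that thorn-independence has local character: for every finite tuple $a$ and set $B$ there is $B_0\subseteq B$ with $|B_0|\le |T|$ and $a\downarrow^{\mathrm{th}}_{B_0}B$. Thorn-weight.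 Let $p$ be a type over $A$. $a,B,(b_i)_{i<n}$ witness that the thorn-weight of $p$ is at least $n$ if $a\models p$, $B\supseteq A$, $a\downarrow^{\mathrm{th}}_A B$, $(b_i)_{i<n}$ is $B$-thorn-independent, and $a\not\downarrow^{\mathrm{th}}_B b_i$ for all $i$. The thorn-weight of $p$ is the maximal such $n$ (finite if a maximal $n<\omega$ exists). $p$ has rudimentarily finite thorn-weight if for every non-thorn-forking extension $q\in S(B)$ of $p$ there are no $a\models q$ and infinite $B$-thorn-independent $(b_i)_{i<\omega}$ with $a\not\downarrow^{\mathrm{th}}_B b_i$ for all $i$. Domination. $a$ thorn-dominates $b$ over $C$ if for every $c$, $b\not\downarrow^{\mathrm{th}}_C c$ implies $a\not\downarrow^{\mathrm{th}}_C c$; $a,b$ are thorn-domination equivalent over $C$ if each thorn-dominates the other over $C$. Types $p$ and $q$ are thorn-equidominant if there are non-thorn-forking extensions $p',q'$ of $p,q$ to a common domain $C$ and realizations $a'\models p'$, $b'\models q'$ which are thorn-domination equivalent over $C$. A finite free product of types $q_0,\dots,q_{n-1}$ over $A'$ is a type $\mathrm{tp}(b_0\cdots b_{n-1}/A')$ with $b_i\models q_i$ and $(b_i)_{i<n}$ $A'$-thorn-independent. *)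

theory Defs
  imports Main
begin

unbundle cardinal_syntax

section \<open>Many-sorted first-order logic\<close>

text \<open>
  The sorts are the elements of the type \<open>'s\<close>. A symbol that is mapped to \<open>None\<close> does not belong
  to the language. A variable carries its sort and an index.
\<close>

record ('s, 'f, 'r) language =
  fun_sig :: "'f \<Rightarrow> ('s list \<times> 's) option"
  rel_sig :: "'r \<Rightarrow> 's list option"

type_synonym 's var = "'s \<times> nat"

datatype ('s, 'f) tm = Var "'s var" | App 'f "('s, 'f) tm list"

datatype ('s, 'f, 'r) fm =
    Eq "('s, 'f) tm" "('s, 'f) tm"
  | Rel 'r "('s, 'f) tm list"
  | Neg "('s, 'f, 'r) fm"
  | Conj "('s, 'f, 'r) fm" "('s, 'f, 'r) fm"
  | Ex "'s var" "('s, 'f, 'r) fm"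

primrec sort_tm :: "('s, 'f, 'r, 'z) language_scheme \<Rightarrow> ('s, 'f) tm \<Rightarrow> 's option" where
  "sort_tm L (Var v) = Some (fst v)"
| "sort_tm L (App f ts) =
    (case fun_sig L f of
       None \<Rightarrow> None
     | Some (ss, s) \<Rightarrow> if map (sort_tm L) ts = map Some ss then Some s else None)"

primrec wf_fm :: "('s, 'f, 'r, 'z) language_scheme \<Rightarrow> ('s, 'f, 'r) fm \<Rightarrow> bool" where
  "wf_fm L (Eq t u) \<longleftrightarrow> (\<exists>s. sort_tm L t = Some s \<and> sort_tm L u = Some s)"
| "wf_fm L (Rel R ts) \<longleftrightarrow> (\<exists>ss. rel_sig L R = Some ss \<and> map (sort_tm L) ts = map Some ss)"
| "wf_fm L (Neg \<phi>) \<longleftrightarrow> wf_fm L \<phi>"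
| "wf_fm L (Conj \<phi> \<psi>) \<longleftrightarrow> wf_fm L \<phi> \<and> wf_fm L \<psi>"
| "wf_fm L (Ex v \<phi>) \<longleftrightarrow> wf_fm L \<phi>"

primrec fv_tm :: "('s, 'f) tm \<Rightarrow> 's var set" where
  "fv_tm (Var v) = {v}"
| "fv_tm (App f ts) = \<Union> (set (map fv_tm ts))"

primrec fv :: "('s, 'f, 'r) fm \<Rightarrow> 's var set" where
  "fv (Eq t u) = fv_tm t \<union> fv_tm u"
| "fv (Rel R ts) = \<Union> (fv_tm ` set ts)"
| "fv (Neg \<phi>) = fv \<phi>"
| "fv (Conj \<phi> \<psi>) = fv \<phi> \<union> fv \<psi>"
| "fv (Ex v \<phi>) = fv \<phi> - {v}"

definition sentences :: "('s, 'f, 'r, 'z) language_scheme \<Rightarrow> ('s, 'f, 'r) fm set" where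
  "sentences L = {\<phi>. wf_fm L \<phi> \<and> fv \<phi> = {}}"

text \<open>The universe of a structure is the whole type \<open>'m\<close>, partitioned into sorts by \<open>srt\<close>.\<close>

record ('s, 'f, 'r, 'm) struct = "('s, 'f, 'r) language" +
  srt :: "'m \<Rightarrow> 's"
  fun_int :: "'f \<Rightarrow> 'm list \<Rightarrow> 'm"
  rel_int :: "'r \<Rightarrow> 'm list \<Rightarrow> bool"

text \<open>All sorts are nonempty. Interpretations only matter on arguments of the right sorts.\<close>

definition is_structure :: "('s, 'f, 'r, 'm, 'z) struct_scheme \<Rightarrow> bool" where
  "is_structure M \<longleftrightarrow> surj (srt M) \<and>
     (\<forall>f ss s xs. fun_sig M f = Some (ss, s) \<and> map (srt M) xs = ss \<longrightarrow> srt M (fun_int M f xs) = s)"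

definition sorted_env :: "('s, 'f, 'r, 'm, 'z) struct_scheme \<Rightarrow> ('s var \<Rightarrow> 'm) \<Rightarrow> bool" where
  "sorted_env M e \<longleftrightarrow> (\<forall>v. srt M (e v) = fst v)"

primrec val :: "('s, 'f, 'r, 'm, 'z) struct_scheme \<Rightarrow> ('s var \<Rightarrow> 'm) \<Rightarrow> ('s, 'f) tm \<Rightarrow> 'm" where
  "val M e (Var v) = e v"
| "val M e (App f ts) = fun_int M f (map (val M e) ts)"

primrec sat :: "('s, 'f, 'r, 'm, 'z) struct_scheme \<Rightarrow> ('s var \<Rightarrow> 'm) \<Rightarrow> ('s, 'f, 'r) fm \<Rightarrow> bool" where
  "sat M e (Eq t u) \<longleftrightarrow> val M e t = val M e u"
| "sat M e (Rel R ts) \<longleftrightarrow> rel_int M R (map (val M e) ts)"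
| "sat M e (Neg \<phi>) \<longleftrightarrow> \<not> sat M e \<phi>"
| "sat M e (Conj \<phi> \<psi>) \<longleftrightarrow> sat M e \<phi> \<and> sat M e \<psi>"
| "sat M e (Ex v \<phi>) \<longleftrightarrow> (\<exists>x. srt M x = fst v \<and> sat M (e(v := x)) \<phi>)"

text \<open>
  Formulas are evaluated at finite tuples by position: the \<open>i\<close>-th place of a tuple of sorts \<open>ss\<close>
  is denoted by the variable \<open>(ss ! i, i)\<close>.
\<close>

definition tuple_vars :: "'s list \<Rightarrow> 's var set" where
  "tuple_vars ss = {(ss ! i, i) | i. i < length ss}"

definition holds :: "('s, 'f, 'r, 'm, 'z) struct_scheme \<Rightarrow> ('s, 'f, 'r) fm \<Rightarrow> 'm list \<Rightarrow> bool" where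
  "holds M \<phi> c \<longleftrightarrow>
     (\<exists>e. sorted_env M e \<and> (\<forall>i<length c. e (srt M (c ! i), i) = c ! i) \<and> sat M e \<phi>)"

definition models :: "('s, 'f, 'r, 'm, 'z) struct_scheme \<Rightarrow> ('s, 'f, 'r) fm set \<Rightarrow> bool" where
  "models M T \<longleftrightarrow> is_structure M \<and> (\<forall>\<sigma>\<in>T. holds M \<sigma> [])"

text \<open>
  A complete theory contains every sentence or its negation. Consistency will come from the
  existence of a model, so that \<open>T\<close> is the full (deductively closed) theory of its models; in
  particular \<open>|T|\<close> is the number of formulas of the language.
\<close>

definition complete_theory ::
  "('s, 'f, 'r, 'z) language_scheme \<Rightarrow> ('s, 'f, 'r) fm set \<Rightarrow> bool" where
  "complete_theory L T \<longleftrightarrow> T \<subseteq> sentences L \<and> (\<forall>\<sigma>\<in>sentences L. \<sigma> \<in> T \<or> Neg \<sigma> \<in> T)"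

section \<open>Formulas with parameters and types\<close>

text \<open>
  \<open>PForm ss \<phi> b\<close> is the formula \<open>\<phi>(x, b)\<close>, where \<open>x\<close> is a tuple of variables of sorts \<open>ss\<close>: the
  first \<open>length ss\<close> places belong to \<open>x\<close>, the following ones to the parameters.
\<close>

datatype ('s, 'f, 'r, 'm) pform =
  PForm (vsorts: "'s list") (matrix: "('s, 'f, 'r) fm") (params: "'m list")

definition pforms_over ::
  "('s, 'f, 'r, 'm, 'z) struct_scheme \<Rightarrow> 's list \<Rightarrow> 'm set \<Rightarrow> ('s, 'f, 'r, 'm) pform set" where
  "pforms_over M ss A =
     {PForm ss \<phi> b | \<phi> b. set b \<subseteq> A \<and> wf_fm M \<phi> \<and> fv \<phi> \<subseteq> tuple_vars (ss @ map (srt M) b)}"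

definition satisfies ::
  "('s, 'f, 'r, 'm, 'z) struct_scheme \<Rightarrow> 'm list \<Rightarrow> ('s, 'f, 'r, 'm) pform \<Rightarrow> bool" where
  "satisfies M a \<psi> \<longleftrightarrow> map (srt M) a = vsorts \<psi> \<and> holds M (matrix \<psi>) (a @ params \<psi>)"

definition realizes ::
  "('s, 'f, 'r, 'm, 'z) struct_scheme \<Rightarrow> 'm list \<Rightarrow> ('s, 'f, 'r, 'm) pform set \<Rightarrow> bool" where
  "realizes M a p \<longleftrightarrow> (\<forall>\<psi>\<in>p. satisfies M a \<psi>)"

definition complete_types_in ::
  "('s, 'f, 'r, 'm, 'z) struct_scheme \<Rightarrow> 's list \<Rightarrow> 'm set \<Rightarrow> ('s, 'f, 'r, 'm) pform set set" where
  "complete_types_in M ss A =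
     {p. p \<subseteq> pforms_over M ss A \<and>
         (\<forall>F. F \<subseteq> p \<and> finite F \<longrightarrow> (\<exists>a. map (srt M) a = ss \<and> realizes M a F)) \<and>
         (\<forall>\<phi> b. PForm ss \<phi> b \<in> pforms_over M ss A \<longrightarrow> PForm ss \<phi> b \<in> p \<or> PForm ss (Neg \<phi>) b \<in> p)}"

definition complete_types ::
  "('s, 'f, 'r, 'm, 'z) struct_scheme \<Rightarrow> 'm set \<Rightarrow> ('s, 'f, 'r, 'm) pform set set" where
  "complete_types M A = (\<Union>ss. complete_types_in M ss A)"

definition tp ::
  "('s, 'f, 'r, 'm, 'z) struct_scheme \<Rightarrow> 'm list \<Rightarrow> 'm set \<Rightarrow> ('s, 'f, 'r, 'm) pform set" where
  "tp M a A = {\<psi> \<in> pforms_over M (map (srt M) a) A. satisfies M a \<psi>}"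

definition algebraic_pform ::
  "('s, 'f, 'r, 'm, 'z) struct_scheme \<Rightarrow> ('s, 'f, 'r, 'm) pform \<Rightarrow> bool" where
  "algebraic_pform M \<psi> \<longleftrightarrow> finite {a. satisfies M a \<psi>}"

definition algebraic_type ::
  "('s, 'f, 'r, 'm, 'z) struct_scheme \<Rightarrow> ('s, 'f, 'r, 'm) pform set \<Rightarrow> bool" where
  "algebraic_type M p \<longleftrightarrow> (\<exists>\<psi>\<in>p. algebraic_pform M \<psi>)"

definition algebraic_over ::
  "('s, 'f, 'r, 'm, 'z) struct_scheme \<Rightarrow> 'm list \<Rightarrow> 'm set \<Rightarrow> bool" where
  "algebraic_over M b D \<longleftrightarrow> algebraic_type M (tp M b D)"

section \<open>Monster models\<close>

text \<open>A structure together with the cardinal below which sets count as small.\<close>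

record ('s, 'f, 'r, 'm, 'k) monster = "('s, 'f, 'r, 'm) struct" +
  kappa :: "'k rel"

definition small :: "('s, 'f, 'r, 'm, 'k, 'z) monster_scheme \<Rightarrow> 'm set \<Rightarrow> bool" where
  "small M A \<longleftrightarrow> |A| <o kappa M"

definition saturated :: "('s, 'f, 'r, 'm, 'k, 'z) monster_scheme \<Rightarrow> bool" where
  "saturated M \<longleftrightarrow> (\<forall>A. small M A \<longrightarrow> (\<forall>p\<in>complete_types M A. \<exists>a. realizes M a p))"

definition automorphism :: "('s, 'f, 'r, 'm, 'z) struct_scheme \<Rightarrow> ('m \<Rightarrow> 'm) \<Rightarrow> bool" where
  "automorphism M h \<longleftrightarrow> bij h \<and> (\<forall>x. srt M (h x) = srt M x) \<and>
     (\<forall>f ss s xs. fun_sig M f = Some (ss, s) \<and> map (srt M) xs = ss \<longrightarrow>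
        h (fun_int M f xs) = fun_int M f (map h xs)) \<and>
     (\<forall>R ss xs. rel_sig M R = Some ss \<and> map (srt M) xs = ss \<longrightarrow>
        rel_int M R (map h xs) = rel_int M R xs)"

definition elementary_on :: "('s, 'f, 'r, 'm, 'z) struct_scheme \<Rightarrow> 'm set \<Rightarrow> ('m \<Rightarrow> 'm) \<Rightarrow> bool" where
  "elementary_on M A h \<longleftrightarrow> (\<forall>c. set c \<subseteq> A \<longrightarrow> tp M (map h c) {} = tp M c {})"

definition strongly_homogeneous :: "('s, 'f, 'r, 'm, 'k, 'z) monster_scheme \<Rightarrow> bool" where
  "strongly_homogeneous M \<longleftrightarrow>
     (\<forall>A h. small M A \<and> elementary_on M A h \<longrightarrow> (\<exists>g. automorphism M g \<and> (\<forall>x\<in>A. g x = h x)))"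

text \<open>
  The customary ``sufficiently large'' is made precise as \<open>2\<^bsup>|T|\<^esup> < \<kappa>\<close>. Some bound of this kind is
  needed: if \<open>\<kappa> \<le> |T|\<^sup>+\<close>, then the choice \<open>B\<^sub>0 = B\<close> is always allowed in local character.
\<close>

definition monster_model ::
  "('s, 'f, 'r, 'm, 'k, 'z) monster_scheme \<Rightarrow> ('s, 'f, 'r) fm set \<Rightarrow> bool" where
  "monster_model M T \<longleftrightarrow> models M T \<and> Card_order (kappa M) \<and> |Pow T| <o kappa M \<and>
     saturated M \<and> strongly_homogeneous M"

text \<open>
  \<open>T = T\<^bsup>eq\<^esup>\<close>: for every 0-definable equivalence relation on tuples of sorts \<open>ss\<close> there is a
  sort \<open>s\<close> and a 0-definable surjection onto \<open>s\<close> whose fibres are the equivalence classes.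
\<close>

definition closed_under_eq :: "('s, 'f, 'r, 'm, 'z) struct_scheme \<Rightarrow> bool" where
  "closed_under_eq M \<longleftrightarrow>
     (\<forall>ss \<epsilon>. wf_fm M \<epsilon> \<and> fv \<epsilon> \<subseteq> tuple_vars (ss @ ss) \<and>
        equiv {x. map (srt M) x = ss}
          {(x, y). map (srt M) x = ss \<and> map (srt M) y = ss \<and> holds M \<epsilon> (x @ y)} \<longrightarrow>
        (\<exists>s \<pi> g. wf_fm M \<pi> \<and> fv \<pi> \<subseteq> tuple_vars (ss @ [s]) \<and>
           g ` {x. map (srt M) x = ss} = {u. srt M u = s} \<and>
           (\<forall>x u. map (srt M) x = ss \<and> srt M u = s \<longrightarrow> (holds M \<pi> (x @ [u]) \<longleftrightarrow> u = g x)) \<and>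
           (\<forall>x y. map (srt M) x = ss \<and> map (srt M) y = ss \<longrightarrow>
              (g x = g y \<longleftrightarrow> holds M \<epsilon> (x @ y)))))"

section \<open>Thorn-forking\<close>

text \<open>
  The family of the instances \<open>\<psi>(x, b')\<close>, \<open>b' \<in> P\<close>, is \<open>k\<close>-inconsistent: no \<open>k\<close> distinct members
  have a common solution.
\<close>

definition k_inconsistent ::
  "('s, 'f, 'r, 'm, 'z) struct_scheme \<Rightarrow> nat \<Rightarrow> 's list \<Rightarrow> ('s, 'f, 'r) fm \<Rightarrow> 'm list set \<Rightarrow> bool" where
  "k_inconsistent M k ss \<phi> P \<longleftrightarrow>
     (\<forall>P'. P' \<subseteq> P \<and> finite P' \<and> card P' = k \<longrightarrow>
        \<not> (\<exists>a. map (srt M) a = ss \<and> (\<forall>b'\<in>P'. satisfies M a (PForm ss \<phi> b'))))"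

definition strongly_divides ::
  "('s, 'f, 'r, 'm, 'z) struct_scheme \<Rightarrow> ('s, 'f, 'r, 'm) pform \<Rightarrow> 'm set \<Rightarrow> bool" where
  "strongly_divides M \<psi> D \<longleftrightarrow>
     \<not> algebraic_over M (params \<psi>) D \<and>
     (\<exists>k. k_inconsistent M k (vsorts \<psi>) (matrix \<psi>) {b'. realizes M b' (tp M (params \<psi>) D)})"

definition thorn_divides ::
  "('s, 'f, 'r, 'm, 'k, 'z) monster_scheme \<Rightarrow> ('s, 'f, 'r, 'm) pform \<Rightarrow> 'm set \<Rightarrow> bool" where
  "thorn_divides M \<psi> C \<longleftrightarrow> (\<exists>D. C \<subseteq> D \<and> small M D \<and> strongly_divides M \<psi> D)"

definition thorn_forks ::
  "('s, 'f, 'r, 'm, 'k, 'z) monster_scheme \<Rightarrow> ('s, 'f, 'r, 'm) pform \<Rightarrow> 'm set \<Rightarrow> bool" where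
  "thorn_forks M \<psi> C \<longleftrightarrow>
     (\<exists>\<Theta>. finite \<Theta> \<and> \<Theta> \<subseteq> pforms_over M (vsorts \<psi>) UNIV \<and>
        (\<forall>\<theta>\<in>\<Theta>. thorn_divides M \<theta> C) \<and>
        (\<forall>a. satisfies M a \<psi> \<longrightarrow> (\<exists>\<theta>\<in>\<Theta>. satisfies M a \<theta>)))"

definition type_thorn_forks ::
  "('s, 'f, 'r, 'm, 'k, 'z) monster_scheme \<Rightarrow> ('s, 'f, 'r, 'm) pform set \<Rightarrow> 'm set \<Rightarrow> bool" where
  "type_thorn_forks M p A \<longleftrightarrow> (\<exists>\<psi>\<in>p. thorn_forks M \<psi> A)"

text \<open>\<open>indep M a A B\<close> says that \<open>a\<close> is thorn-independent from \<open>B\<close> over \<open>A\<close>.\<close>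

definition indep ::
  "('s, 'f, 'r, 'm, 'k, 'z) monster_scheme \<Rightarrow> 'm list \<Rightarrow> 'm set \<Rightarrow> 'm set \<Rightarrow> bool" where
  "indep M a A B \<longleftrightarrow> \<not> type_thorn_forks M (tp M a (A \<union> B)) A"

definition indep_family ::
  "('s, 'f, 'r, 'm, 'k, 'z) monster_scheme \<Rightarrow> 'm set \<Rightarrow> 'i set \<Rightarrow> ('i \<Rightarrow> 'm list) \<Rightarrow> bool" where
  "indep_family M A I b \<longleftrightarrow> (\<forall>i\<in>I. indep M (b i) A (\<Union>j\<in>I - {i}. set (b j)))"

definition rosy ::
  "('s, 'f, 'r, 'm, 'k, 'z) monster_scheme \<Rightarrow> ('s, 'f, 'r) fm set \<Rightarrow> bool" where
  "rosy M T \<longleftrightarrow>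
     (\<forall>a B. small M B \<longrightarrow> (\<exists>B\<^sub>0. B\<^sub>0 \<subseteq> B \<and> |B\<^sub>0| \<le>o |T| \<and> indep M a B\<^sub>0 B))"

text \<open>\<open>q\<close> over \<open>B\<close> is a non-thorn-forking extension of \<open>p\<close> over \<open>A\<close>.\<close>

definition nf_extension ::
  "('s, 'f, 'r, 'm, 'k, 'z) monster_scheme \<Rightarrow> ('s, 'f, 'r, 'm) pform set \<Rightarrow> 'm set \<Rightarrow>
   ('s, 'f, 'r, 'm) pform set \<Rightarrow> 'm set \<Rightarrow> bool" where
  "nf_extension M p A q B \<longleftrightarrow>
     A \<subseteq> B \<and> small M B \<and> q \<in> complete_types M B \<and> p \<subseteq> q \<and> \<not> type_thorn_forks M q A"

section \<open>Thorn-weight\<close>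

definition weight_witness ::
  "('s, 'f, 'r, 'm, 'k, 'z) monster_scheme \<Rightarrow> ('s, 'f, 'r, 'm) pform set \<Rightarrow> 'm set \<Rightarrow>
   nat \<Rightarrow> 'm list \<Rightarrow> 'm set \<Rightarrow> (nat \<Rightarrow> 'm list) \<Rightarrow> bool" where
  "weight_witness M p A n a B b \<longleftrightarrow>
     realizes M a p \<and> A \<subseteq> B \<and> small M B \<and> indep M a A B \<and>
     indep_family M B {..<n} b \<and> (\<forall>i<n. \<not> indep M a B (set (b i)))"

definition weight_ge ::
  "('s, 'f, 'r, 'm, 'k, 'z) monster_scheme \<Rightarrow> ('s, 'f, 'r, 'm) pform set \<Rightarrow> 'm set \<Rightarrow> nat \<Rightarrow> bool" where
  "weight_ge M p A n \<longleftrightarrow> (\<exists>a B b. weight_witness M p A n a B b)"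

definition has_weight ::
  "('s, 'f, 'r, 'm, 'k, 'z) monster_scheme \<Rightarrow> ('s, 'f, 'r, 'm) pform set \<Rightarrow> 'm set \<Rightarrow> nat \<Rightarrow> bool" where
  "has_weight M p A n \<longleftrightarrow> weight_ge M p A n \<and> (\<forall>m. weight_ge M p A m \<longrightarrow> m \<le> n)"

definition finite_weight ::
  "('s, 'f, 'r, 'm, 'k, 'z) monster_scheme \<Rightarrow> ('s, 'f, 'r, 'm) pform set \<Rightarrow> 'm set \<Rightarrow> bool" where
  "finite_weight M p A \<longleftrightarrow> (\<exists>n. has_weight M p A n)"

definition rudimentarily_finite_weight ::
  "('s, 'f, 'r, 'm, 'k, 'z) monster_scheme \<Rightarrow> ('s, 'f, 'r, 'm) pform set \<Rightarrow> 'm set \<Rightarrow> bool" where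
  "rudimentarily_finite_weight M p A \<longleftrightarrow>
     (\<forall>B q. nf_extension M p A q B \<longrightarrow>
        \<not> (\<exists>a (b :: nat \<Rightarrow> 'm list). realizes M a q \<and> indep_family M B UNIV b \<and>
              (\<forall>i. \<not> indep M a B (set (b i)))))"

section \<open>Domination\<close>

definition dominates ::
  "('s, 'f, 'r, 'm, 'k, 'z) monster_scheme \<Rightarrow> 'm set \<Rightarrow> 'm list \<Rightarrow> 'm list \<Rightarrow> bool" where
  "dominates M C a b \<longleftrightarrow> (\<forall>c. \<not> indep M b C (set c) \<longrightarrow> \<not> indep M a C (set c))"

definition dom_equiv ::
  "('s, 'f, 'r, 'm, 'k, 'z) monster_scheme \<Rightarrow> 'm set \<Rightarrow> 'm list \<Rightarrow> 'm list \<Rightarrow> bool" where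
  "dom_equiv M C a b \<longleftrightarrow> dominates M C a b \<and> dominates M C b a"

definition equidominant ::
  "('s, 'f, 'r, 'm, 'k, 'z) monster_scheme \<Rightarrow> ('s, 'f, 'r, 'm) pform set \<Rightarrow> 'm set \<Rightarrow>
   ('s, 'f, 'r, 'm) pform set \<Rightarrow> 'm set \<Rightarrow> bool" where
  "equidominant M p A q B \<longleftrightarrow>
     (\<exists>C p' q' a b. nf_extension M p A p' C \<and> nf_extension M q B q' C \<and>
        realizes M a p' \<and> realizes M b q' \<and> dom_equiv M C a b)"

definition concat_family :: "nat \<Rightarrow> (nat \<Rightarrow> 'm list) \<Rightarrow> 'm list" where
  "concat_family n b = concat (map b [0..<n])"

definition free_product ::
  "('s, 'f, 'r, 'm, 'k, 'z) monster_scheme \<Rightarrow> 'm set \<Rightarrow> nat \<Rightarrow>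
   (nat \<Rightarrow> ('s, 'f, 'r, 'm) pform set) \<Rightarrow> ('s, 'f, 'r, 'm) pform set \<Rightarrow> bool" where
  "free_product M A n q r \<longleftrightarrow>
     (\<exists>b. (\<forall>i<n. realizes M (b i) (q i)) \<and> indep_family M A {..<n} b \<and>
        r = tp M (concat_family n b) A)"

end

theory Submission
  imports Defs
begin

text \<open>
  The proof has two halves: thorn-independence is an independence relation, and any independence
  relation admits a decomposition into types of weight one.

  \<^bold>\<open>Independence.\<close> Base monotonicity is built into the definition of thorn-dividing, and extension,
  by compactness, into that of thorn-forking. Left transitivity (\<open>transitivity_left\<close>) rests on one
  observation (\<open>alg_fork\<close>): if \<open>e\<close> is algebraic over \<open>Dg\<close> but not over \<open>D\<close>, then \<open>g\<close> depends on \<open>De\<close> over every subset of \<open>D\<close>.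
  For \<open>symmetry\<close>, suppose that \<open>b\<close> satisfies a formula \<open>\<theta>(y, e)\<close> which strongly divides over \<open>Cd\<close>
  although \<open>de\<close> is independent from \<open>b\<close> over \<open>C\<close>. Finite Morley sequences in the type of \<open>de\<close>
  over \<open>Cb\<close>, read backwards, give finite chains of every length along which \<open>b\<close> depends on each new
  member over its predecessors. Finite chains suffice, because the chain condition is
  type-definable and compactness prolongs such chains to length \<open>|T|\<^sup>+\<close>, against local character.

  \<^bold>\<open>Decomposition.\<close> Fix a realization \<open>a\<close> of \<open>p\<close>. Everything else is moved around it, and all bases
  are independent from \<open>a\<close> over \<open>A\<close>. If \<open>a\<close> depends on \<open>c\<close>, and \<open>c\<close> is independent from \<open>E\<close>, then over
  some larger base \<open>a\<close> depends on a tuple of weight one which is independent from \<open>E\<close>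
  (\<open>weight_one_exists\<close>): a tuple \<open>d\<close> of larger weight has two independent tuples on which it
  depends, and these can be placed so generally over \<open>d\<close> that \<open>a\<close> depends on them as well;
  splitting forever would give infinitely many independent tuples on which \<open>a\<close> depends.
  Collecting such tuples of weight one, one keeps the base so large that \<open>a\<close> dominates
  the whole tuple \<open>ab\<^sub>0\<dots>b\<^bsub>n-1\<^esub>\<close>, and not only \<open>b\<^sub>0\<dots>b\<^bsub>n-1\<^esub>\<close>. This
  stronger condition is what lets domination survive the addition of \<open>b\<^sub>n\<close>
  (\<open>partial_basis_extend\<close>). The process stops, and it can only stop when \<open>b\<^sub>0\<dots>b\<^bsub>n-1\<^esub>\<close>
  dominates \<open>a\<close>. Weights add up along independent tuples of weight one
  (\<open>weight_one_bound\<close>), so that the weight of \<open>p\<close> is exactly \<open>n\<close>.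
\<close>

section \<open>Finite character, substitution and automorphisms\<close>

text \<open>
  Tukey's lemma: the union of a chain keeps a property of finite character, so Zorn's lemma applies.
\<close>

lemma finite_character_maximal:
  assumes Q0: "Q S0"
    and fc: "\<And>S. Q S \<longleftrightarrow> (\<forall>F. F \<subseteq> S \<and> finite F \<longrightarrow> Q F)"
  obtains S where "S0 \<subseteq> S" "Q S" "\<And>S'. S \<subseteq> S' \<Longrightarrow> Q S' \<Longrightarrow> S' = S"
proof -
  let ?A = "{S. S0 \<subseteq> S \<and> Q S}"
  have "\<exists>m\<in>?A. \<forall>X\<in>?A. m \<subseteq> X \<longrightarrow> X = m"
  proof (rule subset_Zorn_nonempty)
    show "?A \<noteq> {}" using Q0 by auto
  next
    fix \<C> assume ne: "\<C> \<noteq> {}" and "subset.chain ?A \<C>"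
    then have sub: "\<C> \<subseteq> ?A" and ch: "\<And>X Y. X \<in> \<C> \<Longrightarrow> Y \<in> \<C> \<Longrightarrow> X \<subseteq> Y \<or> Y \<subseteq> X"
      by (auto simp: subset_chain_def)
    have "Q F" if "F \<subseteq> \<Union>\<C>" "finite F" for F
    proof -
      have c: "subset.chain UNIV \<C>" using ch by (auto simp: subset_chain_def)
      obtain X where "X \<in> \<C>" "F \<subseteq> X"
        by (rule finite_subset_Union_chain[OF \<open>finite F\<close> \<open>F \<subseteq> \<Union>\<C>\<close> ne c])
      moreover have "Q X" using sub \<open>X \<in> \<C>\<close> by auto
      ultimately show ?thesis using fc[of X] \<open>finite F\<close> by blast
    qed
    then have "Q (\<Union>\<C>)" using fc by blast
    then show "\<Union>\<C> \<in> ?A" using sub ne by blast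
  qed
  then show ?thesis using that by auto
qed

primrec subst_tm :: "('s var \<Rightarrow> 's var) \<Rightarrow> ('s, 'f) tm \<Rightarrow> ('s, 'f) tm" where
  "subst_tm \<sigma> (Var v) = Var (\<sigma> v)"
| "subst_tm \<sigma> (App f ts) = App f (map (subst_tm \<sigma>) ts)"

text \<open>
  Every bound variable gets the index \<open>n\<close>, which grows under each quantifier. There is no capture as
  long as the values of \<open>\<sigma>\<close> at the free variables have indices below \<open>n\<close>.
\<close>

primrec subst_fm :: "('s, 'f, 'r) fm \<Rightarrow> ('s var \<Rightarrow> 's var) \<Rightarrow> nat \<Rightarrow> ('s, 'f, 'r) fm" where
  "subst_fm (Eq t u) \<sigma> n = Eq (subst_tm \<sigma> t) (subst_tm \<sigma> u)"
| "subst_fm (Rel R ts) \<sigma> n = Rel R (map (subst_tm \<sigma>) ts)"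
| "subst_fm (Neg \<phi>) \<sigma> n = Neg (subst_fm \<phi> \<sigma> n)"
| "subst_fm (Conj \<phi> \<psi>) \<sigma> n = Conj (subst_fm \<phi> \<sigma> n) (subst_fm \<psi> \<sigma> n)"
| "subst_fm (Ex v \<phi>) \<sigma> n = Ex (fst v, n) (subst_fm \<phi> (\<sigma>(v := (fst v, n))) (Suc n))"

lemma val_cong: "(\<And>v. v \<in> fv_tm t \<Longrightarrow> e v = e' v) \<Longrightarrow> val M e t = val M e' t"
proof (induction t)
  case (App f ts)
  have "map (val M e) ts = map (val M e') ts" by (rule map_cong[OF refl], rule App.IH) (auto intro!: App.prems)
  then show ?case by (simp only: val.simps)
qed simp

lemma sat_cong: "(\<And>v. v \<in> fv \<phi> \<Longrightarrow> e v = e' v) \<Longrightarrow> sat M e \<phi> = sat M e' \<phi>"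
proof (induction \<phi> arbitrary: e e')
  case (Eq t u)
  have "val M e t = val M e' t" "val M e u = val M e' u" by (auto intro!: val_cong Eq)
  then show ?case by (simp only: sat.simps)
next
  case (Rel R ts)
  then have "map (val M e) ts = map (val M e') ts" by (auto intro!: val_cong)
  then show ?case by (simp only: sat.simps)
next
  case (Neg \<phi>)
  have "sat M e \<phi> = sat M e' \<phi>" by (rule Neg.IH) (use Neg.prems in simp)
  then show ?case by (simp only: sat.simps)
next
  case (Conj \<phi> \<psi>)
  have "sat M e \<phi> = sat M e' \<phi>" by (rule Conj.IH) (use Conj.prems in simp)
  moreover have "sat M e \<psi> = sat M e' \<psi>" by (rule Conj.IH) (use Conj.prems in simp)
  ultimately show ?case by (simp only: sat.simps)
next
  case (Ex v \<phi>)
  have "sat M (e(v := x)) \<phi> = sat M (e'(v := x)) \<phi>" for x by (rule Ex.IH) (use Ex.prems in simp)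
  then show ?case by (simp only: sat.simps)
qed

lemma val_subst: "val M e (subst_tm \<sigma> t) = val M (e \<circ> \<sigma>) t"
  by (induction t) (auto cong: map_cong)

lemma sort_subst:
  assumes "\<And>v. fst (\<sigma> v) = fst v"
  shows "sort_tm L (subst_tm \<sigma> t) = sort_tm L t"
proof (induction t)
  case (Var v) show ?case by (simp only: subst_tm.simps sort_tm.simps assms)
next
  case (App f ts)
  then have "map (sort_tm L) (map (subst_tm \<sigma>) ts) = map (sort_tm L) ts" by auto
  then show ?case by (simp only: subst_tm.simps sort_tm.simps)
qed

lemma fv_subst_tm: "fv_tm (subst_tm \<sigma> t) = \<sigma> ` fv_tm t"
  by (induction t) auto

lemma wf_subst: "(\<And>v. fst (\<sigma> v) = fst v) \<Longrightarrow> wf_fm L (subst_fm \<phi> \<sigma> n) = wf_fm L \<phi>"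
proof (induction \<phi> arbitrary: \<sigma> n)
  case (Rel R ts)
  have "map (sort_tm L) (map (subst_tm \<sigma>) ts) = map (sort_tm L) ts" by (simp add: sort_subst[OF Rel])
  then show ?case by (simp only: subst_fm.simps wf_fm.simps)
next
  case (Ex v \<phi>)
  have "fst ((\<sigma>(v := (fst v, n))) u) = fst u" for u using Ex.prems[of u] by auto
  then show ?case using Ex.IH[of "\<sigma>(v := (fst v, n))" "Suc n"] by (simp only: subst_fm.simps wf_fm.simps)
next
  case (Eq t u) then show ?case by (simp only: subst_fm.simps wf_fm.simps sort_subst)
next
  case (Neg \<phi>) then show ?case by (simp only: subst_fm.simps wf_fm.simps)
next
  case (Conj \<phi> \<psi>) then show ?case by (simp only: subst_fm.simps wf_fm.simps)
qed

lemma fv_subst: "fv (subst_fm \<phi> \<sigma> n) \<subseteq> \<sigma> ` fv \<phi>"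
proof (induction \<phi> arbitrary: \<sigma> n)
  case (Ex v \<phi>)
  show ?case using Ex[of "\<sigma>(v := (fst v, n))" "Suc n"] by (fastforce split: if_splits)
qed (auto simp: fv_subst_tm, blast+)

lemma sat_subst:
  "(\<And>v. fst (\<sigma> v) = fst v) \<Longrightarrow> (\<And>v. v \<in> fv \<phi> \<Longrightarrow> snd (\<sigma> v) < n) \<Longrightarrow>
    sat M e (subst_fm \<phi> \<sigma> n) \<longleftrightarrow> sat M (e \<circ> \<sigma>) \<phi>"
proof (induction \<phi> arbitrary: \<sigma> n e)
  case (Rel R ts)
  have "map (val M e) (map (subst_tm \<sigma>) ts) = map (val M (e \<circ> \<sigma>)) ts" by (simp add: val_subst)
  then show ?case by (simp only: subst_fm.simps sat.simps)
next
  case (Ex v \<phi>)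
  let ?s = "\<sigma>(v := (fst v, n))"
  have 1: "\<And>u. fst (?s u) = fst u" using Ex.prems(1) by (metis fst_conv fun_upd_apply)
  have "sat M (e((fst v, n) := x)) (subst_fm \<phi> ?s (Suc n)) \<longleftrightarrow> sat M ((e \<circ> \<sigma>)(v := x)) \<phi>" for x
  proof -
    have "sat M (e((fst v, n) := x)) (subst_fm \<phi> ?s (Suc n)) \<longleftrightarrow> sat M (e((fst v, n) := x) \<circ> ?s) \<phi>"
      using Ex.IH[OF 1, of "Suc n"] Ex.prems(2) by (fastforce simp: less_Suc_eq)
    also have "\<dots> \<longleftrightarrow> sat M ((e \<circ> \<sigma>)(v := x)) \<phi>"
      using Ex.prems(2) by (intro sat_cong) fastforce
    finally show ?thesis .
  qed
  then show ?case by (simp only: subst_fm.simps sat.simps fst_conv)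
qed (auto simp: val_subst)

lemma tuple_vars_eq: "tuple_vars ss = {v. snd v < length ss \<and> fst v = ss ! snd v}"
  by (auto simp: tuple_vars_def)

lemma sorted_env_ex:
  assumes "is_structure M"
  shows "\<exists>e. sorted_env M e \<and> (\<forall>i<length c. e (srt M (c ! i), i) = c ! i)"
proof -
  have "\<exists>x. srt M x = s" for s using assms by (metis is_structure_def surjD)
  then obtain g where g: "\<And>s. srt M (g s) = s" by metis
  let ?e = "\<lambda>v. if snd v < length c \<and> fst v = srt M (c ! snd v) then c ! snd v else g (fst v)"
  have "sorted_env M ?e" by (auto simp: sorted_env_def g)
  then show ?thesis by (intro exI[of _ ?e]) auto
qed

text \<open>
  Only the places of the tuple occur freely, so every environment that extends the tuple may be
  used to evaluate the formula.
\<close>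

lemma holds_env:
  assumes fv: "fv \<phi> \<subseteq> tuple_vars (map (srt M) c)" and s: "sorted_env M e"
    and e: "\<And>i. i < length c \<Longrightarrow> e (srt M (c ! i), i) = c ! i"
  shows "holds M \<phi> c \<longleftrightarrow> sat M e \<phi>"
proof
  assume "holds M \<phi> c"
  then obtain e' where e': "\<forall>i<length c. e' (srt M (c ! i), i) = c ! i" "sat M e' \<phi>"
    by (auto simp: holds_def)
  have "sat M e \<phi> = sat M e' \<phi>"
    using fv e e' by (intro sat_cong) (force simp: tuple_vars_def)
  then show "sat M e \<phi>" using e' by simp
qed (use s e in \<open>auto simp: holds_def\<close>)

lemma automorphism_val:
  assumes h: "automorphism M h" and st: "is_structure M" and s: "sorted_env M e"
  shows "sort_tm M t = Some s \<Longrightarrow> val M (h \<circ> e) t = h (val M e t) \<and> srt M (val M e t) = s"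
proof (induction t arbitrary: s)
  case (Var v) then show ?case using s unfolding sorted_env_def by (metis o_apply option.inject sort_tm.simps(1) val.simps(1))
next
  case (App f ts)
  then obtain ss where ss: "fun_sig M f = Some (ss, s)" "map (sort_tm M) ts = map Some ss"
    by (auto split: option.splits if_splits)
  have "\<exists>s'. sort_tm M t = Some s'" if "t \<in> set ts" for t
  proof -
    have "sort_tm M t \<in> set (map Some ss)" using that ss(2) by (metis image_eqI list.set_map)
    then show ?thesis by auto
  qed
  then have IH: "val M (h \<circ> e) t = h (val M e t)" "sort_tm M t = Some (srt M (val M e t))"
    if "t \<in> set ts" for t using App.IH[OF that] \<open>\<And>t. t \<in> set ts \<Longrightarrow> \<exists>s'. sort_tm M t = Some s'\<close>[OF that] by blast+
  have 1: "map (val M (h \<circ> e)) ts = map h (map (val M e) ts)" using IH by simp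
  have "map (sort_tm M) ts = map Some (map (srt M) (map (val M e) ts))" using IH(2) by simp
  then have "map Some (map (srt M) (map (val M e) ts)) = map Some ss" using ss by simp
  then have "map (srt M) (map (val M e) ts) = ss"
    by (simp only: inj_map_eq_map[OF inj_Some])
  then have sx: "map (srt M) (map (val M e) ts) = ss" .
  have "h (fun_int M f (map (val M e) ts)) = fun_int M f (map h (map (val M e) ts))"
    using h ss(1) sx unfolding automorphism_def by blast
  moreover have "srt M (fun_int M f (map (val M e) ts)) = s"
    using st ss(1) sx unfolding is_structure_def by blast
  ultimately show ?case by (simp only: val.simps 1)
qed

lemma sorts_cong: "map (sort_tm M) ts = map Some ss \<Longrightarrow> t \<in> set ts \<Longrightarrow> \<exists>s. sort_tm M t = Some s"
  by (metis (no_types, lifting) ex_map_conv image_eqI list.set_map)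

lemma automorphism_sat:
  assumes h: "automorphism M h" and st: "is_structure M"
  shows "wf_fm M \<phi> \<Longrightarrow> sorted_env M e \<Longrightarrow> sat M (h \<circ> e) \<phi> \<longleftrightarrow> sat M e \<phi>"
proof (induction \<phi> arbitrary: e)
  case (Eq t u)
  then obtain s where "sort_tm M t = Some s" "sort_tm M u = Some s" by auto
  then have "val M (h \<circ> e) t = h (val M e t)" "val M (h \<circ> e) u = h (val M e u)"
    using automorphism_val[OF h st Eq.prems(2)] by auto
  moreover have "inj h" using h by (auto simp: automorphism_def bij_def)
  ultimately show ?case by (simp only: sat.simps inj_eq)
next
  case (Rel R ts)
  then obtain ss where ss: "rel_sig M R = Some ss" "map (sort_tm M) ts = map Some ss" by auto
  have IH: "val M (h \<circ> e) t = h (val M e t)" "sort_tm M t = Some (srt M (val M e t))"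
    if "t \<in> set ts" for t using automorphism_val[OF h st Rel.prems(2)] sorts_cong[OF ss(2) that] by auto
  have 1: "map (val M (h \<circ> e)) ts = map h (map (val M e) ts)" using IH by simp
  have "map (sort_tm M) ts = map Some (map (srt M) (map (val M e) ts))" using IH(2) by simp
  then have "map (srt M) (map (val M e) ts) = ss" using ss(2) by (simp only: inj_map_eq_map[OF inj_Some])
  then have "rel_int M R (map h (map (val M e) ts)) = rel_int M R (map (val M e) ts)"
    using h ss(1) unfolding automorphism_def by blast
  then show ?case by (simp only: sat.simps 1)
next
  case (Ex v \<phi>)
  have s: "\<And>x. srt M (h x) = srt M x" and "surj h" using h by (auto simp: automorphism_def bij_def)
  have upd: "h \<circ> e(v := x) = (h \<circ> e)(v := h x)" for x by auto
  have "sat M (h \<circ> e) (Ex v \<phi>) \<longleftrightarrow> (\<exists>x. srt M (h x) = fst v \<and> sat M ((h \<circ> e)(v := h x)) \<phi>)"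
    using \<open>surj h\<close> by (metis sat.simps(5) surjD)
  also have "\<dots> \<longleftrightarrow> (\<exists>x. srt M x = fst v \<and> sat M (e(v := x)) \<phi>)"
  proof -
    have "sat M ((h \<circ> e)(v := h x)) \<phi> \<longleftrightarrow> sat M (e(v := x)) \<phi>" if "srt M x = fst v" for x
      unfolding upd[symmetric] by (rule Ex.IH) (use Ex.prems that in \<open>auto simp: sorted_env_def\<close>)
    then show ?thesis using s by auto
  qed
  finally show ?case by (simp only: sat.simps)
qed auto

lemma automorphism_inv:
  assumes h: "automorphism M h" and st: "is_structure M"
  shows "automorphism M (inv h)"
proof -
  have b: "bij h" and s: "\<And>x. srt M (h x) = srt M x"
   and f: "\<And>f ss s xs. fun_sig M f = Some (ss, s) \<Longrightarrow> map (srt M) xs = ss \<Longrightarrow>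
        h (fun_int M f xs) = fun_int M f (map h xs)"
   and r: "\<And>R ss xs. rel_sig M R = Some ss \<Longrightarrow> map (srt M) xs = ss \<Longrightarrow>
        rel_int M R (map h xs) = rel_int M R xs" using h by (auto simp: automorphism_def)
  have hi: "h (inv h x) = x" "inv h (h x) = x" for x using b by (simp_all add: bij_def surj_f_inv_f)
  have si: "srt M (inv h x) = srt M x" for x using s[of "inv h x"] hi by simp
  have mi: "map h (map (inv h) xs) = xs" for xs by (simp add: o_def hi)
  have ms: "map (srt M) (map (inv h) xs) = map (srt M) xs" for xs by (simp add: o_def si)
  show ?thesis unfolding automorphism_def
  proof (intro conjI allI impI; (elim conjE)?)
    show "bij (inv h)" using b by (rule bij_imp_bij_inv)
    show "srt M (inv h x) = srt M x" for x by (rule si)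
    fix f ss s xs assume "fun_sig M f = Some (ss, s)" "map (srt M) xs = ss"
    then show "inv h (fun_int M f xs) = fun_int M f (map (inv h) xs)"
      using f[of f ss s "map (inv h) xs"] ms mi hi by (metis (no_types))
  next
    fix R ss xs assume "rel_sig M R = Some ss" "map (srt M) xs = ss"
    then show "rel_int M R (map (inv h) xs) = rel_int M R xs"
      using r[of R ss "map (inv h) xs"] ms mi by metis
  qed
qed

lemma automorphism_comp:
  assumes "automorphism M h" "automorphism M g"
  shows "automorphism M (h \<circ> g)"
proof -
  have sg: "map (srt M) (map g xs) = map (srt M) xs" for xs using assms by (auto simp: automorphism_def)
  show ?thesis unfolding automorphism_def
  proof (intro conjI allI impI; (elim conjE)?)
    show "bij (h \<circ> g)" using assms by (auto simp: automorphism_def intro: bij_comp)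
    show "srt M ((h \<circ> g) x) = srt M x" for x using assms by (auto simp: automorphism_def)
    fix f ss s xs assume *: "fun_sig M f = Some (ss, s)" "map (srt M) xs = ss"
    then have "g (fun_int M f xs) = fun_int M f (map g xs)" using assms by (auto simp: automorphism_def)
    moreover have "h (fun_int M f (map g xs)) = fun_int M f (map h (map g xs))"
      using assms(1) * sg[of xs] unfolding automorphism_def by metis
    ultimately show "(h \<circ> g) (fun_int M f xs) = fun_int M f (map (h \<circ> g) xs)" by simp
  next
    fix R ss xs assume *: "rel_sig M R = Some ss" "map (srt M) xs = ss"
    have "rel_int M R (map h (map g xs)) = rel_int M R (map g xs)"
      using assms(1) * sg[of xs] unfolding automorphism_def by metis
    moreover have "rel_int M R (map g xs) = rel_int M R xs" using assms * unfolding automorphism_def by metis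
    ultimately show "rel_int M R (map (h \<circ> g) xs) = rel_int M R xs" by simp
  qed
qed

section \<open>Counting and selecting\<close>

text \<open>
  In contrast to a condition on \<open>card\<close>, this is also meaningful for infinite sets.
\<close>

definition atleast :: "nat \<Rightarrow> 'a set \<Rightarrow> bool" where
  "atleast k S \<longleftrightarrow> (\<exists>F. F \<subseteq> S \<and> finite F \<and> card F = k)"

lemma atleast_0 [simp]: "atleast 0 S"
  unfolding atleast_def by (rule exI[of _ "{}"]) simp

lemma atleast_mono: "atleast k S \<Longrightarrow> S \<subseteq> S' \<Longrightarrow> atleast k S'" by (auto simp: atleast_def)

lemma atleast_Suc: "atleast (Suc k) S \<longleftrightarrow> (\<exists>z\<in>S. atleast k (S - {z}))"
proof
  assume "atleast (Suc k) S"
  then obtain F where F: "F \<subseteq> S" "finite F" "card F = Suc k" by (auto simp: atleast_def)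
  then obtain z where "z \<in> F" by fastforce
  then show "\<exists>z\<in>S. atleast k (S - {z})" using F
    by (intro bexI[of _ z]) (auto simp: atleast_def intro!: exI[of _ "F - {z}"])
next
  assume "\<exists>z\<in>S. atleast k (S - {z})"
  then obtain z F where "z \<in> S" "F \<subseteq> S - {z}" "finite F" "card F = k" by (auto simp: atleast_def)
  then show "atleast (Suc k) S" unfolding atleast_def by (intro exI[of _ "insert z F"]) (auto simp: card_insert_if)
qed

lemma atleast_finite: "finite S \<Longrightarrow> atleast k S \<longleftrightarrow> k \<le> card S"
  unfolding atleast_def using card_mono obtain_subset_with_card_n by metis

lemma atleast_infinite: "infinite S \<Longrightarrow> atleast k S"
  unfolding atleast_def using infinite_arbitrarily_large by metis

lemma not_atleast_finite: "\<not> atleast k S \<Longrightarrow> finite S" using atleast_infinite by metis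

lemma atleast_image: "inj_on f S \<Longrightarrow> atleast k (f ` S) \<longleftrightarrow> atleast k S"
  by (metis atleast_finite atleast_infinite card_image finite_imageD finite_imageI)

lemma indices_of_sublist:
  assumes "set b \<subseteq> set d"
  obtains ks where "length ks = length b" "\<And>i. i \<in> set ks \<Longrightarrow> i < length d" "b = map ((!) d) ks"
proof -
  have "\<forall>x\<in>set b. \<exists>i<length d. d ! i = x" using assms by (metis in_mono in_set_conv_nth)
  then obtain f where "\<forall>x\<in>set b. f x < length d \<and> d ! f x = x" by metis
  then show ?thesis using that[of "map f b"] by (auto simp: map_idI)
qed

locale rosy_monster =
  fixes M :: "('s, 'f, 'r, 'm, 'k) monster"
    and T :: "('s, 'f, 'r) fm set"
  assumes complete: "complete_theory M T"
    and monster: "monster_model M T"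
    and rosy: "rosy M T"
begin

abbreviation srts :: "'m list \<Rightarrow> 's list" where "srts a \<equiv> map (srt M) a"

definition tuples :: "'s list \<Rightarrow> 'm list set" where "tuples ss = {a. srts a = ss}"

lemma tuples_iff [simp]: "a \<in> tuples ss \<longleftrightarrow> srts a = ss" by (simp add: tuples_def)

lemma srts_length: "srts a = ss \<Longrightarrow> length a = length ss" by auto

lemma is_struct: "is_structure M" using monster by (auto simp: monster_model_def models_def)

section \<open>Small sets\<close>

text \<open>
  Iterated negation gives sentences of all sizes, and completeness puts one of any two successive
  ones into \<open>T\<close>.
\<close>

lemma infinite_T: "infinite T"
proof
  assume fin: "finite T"
  define \<sigma> :: "nat \<Rightarrow> ('s, 'f, 'r) fm" where "\<sigma> n = (Neg ^^ n) (Ex (undefined, 0) (Eq (Var (undefined, 0)) (Var (undefined, 0))))" for n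
  have fv: "wf_fm M (\<sigma> n) \<and> fv (\<sigma> n) = {}" for n by (induction n) (auto simp: \<sigma>_def)
  have inj: "size (\<sigma> n) = n + size (\<sigma> 0)" for n by (induction n) (auto simp: \<sigma>_def)
  have "\<exists>m\<ge>n. \<sigma> m \<in> T" for n
  proof -
    have "\<sigma> n \<in> sentences M" using fv by (auto simp: sentences_def)
    then have "\<sigma> n \<in> T \<or> Neg (\<sigma> n) \<in> T" using complete by (auto simp: complete_theory_def)
    moreover have "Neg (\<sigma> n) = \<sigma> (Suc n)" by (simp add: \<sigma>_def)
    ultimately show ?thesis by (metis le_SucI order_refl)
  qed
  then have "infinite {m. \<sigma> m \<in> T}" by (metis finite_nat_set_iff_bounded mem_Collect_eq not_less)
  moreover have "inj \<sigma>" by (rule injI) (metis add_right_cancel inj)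
  ultimately show False using fin by (metis finite_vimageI vimage_def)
qed

lemma small_mono: "small M B \<Longrightarrow> A \<subseteq> B \<Longrightarrow> small M A"
  unfolding small_def using card_of_mono1 ordLeq_ordLess_trans by blast

lemma Card_order_kappa: "Card_order (kappa M)" using monster by (auto simp: monster_model_def)

lemma Pow_T_less: "|Pow T| <o kappa M" using monster by (auto simp: monster_model_def)

lemma T_less: "|T| <o kappa M"
  using Pow_T_less card_of_Pow[of T] ordLess_transitive by blast

lemma infinite_kappa: "infinite (Field (kappa M))"
  using T_less infinite_T Card_order_kappa
  by (metis card_of_Field_ordIso card_of_ordLess2 card_of_ordLeq_finite ordLess_imp_ordLeq ordIso_symmetric ordLess_ordIso_trans)

lemma small_Un: "small M A \<Longrightarrow> small M B \<Longrightarrow> small M (A \<union> B)"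
  unfolding small_def
  using card_of_Un_ordLess_infinite_Field[OF infinite_kappa Card_order_kappa] by blast

lemma small_le_T: "|E| \<le>o |T| \<Longrightarrow> small M E"
  unfolding small_def using T_less ordLeq_ordLess_trans by blast

lemma finite_le_T: "finite E \<Longrightarrow> |E| \<le>o |T|"
  using infinite_T by (meson card_of_Well_order card_of_ordLeq_finite ordLeq_total)

lemma small_finite [simp]: "finite E \<Longrightarrow> small M E"
  using finite_le_T small_le_T by blast

lemma small_image: "small M A \<Longrightarrow> small M (h ` A)"
  unfolding small_def using card_of_image ordLeq_ordLess_trans by blast

lemma Un_le_T: "|E| \<le>o |T| \<Longrightarrow> |F| \<le>o |T| \<Longrightarrow> |E \<union> F| \<le>o |T|"
  using infinite_T card_of_Un_ordLeq_infinite_Field[OF _ _ _ card_of_Card_order, of T E F] by (simp add: Field_card_of)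

lemma UN_le_T: "|I| \<le>o |T| \<Longrightarrow> (\<And>i. i \<in> I \<Longrightarrow> |E i| \<le>o |T| ) \<Longrightarrow> |\<Union>i\<in>I. E i| \<le>o |T|"
  using infinite_T card_of_UNION_ordLeq_infinite by blast

lemma mono_le_T: "|E| \<le>o |T| \<Longrightarrow> F \<subseteq> E \<Longrightarrow> |F| \<le>o |T|"
  using card_of_mono1 ordLeq_transitive by blast

section \<open>Definable sets\<close>

definition definable0 :: "'s list \<Rightarrow> 'm list set set" where
  "definable0 ss = {{a \<in> tuples ss. holds M \<phi> a} | \<phi>. wf_fm M \<phi> \<and> fv \<phi> \<subseteq> tuple_vars ss}"

lemma definable0_subset: "X \<in> definable0 ss \<Longrightarrow> X \<subseteq> tuples ss" by (auto simp: definable0_def)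

lemma holds_Neg: "fv \<phi> \<subseteq> tuple_vars (srts a) \<Longrightarrow> holds M (Neg \<phi>) a \<longleftrightarrow> \<not> holds M \<phi> a"
  using sorted_env_ex[OF is_struct, of a] holds_env[of _ M a] by (metis fv.simps(3) sat.simps(3))

lemma holds_Conj: "fv \<phi> \<subseteq> tuple_vars (srts a) \<Longrightarrow> fv \<psi> \<subseteq> tuple_vars (srts a) \<Longrightarrow>
    holds M (Conj \<phi> \<psi>) a \<longleftrightarrow> holds M \<phi> a \<and> holds M \<psi> a"
  using sorted_env_ex[OF is_struct, of a] holds_env[of _ M a] by (metis fv.simps(4) sat.simps(4) Un_least)

lemma definable0_compl: "X \<in> definable0 ss \<Longrightarrow> tuples ss - X \<in> definable0 ss"
proof -
  assume "X \<in> definable0 ss"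
  then obtain \<phi> where \<phi>: "wf_fm M \<phi>" "fv \<phi> \<subseteq> tuple_vars ss" "X = {a \<in> tuples ss. holds M \<phi> a}" by (auto simp: definable0_def)
  then have "tuples ss - X = {a \<in> tuples ss. holds M (Neg \<phi>) a}" using holds_Neg by auto
  then show ?thesis using \<phi> unfolding definable0_def by (intro CollectI exI[of _ "Neg \<phi>"]) auto
qed

lemma definable0_inter: "X \<in> definable0 ss \<Longrightarrow> Y \<in> definable0 ss \<Longrightarrow> X \<inter> Y \<in> definable0 ss"
proof -
  assume "X \<in> definable0 ss" "Y \<in> definable0 ss"
  then obtain \<phi> \<psi> where \<phi>: "wf_fm M \<phi>" "fv \<phi> \<subseteq> tuple_vars ss" "X = {a \<in> tuples ss. holds M \<phi> a}"
    "wf_fm M \<psi>" "fv \<psi> \<subseteq> tuple_vars ss" "Y = {a \<in> tuples ss. holds M \<psi> a}" by (auto simp: definable0_def)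
  then have "X \<inter> Y = {a \<in> tuples ss. holds M (Conj \<phi> \<psi>) a}" using holds_Conj by auto
  then show ?thesis using \<phi> unfolding definable0_def by (intro CollectI exI[of _ "Conj \<phi> \<psi>"]) auto
qed

lemma definable0_eq: "i < length ss \<Longrightarrow> j < length ss \<Longrightarrow> ss ! i = ss ! j \<Longrightarrow> {a \<in> tuples ss. a ! i = a ! j} \<in> definable0 ss"
proof -
  assume ij: "i < length ss" "j < length ss" "ss ! i = ss ! j"
  let ?\<phi> = "Eq (Var (ss ! i, i)) (Var (ss ! j, j))"
  have fv: "fv ?\<phi> \<subseteq> tuple_vars ss" using ij by (auto simp: tuple_vars_def)
  have "holds M ?\<phi> a \<longleftrightarrow> a ! i = a ! j" if "srts a = ss" for a
  proof -
    obtain e where e: "sorted_env M e" "\<forall>i<length a. e (srt M (a ! i), i) = a ! i"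
      using sorted_env_ex[OF is_struct] by metis
    have "holds M ?\<phi> a \<longleftrightarrow> sat M e ?\<phi>" using fv e that by (intro holds_env) auto
    moreover have "e (ss ! i, i) = a ! i" "e (ss ! j, j) = a ! j" using e ij that by auto
    ultimately show ?thesis by simp
  qed
  then have "{a \<in> tuples ss. a ! i = a ! j} = {a \<in> tuples ss. holds M ?\<phi> a}" by auto
  then show ?thesis using fv ij unfolding definable0_def by (intro CollectI exI[of _ ?\<phi>]) auto
qed

lemma definable0_ex: assumes "X \<in> definable0 (ss @ [s])" shows "{a \<in> tuples ss. \<exists>x. a @ [x] \<in> X} \<in> definable0 ss"
proof -
  obtain \<phi> where \<phi>: "wf_fm M \<phi>" "fv \<phi> \<subseteq> tuple_vars (ss @ [s])" "X = {a \<in> tuples (ss @ [s]). holds M \<phi> a}"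
    using assms by (auto simp: definable0_def)
  let ?v = "(s, length ss)"
  have fv: "fv (Ex ?v \<phi>) \<subseteq> tuple_vars ss"
  proof
    fix u assume "u \<in> fv (Ex ?v \<phi>)"
    then have "u \<in> tuple_vars (ss @ [s])" "u \<noteq> ?v" using \<phi>(2) by auto
    then show "u \<in> tuple_vars ss" by (cases u) (auto simp: tuple_vars_eq nth_append split: if_splits)
  qed
  have "holds M (Ex ?v \<phi>) a \<longleftrightarrow> (\<exists>x. a @ [x] \<in> X)" if "srts a = ss" for a
  proof -
    have l: "length ss = length a" using that by auto
    obtain e where e: "sorted_env M e" "\<forall>i<length a. e (srt M (a ! i), i) = a ! i"
      using sorted_env_ex[OF is_struct] by metis
    have "holds M (Ex ?v \<phi>) a \<longleftrightarrow> sat M e (Ex ?v \<phi>)" using fv e that by (intro holds_env) auto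
    also have "\<dots> \<longleftrightarrow> (\<exists>x. srt M x = s \<and> sat M (e(?v := x)) \<phi>)" by simp
    also have "\<dots> \<longleftrightarrow> (\<exists>x. srt M x = s \<and> holds M \<phi> (a @ [x]))"
    proof -
      have "holds M \<phi> (a @ [x]) \<longleftrightarrow> sat M (e(?v := x)) \<phi>" if "srt M x = s" for x
      proof (rule holds_env)
        show "fv \<phi> \<subseteq> tuple_vars (srts (a @ [x]))" using \<phi>(2) \<open>srt M x = s\<close> \<open>srts a = ss\<close> by simp
        show "sorted_env M (e(?v := x))" using e(1) \<open>srt M x = s\<close> by (simp add: sorted_env_def)
        fix i assume i: "i < length (a @ [x])"
        show "(e(?v := x)) (srt M ((a @ [x]) ! i), i) = (a @ [x]) ! i"
        proof (cases "i < length a")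
          case True then show ?thesis using e(2) l by (simp add: nth_append)
        next
          case False then have "i = length a" using i by simp
          then show ?thesis using l \<open>srt M x = s\<close> by simp
        qed
      qed
      then show ?thesis by auto
    qed
    also have "\<dots> \<longleftrightarrow> (\<exists>x. a @ [x] \<in> X)" using that \<phi>(3) by auto
    finally show ?thesis .
  qed
  then have "{a \<in> tuples ss. \<exists>x. a @ [x] \<in> X} = {a \<in> tuples ss. holds M (Ex ?v \<phi>) a}" by auto
  then show ?thesis using fv \<phi>(1) unfolding definable0_def by (intro CollectI exI[of _ "Ex ?v \<phi>"]) auto
qed

text \<open>
  A selector picks entries of its argument by position; it may permute, drop and repeat them. All
  changes of variables below are preimages under selectors.
\<close>

definition selects :: "'s list \<Rightarrow> 's list \<Rightarrow> ('m list \<Rightarrow> 'm list) \<Rightarrow> bool" where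
  "selects ts ss f \<longleftrightarrow> (\<exists>ks. length ks = length ss \<and> (\<forall>k<length ss. ks ! k < length ts \<and> ts ! (ks ! k) = ss ! k) \<and>
     (\<forall>a\<in>tuples ts. f a = map ((!) a) ks))"

lemma selectsI: "(\<And>i. i \<in> set ks \<Longrightarrow> i < length ts) \<Longrightarrow> map ((!) ts) ks = ss \<Longrightarrow> (\<And>a. srts a = ts \<Longrightarrow> f a = map ((!) a) ks) \<Longrightarrow> selects ts ss f"
  unfolding selects_def by (intro exI[of _ ks]) auto

lemma selectsE:
  assumes "selects ts ss f"
  obtains ks where "\<And>i. i \<in> set ks \<Longrightarrow> i < length ts" "map ((!) ts) ks = ss" "\<And>a. srts a = ts \<Longrightarrow> f a = map ((!) a) ks"
proof -
  obtain ks where i: "length ks = length ss" "\<forall>k<length ss. ks ! k < length ts \<and> ts ! (ks ! k) = ss ! k"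
     "\<forall>a\<in>tuples ts. f a = map ((!) a) ks" using assms by (auto simp: selects_def)
  show ?thesis
  proof (rule that[of ks])
    show "i < length ts" if "i \<in> set ks" for i using i that by (metis in_set_conv_nth)
    show "map ((!) ts) ks = ss" using i by (intro nth_equalityI) auto
    show "srts a = ts \<Longrightarrow> f a = map ((!) a) ks" for a using i(3) by simp
  qed
qed

lemma selects_sorts: "selects ts ss f \<Longrightarrow> srts a = ts \<Longrightarrow> srts (f a) = ss"
  by (erule selectsE) (auto simp: map_eq_conv)

text \<open>
  The places of the smaller tuple are substituted by those of the larger one. The bound variables
  receive indices from \<open>length ts\<close> on, beyond all places.
\<close>

lemma definable0_sel:
  assumes "selects ts ss f" and X: "X \<in> definable0 ss" shows "{a \<in> tuples ts. f a \<in> X} \<in> definable0 ts"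
proof -
  obtain ks where ks: "length ks = length ss" "\<And>k. k < length ss \<Longrightarrow> ks ! k < length ts \<and> ts ! (ks ! k) = ss ! k"
     "\<And>a. srts a = ts \<Longrightarrow> f a = map ((!) a) ks" using assms(1) by (auto simp: selects_def)
  obtain \<phi> where \<phi>: "wf_fm M \<phi>" "fv \<phi> \<subseteq> tuple_vars ss" "X = {a \<in> tuples ss. holds M \<phi> a}"
    using X by (auto simp: definable0_def)
  define \<sigma> :: "'s var \<Rightarrow> 's var" where "\<sigma> v = (fst v, ks ! snd v)" for v
  let ?\<psi> = "subst_fm \<phi> \<sigma> (length ts)"
  have \<sigma>1: "fst (\<sigma> v) = fst v" for v by (simp add: \<sigma>_def)
  have \<sigma>2: "v \<in> fv \<phi> \<Longrightarrow> \<sigma> v \<in> tuple_vars ts" for v using \<phi>(2) ks by (auto simp: tuple_vars_eq \<sigma>_def)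
  have fv: "fv ?\<psi> \<subseteq> tuple_vars ts" using fv_subst \<sigma>2 by fastforce
  have wf: "wf_fm M ?\<psi>" using wf_subst[of \<sigma> M \<phi>] \<phi> \<sigma>1 by simp
  have "holds M ?\<psi> a \<longleftrightarrow> f a \<in> X" if a: "srts a = ts" for a
  proof -
    have s: "srts (f a) = ss" using a assms(1) selects_sorts by blast
    obtain e where e: "sorted_env M e" "\<forall>i<length a. e (srt M (a ! i), i) = a ! i"
      using sorted_env_ex[OF is_struct] by metis
    have "holds M ?\<psi> a \<longleftrightarrow> sat M e ?\<psi>" using fv e a by (intro holds_env) auto
    also have "\<dots> \<longleftrightarrow> sat M (e \<circ> \<sigma>) \<phi>" using \<sigma>1 \<sigma>2 by (intro sat_subst) (auto simp: tuple_vars_eq)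
    also have "\<dots> \<longleftrightarrow> holds M \<phi> (f a)"
    proof (rule holds_env[symmetric])
      show "fv \<phi> \<subseteq> tuple_vars (srts (f a))" using s \<phi> by simp
      show "sorted_env M (e \<circ> \<sigma>)" using e(1) \<sigma>1 unfolding sorted_env_def o_apply by metis
      fix i assume i: "i < length (f a)"
      then have "i < length ss" using s by auto
      then show "(e \<circ> \<sigma>) (srt M (f a ! i), i) = f a ! i" using ks a e i by (auto simp: \<sigma>_def)
    qed
    also have "\<dots> \<longleftrightarrow> f a \<in> X" using \<phi> s by simp
    finally show ?thesis .
  qed
  then have "{a \<in> tuples ts. f a \<in> X} = {a \<in> tuples ts. holds M ?\<psi> a}" by auto
  then show ?thesis using fv wf unfolding definable0_def by (intro CollectI exI[of _ ?\<psi>]) auto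
qed

lemma selects_append: "selects ts ss f \<Longrightarrow> selects ts us g \<Longrightarrow> selects ts (ss @ us) (\<lambda>a. f a @ g a)"
proof -
  assume 1: "selects ts ss f" and 2: "selects ts us g"
  obtain ks where "\<And>i. i \<in> set ks \<Longrightarrow> i < length ts" "map ((!) ts) ks = ss" "\<And>a. srts a = ts \<Longrightarrow> f a = map ((!) a) ks"
    using selectsE[OF 1] by blast
  moreover obtain js where "\<And>i. i \<in> set js \<Longrightarrow> i < length ts" "map ((!) ts) js = us" "\<And>a. srts a = ts \<Longrightarrow> g a = map ((!) a) js"
    using selectsE[OF 2] by blast
  ultimately show ?thesis by (intro selectsI[where ks = "ks @ js"]) auto
qed

lemma selects_comp: "selects rs ts g \<Longrightarrow> selects ts ss f \<Longrightarrow> selects rs ss (\<lambda>a. f (g a))"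
proof -
  assume 1: "selects rs ts g" and 2: "selects ts ss f"
  obtain ks where ks: "\<And>i. i \<in> set ks \<Longrightarrow> i < length rs" "map ((!) rs) ks = ts" "\<And>a. srts a = rs \<Longrightarrow> g a = map ((!) a) ks"
    using selectsE[OF 1] by blast
  obtain js where js: "\<And>i. i \<in> set js \<Longrightarrow> i < length ts" "map ((!) ts) js = ss" "\<And>a. srts a = ts \<Longrightarrow> f a = map ((!) a) js"
    using selectsE[OF 2] by blast
  have l: "length ts = length ks" using ks(2) by auto
  show ?thesis
  proof (rule selectsI[where ks = "map ((!) ks) js"])
    show "i < length rs" if "i \<in> set (map ((!) ks) js)" for i using that ks js l by auto
    show "map ((!) rs) (map ((!) ks) js) = ss" using ks(2) js(1,2) l by auto
    fix a assume a: "srts a = rs"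
    then have "f (g a) = map ((!) (g a)) js" using js(3) selects_sorts[OF 1] by blast
    also have "\<dots> = map ((!) a) (map ((!) ks) js)" using ks(3)[OF a] js(1) l by auto
    finally show "f (g a) = map ((!) a) (map ((!) ks) js)" .
  qed
qed

lemma selects_seg:
  assumes "ts = us @ ss @ vs"
  shows "selects ts ss (\<lambda>a. take (length ss) (drop (length us) a))"
  using assms
  by (intro selectsI[where ks = "[length us..<length us + length ss]"])
     (auto intro!: nth_equalityI simp: nth_append dest: srts_length)

lemma selects_take: "selects (ss @ vs) ss (take (length ss))"
  using selects_seg[of "ss @ vs" "[]" ss vs] by simp

lemma selects_drop: "selects (us @ ss) ss (drop (length us))"
  by (rule selectsI[where ks = "[length us..<length us + length ss]"])
    (auto intro!: nth_equalityI simp: nth_append dest: srts_length)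

lemma selects_list: "(\<And>i. i \<in> set ks \<Longrightarrow> i < length ts) \<Longrightarrow> map ((!) ts) ks = ss \<Longrightarrow> selects ts ss (\<lambda>a. map ((!) a) ks)"
  by (rule selectsI) auto

lemma definable0_automorphism:
  assumes h: "automorphism M h" and X: "X \<in> definable0 ss" shows "map h a \<in> X \<longleftrightarrow> a \<in> X"
proof -
  obtain \<phi> where \<phi>: "wf_fm M \<phi>" "fv \<phi> \<subseteq> tuple_vars ss" "X = {a \<in> tuples ss. holds M \<phi> a}"
    using X by (auto simp: definable0_def)
  have s: "srts (map h a) = srts a" using h by (auto simp: automorphism_def)
  have "holds M \<phi> (map h a) \<longleftrightarrow> holds M \<phi> a" if a: "srts a = ss"
  proof -
    obtain e where e: "sorted_env M e" "\<forall>i<length a. e (srt M (a ! i), i) = a ! i"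
      using sorted_env_ex[OF is_struct] by metis
    have "holds M \<phi> (map h a) \<longleftrightarrow> sat M (h \<circ> e) \<phi>"
    proof (rule holds_env)
      show "fv \<phi> \<subseteq> tuple_vars (srts (map h a))" unfolding s using a \<phi> by simp
    qed (use e h in \<open>auto simp: sorted_env_def automorphism_def\<close>)
    also have "\<dots> \<longleftrightarrow> sat M e \<phi>" by (rule automorphism_sat[OF h is_struct \<phi>(1) e(1)])
    also have "\<dots> \<longleftrightarrow> holds M \<phi> a" using \<phi> e a by (intro holds_env[symmetric]) auto
    finally show ?thesis .
  qed
  then show ?thesis using s \<phi> by auto
qed

text \<open>
  From here on formulas are replaced by the sets that they define; \<open>definable_pforms\<close> is the
  translation.
\<close>

definition definable :: "'m set \<Rightarrow> 's list \<Rightarrow> 'm list set set" where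
  "definable A ss = {{a \<in> tuples ss. a @ b \<in> Z} | b Z. set b \<subseteq> A \<and> Z \<in> definable0 (ss @ srts b)}"

lemma definableI: "set b \<subseteq> A \<Longrightarrow> Z \<in> definable0 (ss @ srts b) \<Longrightarrow> X = {a \<in> tuples ss. a @ b \<in> Z} \<Longrightarrow> X \<in> definable A ss"
  unfolding definable_def by blast

lemma definableE:
  assumes "X \<in> definable A ss"
  obtains b Z where "set b \<subseteq> A" "Z \<in> definable0 (ss @ srts b)" "X = {a \<in> tuples ss. a @ b \<in> Z}"
  using assms unfolding definable_def by blast

lemma definable_subset: "X \<in> definable A ss \<Longrightarrow> X \<subseteq> tuples ss" by (erule definableE) blast

lemma definable_sorts: "X \<in> definable A ss \<Longrightarrow> a \<in> X \<Longrightarrow> srts a = ss" using definable_subset by fastforce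

lemma definable_mono: "X \<in> definable A ss \<Longrightarrow> A \<subseteq> B \<Longrightarrow> X \<in> definable B ss"
  unfolding definable_def by blast

lemma definable0_definable: "X \<in> definable0 ss \<Longrightarrow> X \<in> definable A ss"
  using definable0_subset[of X ss] by (intro definableI[of "[]"]) auto

lemma definable_pforms: "definable A ss = (\<lambda>\<psi>. {a. satisfies M a \<psi>}) ` pforms_over M ss A"
proof (intro equalityI subsetI)
  fix X assume "X \<in> definable A ss"
  then obtain b Z where b: "set b \<subseteq> A" "Z \<in> definable0 (ss @ srts b)" "X = {a \<in> tuples ss. a @ b \<in> Z}" by (rule definableE)
  then obtain \<phi> where \<phi>: "wf_fm M \<phi>" "fv \<phi> \<subseteq> tuple_vars (ss @ srts b)" "Z = {a \<in> tuples (ss @ srts b). holds M \<phi> a}"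
    by (auto simp: definable0_def)
  then have "X = {a. satisfies M a (PForm ss \<phi> b)}" using b by (auto simp: satisfies_def)
  then show "X \<in> (\<lambda>\<psi>. {a. satisfies M a \<psi>}) ` pforms_over M ss A" using b \<phi> by (auto simp: pforms_over_def)
next
  fix X assume "X \<in> (\<lambda>\<psi>. {a. satisfies M a \<psi>}) ` pforms_over M ss A"
  then obtain \<phi> b where \<phi>: "set b \<subseteq> A" "wf_fm M \<phi>" "fv \<phi> \<subseteq> tuple_vars (ss @ srts b)"
    "X = {a. satisfies M a (PForm ss \<phi> b)}" by (auto simp: pforms_over_def)
  show "X \<in> definable A ss"
    by (rule definableI[of b _ "{a \<in> tuples (ss @ srts b). holds M \<phi> a}"])
      (use \<phi> in \<open>auto simp: satisfies_def definable0_def\<close>)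
qed

lemma definable_sel:
  assumes f: "selects ts ss f" and X: "X \<in> definable A ss" shows "{a \<in> tuples ts. f a \<in> X} \<in> definable A ts"
proof -
  obtain b Z where b: "set b \<subseteq> A" "Z \<in> definable0 (ss @ srts b)" "X = {a \<in> tuples ss. a @ b \<in> Z}" using X by (rule definableE)
  let ?g = "\<lambda>c. f (take (length ts) c) @ drop (length ts) c"
  have "selects (ts @ srts b) (ss @ srts b) ?g"
    by (intro selects_append selects_drop selects_comp[OF selects_take f])
  then have "{c \<in> tuples (ts @ srts b). ?g c \<in> Z} \<in> definable0 (ts @ srts b)" using b by (rule_tac definable0_sel)
  then show ?thesis
    by (rule definableI[OF b(1)]) (auto simp: b(3) selects_sorts[OF f] dest!: srts_length)
qed

lemma definable_compl: "X \<in> definable A ss \<Longrightarrow> tuples ss - X \<in> definable A ss"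
  by (erule definableE, rule_tac definableI[OF _ definable0_compl]) auto

lemma definable_inter: assumes "X \<in> definable A ss" "Y \<in> definable A ss" shows "X \<inter> Y \<in> definable A ss"
proof -
  obtain b Z where b: "set b \<subseteq> A" "Z \<in> definable0 (ss @ srts b)" "X = {a \<in> tuples ss. a @ b \<in> Z}" using assms(1) by (rule definableE)
  obtain c W where c: "set c \<subseteq> A" "W \<in> definable0 (ss @ srts c)" "Y = {a \<in> tuples ss. a @ c \<in> W}" using assms(2) by (rule definableE)
  let ?ts = "ss @ srts b @ srts c"
  let ?f = "take (length (ss @ srts b))" and ?g = "\<lambda>v. take (length ss) v @ drop (length (ss @ srts b)) v"
  have f: "selects ?ts (ss @ srts b) ?f" using selects_take[of "ss @ srts b" "srts c"] by simp
  have g: "selects ?ts (ss @ srts c) ?g"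
    using selects_append[OF selects_take[of ss "srts b @ srts c"], of "srts c" "drop (length (ss @ srts b))"]
      selects_drop[of "ss @ srts b" "srts c"] by simp
  have "{v \<in> tuples ?ts. ?f v \<in> Z} \<inter> {v \<in> tuples ?ts. ?g v \<in> W} \<in> definable0 ?ts"
    using definable0_inter definable0_sel f g b c by blast
  then have "{v \<in> tuples ?ts. ?f v \<in> Z} \<inter> {v \<in> tuples ?ts. ?g v \<in> W} \<in> definable0 (ss @ srts (b @ c))" by simp
  then show ?thesis by (rule definableI[rotated]) (use b c in \<open>auto dest!: srts_length\<close>)
qed

lemma definable_diff: "X \<in> definable A ss \<Longrightarrow> Y \<in> definable A ss \<Longrightarrow> X - Y \<in> definable A ss"
proof -
  assume *: "X \<in> definable A ss" "Y \<in> definable A ss"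
  then have "X - Y = X \<inter> (tuples ss - Y)" using definable_subset by blast
  then show ?thesis using definable_inter definable_compl * by simp
qed

lemma definable_top: "tuples ss \<in> definable A ss"
proof -
  let ?\<phi> = "Ex (undefined, 0) (Eq (Var (undefined, 0)) (Var (undefined, 0))) :: ('s, 'f, 'r) fm"
  have "holds M ?\<phi> a" for a
  proof -
    obtain e where e: "sorted_env M e" "\<forall>i<length a. e (srt M (a ! i), i) = a ! i"
      using sorted_env_ex[OF is_struct] by metis
    have "\<exists>x. srt M x = undefined" using is_struct by (metis is_structure_def surjD)
    then show ?thesis using e by (auto simp: holds_def)
  qed
  then have "tuples ss = {a \<in> tuples ss. holds M ?\<phi> a}" by auto
  moreover have "wf_fm M ?\<phi> \<and> fv ?\<phi> \<subseteq> tuple_vars ss" by simp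
  ultimately have "tuples ss \<in> definable0 ss" unfolding definable0_def by blast
  then show ?thesis by (rule definable0_definable)
qed

lemma definable_INT: "finite I \<Longrightarrow> (\<And>i. i \<in> I \<Longrightarrow> X i \<in> definable A ss) \<Longrightarrow> {a \<in> tuples ss. \<forall>i\<in>I. a \<in> X i} \<in> definable A ss"
proof (induction I rule: finite_induct)
  case empty then show ?case using definable_top[of ss] by (simp add: tuples_def)
next
  case (insert i I)
  have "{a \<in> tuples ss. \<forall>i\<in>insert i I. a \<in> X i} = X i \<inter> {a \<in> tuples ss. \<forall>i\<in>I. a \<in> X i}"
    using definable_subset[OF insert.prems, of i] by auto
  then show ?case using insert definable_inter by simp
qed

lemma definable_ex1: assumes "X \<in> definable A (ss @ [s])" shows "{a \<in> tuples ss. \<exists>x. a @ [x] \<in> X} \<in> definable A ss"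
proof -
  obtain b Z where b: "set b \<subseteq> A" "Z \<in> definable0 ((ss @ [s]) @ srts b)" "X = {a \<in> tuples (ss @ [s]). a @ b \<in> Z}" using assms by (rule definableE)
  let ?ts = "(ss @ srts b) @ [s]"
  let ?f = "\<lambda>v. (take (length ss) v @ drop (length (ss @ srts b)) v) @ take (length (srts b)) (drop (length ss) v)"
  have "selects ?ts ((ss @ [s]) @ srts b) ?f"
  proof (intro selects_append)
    show "selects ?ts ss (take (length ss))" using selects_take[of ss "srts b @ [s]"] by simp
    show "selects ?ts [s] (drop (length (ss @ srts b)))" by (rule selects_drop)
    show "selects ?ts (srts b) (\<lambda>v. take (length (srts b)) (drop (length ss) v))" by (rule selects_seg[where vs = "[s]"]) simp
  qed
  then have "{v \<in> tuples ?ts. ?f v \<in> Z} \<in> definable0 ?ts" using b(2) by (rule definable0_sel)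
  from definable0_ex[OF this] show ?thesis
    by (rule definableI[OF b(1)]) (auto simp: b(3) dest!: srts_length)
qed

lemma definable_ex: "X \<in> definable A (ss @ ts) \<Longrightarrow> {a \<in> tuples ss. \<exists>b. a @ b \<in> X} \<in> definable A ss"
proof (induction ts arbitrary: X rule: rev_induct)
  case Nil
  have "{a \<in> tuples ss. \<exists>b. a @ b \<in> X} = X"
  proof (intro equalityI subsetI)
    fix a assume "a \<in> {a \<in> tuples ss. \<exists>b. a @ b \<in> X}"
    then obtain b where b: "srts a = ss" "a @ b \<in> X" by auto
    have "srts (a @ b) = ss" using definable_sorts[OF Nil b(2)] by simp
    then have "b = []" using b(1) by simp
    then show "a \<in> X" using b(2) by simp
  next
    fix a assume a: "a \<in> X"
    then show "a \<in> {a \<in> tuples ss. \<exists>b. a @ b \<in> X}" using definable_sorts[OF Nil a] by (auto intro!: exI[of _ "[]"])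
  qed
  then show ?case using Nil by simp
next
  case (snoc t ts)
  have "{a \<in> tuples (ss @ ts). \<exists>x. a @ [x] \<in> X} \<in> definable A (ss @ ts)" using snoc.prems definable_ex1[of X A "ss @ ts" t] by simp
  from snoc.IH[OF this]
  have 1: "{a \<in> tuples ss. \<exists>b. a @ b \<in> {a \<in> tuples (ss @ ts). \<exists>x. a @ [x] \<in> X}} \<in> definable A ss" .
  have "(\<exists>b. a @ b \<in> {a \<in> tuples (ss @ ts). \<exists>x. a @ [x] \<in> X}) \<longleftrightarrow> (\<exists>b. a @ b \<in> X)" if a: "srts a = ss" for a
  proof
    assume "\<exists>b. a @ b \<in> X"
    then obtain b where b: "a @ b \<in> X" by blast
    then have "srts b = ts @ [t]" using definable_sorts[OF snoc.prems b] a by simp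
    then obtain b' x where "b = b' @ [x]" "srts b' = ts" by (cases b rule: rev_cases) auto
    then show "\<exists>b. a @ b \<in> {a \<in> tuples (ss @ ts). \<exists>x. a @ [x] \<in> X}" using a b by auto
  qed auto
  then have "{a \<in> tuples ss. \<exists>b. a @ b \<in> {a \<in> tuples (ss @ ts). \<exists>x. a @ [x] \<in> X}} = {a \<in> tuples ss. \<exists>b. a @ b \<in> X}" by auto
  then show ?case using 1 by simp
qed

lemma definable_swap: "X \<in> definable A (ss @ ts) \<Longrightarrow> {c \<in> tuples (ts @ ss). drop (length ts) c @ take (length ts) c \<in> X} \<in> definable A (ts @ ss)"
  using definable_sel[OF selects_append[OF selects_drop[of ts ss] selects_take[of ts ss]], of X A] by simp

lemma definable_ex_front: assumes "X \<in> definable A (ss @ ts)" shows "{b \<in> tuples ts. \<exists>a. a @ b \<in> X} \<in> definable A ts"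
proof -
  have "(drop (length ts) (b @ a) @ take (length ts) (b @ a) \<in> X \<and> b @ a \<in> tuples (ts @ ss)) \<longleftrightarrow> a @ b \<in> X" if "srts b = ts" for a b
    using that definable_sorts[OF assms, of "a @ b"] by (auto dest!: srts_length)
  then have "{b \<in> tuples ts. \<exists>a. a @ b \<in> X} = {b \<in> tuples ts. \<exists>a. b @ a \<in> {c \<in> tuples (ts @ ss). drop (length ts) c @ take (length ts) c \<in> X}}"
    by (intro Collect_cong) (simp, blast)
  then show ?thesis using definable_ex[OF definable_swap[OF assms]] by simp
qed

lemma definable_subst: assumes "X \<in> definable A (ss @ srts c)" shows "{a \<in> tuples ss. a @ c \<in> X} \<in> definable (A \<union> set c) ss"
proof -
  obtain b Z where b: "set b \<subseteq> A" "Z \<in> definable0 ((ss @ srts c) @ srts b)" "X = {a \<in> tuples (ss @ srts c). a @ b \<in> Z}" using assms by (rule definableE)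
  show ?thesis by (rule definableI[of "c @ b" _ Z]) (use b in auto)
qed

text \<open>
  Each parameter from \<open>c\<close> turns into the variable at its place in \<open>c\<close>; the other parameters belong
  to \<open>A\<close>.
\<close>

lemma definable_unsubst:
  assumes "X \<in> definable (A \<union> set c) ss"
  obtains V where "V \<in> definable A (ss @ srts c)" "X = {a \<in> tuples ss. a @ c \<in> V}"
proof -
  obtain b Z where b: "set b \<subseteq> A \<union> set c" "Z \<in> definable0 (ss @ srts b)" "X = {a \<in> tuples ss. a @ b \<in> Z}" using assms by (rule definableE)
  define d where "d = filter (\<lambda>x. x \<in> A) b"
  have "set b \<subseteq> set (c @ d)" using b(1) by (auto simp: d_def)
  then obtain ks where ks: "length ks = length b" "\<And>i. i \<in> set ks \<Longrightarrow> i < length (c @ d)" "b = map ((!) (c @ d)) ks"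
    using indices_of_sublist by blast
  have kb: "map ((!) (srts c @ srts d)) ks = srts b"
  proof -
    have "srts b = map (\<lambda>i. srt M ((c @ d) ! i)) ks" by (subst ks(3)) simp
    also have "\<dots> = map ((!) (srts (c @ d))) ks" using ks(2) by (intro map_cong refl) (metis nth_map)
    finally show ?thesis by simp
  qed
  let ?ts = "ss @ srts c @ srts d"
  let ?f = "\<lambda>v. take (length ss) v @ map ((!) (drop (length ss) v)) ks"
  have "selects ?ts (ss @ srts b) ?f"
    by (intro selects_append selects_take selects_comp[OF selects_drop[of ss] selects_list]) (use ks(2) kb in auto)
  then have 1: "{v \<in> tuples ?ts. ?f v \<in> Z} \<in> definable0 ?ts" using b(2) by (rule definable0_sel)
  have "{a \<in> tuples (ss @ srts c). a @ d \<in> {v \<in> tuples ?ts. ?f v \<in> Z}} \<in> definable A (ss @ srts c)"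
    by (rule definableI[of d]) (use 1 in \<open>auto simp: d_def\<close>)
  moreover have "X = {a \<in> tuples ss. a @ c \<in> {a \<in> tuples (ss @ srts c). a @ d \<in> {v \<in> tuples ?ts. ?f v \<in> Z}}}"
    using ks(3) by (auto simp: b(3) dest!: srts_length)
  ultimately show ?thesis using that by blast
qed

lemma definable_diag: "{c \<in> tuples (ss @ ss). take (length ss) c = drop (length ss) c} \<in> definable A (ss @ ss)"
proof -
  let ?n = "length ss"
  have "{c \<in> tuples (ss @ ss). c ! i = c ! (?n + i)} \<in> definable A (ss @ ss)" if "i < ?n" for i
    using that by (intro definable0_definable definable0_eq) (auto simp: nth_append)
  then have "{c \<in> tuples (ss @ ss). \<forall>i\<in>{..<?n}. c \<in> {c \<in> tuples (ss @ ss). c ! i = c ! (?n + i)}} \<in> definable A (ss @ ss)"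
    by (intro definable_INT) auto
  moreover have "take ?n c = drop ?n c \<longleftrightarrow> (\<forall>i<?n. c ! i = c ! (?n + i))" if "srts c = ss @ ss" for c
    using srts_length[OF that] by (subst list_eq_iff_nth_eq) auto
  then have "{c \<in> tuples (ss @ ss). take ?n c = drop ?n c} = {c \<in> tuples (ss @ ss). \<forall>i\<in>{..<?n}. c \<in> {c \<in> tuples (ss @ ss). c ! i = c ! (?n + i)}}"
    by auto
  ultimately show ?thesis by simp
qed

lemma definable_point: "set c \<subseteq> A \<Longrightarrow> {c} \<in> definable A (srts c)"
proof -
  assume c: "set c \<subseteq> A"
  let ?n = "length (srts c)"
  have "{a \<in> tuples (srts c). a @ c \<in> {v \<in> tuples (srts c @ srts c). take ?n v = drop ?n v}} \<in> definable (A \<union> set c) (srts c)"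
    by (rule definable_subst[OF definable_diag])
  moreover have "{a \<in> tuples (srts c). a @ c \<in> {v \<in> tuples (srts c @ srts c). take ?n v = drop ?n v}} = {c}"
    by (auto dest!: srts_length)
  ultimately show ?thesis using c by (simp add: Un_absorb2)
qed

text \<open>
  Induction on \<open>k\<close>: a fibre has \<open>k + 1\<close> elements if it contains some \<open>z\<close> such that \<open>k\<close> of its elements
  differ from \<open>z\<close>. This last condition concerns a family indexed by tuples \<open>z @ v\<close>, so the
  induction hypothesis is needed for the sorts \<open>ts @ vs\<close>.
\<close>

lemma definable_count:
  "X \<in> definable A (ts @ vs) \<Longrightarrow> {v \<in> tuples vs. atleast k {z. z @ v \<in> X}} \<in> definable A vs"
proof (induction k arbitrary: vs X)
  case 0 then show ?case using definable_top[of vs] by (simp add: tuples_def)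
next
  case (Suc k)
  let ?n = "length ts"
  let ?f = "\<lambda>c. take ?n c @ drop (length (ts @ ts)) c"
  let ?X1 = "{c \<in> tuples (ts @ ts @ vs). ?f c \<in> X}"
  let ?D = "{c \<in> tuples (ts @ ts). take ?n c = drop ?n c}"
  let ?X2 = "{c \<in> tuples (ts @ ts @ vs). take (length (ts @ ts)) c \<in> ?D}"
  have "selects (ts @ ts @ vs) (ts @ vs) ?f"
    using selects_append[OF selects_take[of ts "ts @ vs"], of vs "drop (length (ts @ ts))"] selects_drop[of "ts @ ts" vs] by simp
  then have "?X1 \<in> definable A (ts @ ts @ vs)" using Suc.prems by (rule definable_sel)
  moreover have "?X2 \<in> definable A (ts @ ts @ vs)"
    using definable_sel[OF selects_take[of "ts @ ts" vs] definable_diag] by simp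
  ultimately have "?X1 - ?X2 \<in> definable A (ts @ ts @ vs)" by (rule definable_diff)
  from Suc.IH[OF this] have Y: "{w \<in> tuples (ts @ vs). atleast k {z. z @ w \<in> ?X1 - ?X2}} \<in> definable A (ts @ vs)" (is "?Y \<in> _") .
  have "{v \<in> tuples vs. \<exists>z. z @ v \<in> X \<inter> ?Y} \<in> definable A vs"
    by (rule definable_ex_front[OF definable_inter[OF Suc.prems Y]])
  moreover have "atleast (Suc k) {z. z @ v \<in> X} \<longleftrightarrow> (\<exists>z. z @ v \<in> X \<inter> ?Y)" if v: "srts v = vs" for v
  proof -
    have "{z'. z' @ z @ v \<in> ?X1 - ?X2} = {z. z @ v \<in> X} - {z}" if z: "z @ v \<in> X" for z
    proof -
      have sz: "srts z = ts" using definable_sorts[OF Suc.prems z] v by (auto dest!: srts_length)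
      have "srts z' = ts" if "z' @ v \<in> X" for z' using definable_sorts[OF Suc.prems that] v by (auto dest!: srts_length)
      note sz' = this
      have lz: "length z = length ts" using sz by (rule srts_length)
      have "z' @ z @ v \<in> ?X1 - ?X2 \<longleftrightarrow> z' @ v \<in> X \<and> z' \<noteq> z" for z'
      proof (cases "srts z' = ts")
        case True
        have "length z' = length ts" using True by (rule srts_length)
        then show ?thesis using True sz v lz by simp
      next
        case False then show ?thesis using sz'[of z'] sz v by auto
      qed
      then show ?thesis by (simp only: set_eq_iff mem_Collect_eq Diff_iff singleton_iff) simp
    qed
    moreover have "z @ v \<in> tuples (ts @ vs)" if "z @ v \<in> X" for z using definable_sorts[OF Suc.prems that] by simp
    ultimately show ?thesis unfolding atleast_Suc by auto
  qed
  ultimately show ?case by (smt (verit, best) Collect_cong tuples_iff)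
qed

section \<open>Compactness\<close>

lemma satisfies_Neg: "PForm ss \<phi> b \<in> pforms_over M ss A \<Longrightarrow> srts a = ss \<Longrightarrow>
   satisfies M a (PForm ss (Neg \<phi>) b) \<longleftrightarrow> \<not> satisfies M a (PForm ss \<phi> b)"
proof -
  assume p: "PForm ss \<phi> b \<in> pforms_over M ss A" and a: "srts a = ss"
  have "fv \<phi> \<subseteq> tuple_vars (ss @ srts b)" using p by (simp add: pforms_over_def)
  then have "holds M (Neg \<phi>) (a @ b) \<longleftrightarrow> \<not> holds M \<phi> (a @ b)" using a by (intro holds_Neg) simp
  then show ?thesis using a by (simp add: satisfies_def)
qed

text \<open>
  A maximal finitely satisfiable set of formulas over \<open>A\<close> is complete, and saturation realizes it.
\<close>

lemma compactness:
  assumes small: "small M A" and sub: "\<F> \<subseteq> definable A ss"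
    and fip: "\<And>F. F \<subseteq> \<F> \<Longrightarrow> finite F \<Longrightarrow> \<exists>a\<in>tuples ss. \<forall>X\<in>F. a \<in> X"
  obtains a where "srts a = ss" "\<And>X. X \<in> \<F> \<Longrightarrow> a \<in> X"
proof -
  let ?Fin = "\<lambda>F. \<exists>a. srts a = ss \<and> realizes M a F"
  let ?Q = "\<lambda>S. S \<subseteq> pforms_over M ss A \<and> (\<forall>F. F \<subseteq> S \<and> finite F \<longrightarrow> ?Fin F)"
  let ?S0 = "{\<psi> \<in> pforms_over M ss A. {a. satisfies M a \<psi>} \<in> \<F>}"
  have Q0: "?Q ?S0"
  proof (intro conjI allI impI)
    show "?S0 \<subseteq> pforms_over M ss A" by auto
    fix F assume F: "F \<subseteq> ?S0 \<and> finite F"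
    then obtain a where "a \<in> tuples ss" "\<forall>X\<in>(\<lambda>\<psi>. {a. satisfies M a \<psi>}) ` F. a \<in> X"
      using fip[of "(\<lambda>\<psi>. {a. satisfies M a \<psi>}) ` F"] by blast
    then show "?Fin F" by (auto simp: realizes_def)
  qed
  have fc: "?Q S \<longleftrightarrow> (\<forall>F. F \<subseteq> S \<and> finite F \<longrightarrow> ?Q F)" for S
  proof
    assume "?Q S" then show "\<forall>F. F \<subseteq> S \<and> finite F \<longrightarrow> ?Q F" by (meson order_trans)
  next
    assume *: "\<forall>F. F \<subseteq> S \<and> finite F \<longrightarrow> ?Q F"
    have "S \<subseteq> pforms_over M ss A"
    proof
      fix x assume "x \<in> S" then have "{x} \<subseteq> S \<and> finite {x}" by simp
      then show "x \<in> pforms_over M ss A" using * by blast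
    qed
    then show "?Q S" using * by blast
  qed
  obtain S where S: "?S0 \<subseteq> S" "?Q S" "\<And>S'. S \<subseteq> S' \<Longrightarrow> ?Q S' \<Longrightarrow> S' = S"
    using finite_character_maximal[of ?Q ?S0, OF Q0 fc] by blast
  have add: "\<exists>F. F \<subseteq> S \<and> finite F \<and> \<not> ?Fin (insert \<psi> F)" if "\<psi> \<in> pforms_over M ss A" "\<psi> \<notin> S" for \<psi>
  proof (rule ccontr)
    assume neg: "\<not> ?thesis"
    have "?Fin F" if "F \<subseteq> insert \<psi> S \<and> finite F" for F
    proof -
      have "F - {\<psi>} \<subseteq> S" "finite (F - {\<psi>})" using that by auto
      then have "?Fin (insert \<psi> (F - {\<psi>}))" using neg by blast
      then show ?thesis by (auto simp: realizes_def)
    qed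
    then have "?Q (insert \<psi> S)" using S(2) that by blast
    then show False using S(3)[of "insert \<psi> S"] that by blast
  qed
  have comp: "PForm ss \<phi> b \<in> S \<or> PForm ss (Neg \<phi>) b \<in> S" if \<phi>: "PForm ss \<phi> b \<in> pforms_over M ss A" for \<phi> b
  proof (rule ccontr)
    assume neg: "\<not> ?thesis"
    have n: "PForm ss (Neg \<phi>) b \<in> pforms_over M ss A" using \<phi> by (auto simp: pforms_over_def)
    obtain F where F: "F \<subseteq> S" "finite F" "\<not> ?Fin (insert (PForm ss \<phi> b) F)" using add[OF \<phi>] neg by blast
    obtain G where G: "G \<subseteq> S" "finite G" "\<not> ?Fin (insert (PForm ss (Neg \<phi>) b) G)" using add[OF n] neg by blast
    have "?Fin (F \<union> G)" using S(2) F G by (metis Un_least finite_Un)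
    then obtain a where "srts a = ss" "realizes M a (F \<union> G)" by blast
    then show False using F(3) G(3) satisfies_Neg[OF \<phi>, of a] by (auto simp: realizes_def)
  qed
  have "S \<in> complete_types_in M ss A"
    unfolding complete_types_in_def using S(2) comp by blast
  then have "S \<in> complete_types M A" by (auto simp: complete_types_def)
  then obtain a where a: "realizes M a S"
    using monster small by (auto simp: monster_model_def saturated_def)
  obtain \<psi> where p: "\<psi> \<in> pforms_over M ss A" using definable_top[of ss A] unfolding definable_pforms by blast
  then obtain \<phi> b where "\<psi> = PForm ss \<phi> b" by (auto simp: pforms_over_def)
  then obtain \<chi> where "\<chi> \<in> S" "vsorts \<chi> = ss" using comp[of \<phi> b] p by fastforce
  then have sa: "srts a = ss" using a by (auto simp: realizes_def satisfies_def)
  moreover have "a \<in> X" if X: "X \<in> \<F>" for X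
  proof -
    obtain \<psi> where "\<psi> \<in> pforms_over M ss A" "X = {a. satisfies M a \<psi>}" using X sub unfolding definable_pforms by blast
    then show ?thesis using X S(1) a by (auto simp: realizes_def)
  qed
  ultimately show ?thesis using that by blast
qed

section \<open>Types and homogeneity\<close>

definition same_type :: "'m set \<Rightarrow> 'm list \<Rightarrow> 'm list \<Rightarrow> bool" where
  "same_type A a b \<longleftrightarrow> srts a = srts b \<and> (\<forall>X\<in>definable A (srts a). a \<in> X \<longleftrightarrow> b \<in> X)"

lemma same_typeD: "same_type A a b \<Longrightarrow> X \<in> definable A (srts a) \<Longrightarrow> a \<in> X \<longleftrightarrow> b \<in> X" by (simp add: same_type_def)

lemma same_type_refl [simp]: "same_type A a a" by (simp add: same_type_def)

lemma same_type_sym: "same_type A a b \<Longrightarrow> same_type A b a" by (auto simp: same_type_def)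

lemma same_type_mono: "same_type B a b \<Longrightarrow> A \<subseteq> B \<Longrightarrow> same_type A a b" using definable_mono by (auto simp: same_type_def)

lemma same_typeI: "srts b = srts a \<Longrightarrow> (\<And>X. X \<in> definable A (srts a) \<Longrightarrow> a \<in> X \<Longrightarrow> b \<in> X) \<Longrightarrow> same_type A a b"
proof -
  assume s: "srts b = srts a" and *: "\<And>X. X \<in> definable A (srts a) \<Longrightarrow> a \<in> X \<Longrightarrow> b \<in> X"
  have "a \<in> X" if X: "X \<in> definable A (srts a)" "b \<in> X" for X
    using *[OF definable_compl[OF X(1)]] X(2) by auto
  then show ?thesis using s * by (auto simp: same_type_def)
qed

lemma realizes_tp: "realizes M b (tp M a A) \<longleftrightarrow> same_type A a b"
proof
  assume r: "realizes M b (tp M a A)"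
  have *: "b \<in> X" if X: "X \<in> definable A (srts a)" "a \<in> X" for X
  proof -
    obtain \<psi> where "\<psi> \<in> pforms_over M (srts a) A" "X = {a. satisfies M a \<psi>}" using X(1) unfolding definable_pforms by blast
    then show ?thesis using X r by (auto simp: tp_def realizes_def)
  qed
  have "srts b = srts a" using *[OF definable_top] by simp
  then show "same_type A a b" using * by (rule same_typeI)
next
  assume e: "same_type A a b"
  have "satisfies M b \<psi>" if \<psi>: "\<psi> \<in> pforms_over M (srts a) A" "satisfies M a \<psi>" for \<psi>
  proof -
    have "{a. satisfies M a \<psi>} \<in> definable A (srts a)" using \<psi>(1) definable_pforms by blast
    from same_typeD[OF e this] show ?thesis using \<psi>(2) by simp
  qed
  then show "realizes M b (tp M a A)" by (auto simp: tp_def realizes_def)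
qed

lemma realizes_self: "realizes M a (tp M a A)" by (simp add: realizes_tp)

lemma tp_eq: "tp M a A = tp M b A \<longleftrightarrow> same_type A a b"
proof
  assume "tp M a A = tp M b A"
  then show "same_type A a b" using realizes_self[of b A] realizes_tp by metis
next
  assume e: "same_type A a b"
  then have s: "srts a = srts b" by (simp add: same_type_def)
  have "tp M a A \<subseteq> tp M b A" using e s realizes_tp[of b a A] by (auto simp: tp_def realizes_def)
  moreover have "tp M b A \<subseteq> tp M a A" using same_type_sym[OF e] s realizes_tp[of a b A] by (auto simp: tp_def realizes_def)
  ultimately show "tp M a A = tp M b A" by blast
qed

lemma same_type_sel: "same_type A a b \<Longrightarrow> selects (srts a) ss f \<Longrightarrow> same_type A (f a) (f b)"
proof -
  assume e: "same_type A a b" and f: "selects (srts a) ss f"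
  have s: "srts b = srts a" using e by (simp add: same_type_def)
  have sf: "srts (f a) = ss" "srts (f b) = ss" using selects_sorts[OF f] s by simp_all
  show ?thesis
  proof (rule same_typeI)
    fix X assume X: "X \<in> definable A (srts (f a))" "f a \<in> X"
    have "{a' \<in> tuples (srts a). f a' \<in> X} \<in> definable A (srts a)" using definable_sel[OF f] sf X by simp
    from same_typeD[OF e this] show "f b \<in> X" using X s by simp
  qed (use sf in simp)
qed

lemma same_type_list: "same_type A a b \<Longrightarrow> (\<And>i. i \<in> set ks \<Longrightarrow> i < length a) \<Longrightarrow> same_type A (map ((!) a) ks) (map ((!) b) ks)"
  using same_type_sel[OF _ selects_list[where ts = "srts a"]] by auto

lemma same_type_point: "same_type A a b \<Longrightarrow> set a \<subseteq> A \<Longrightarrow> b = a"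
  using same_typeD[OF _ definable_point, of A a b] by simp

definition aut :: "'m set \<Rightarrow> ('m \<Rightarrow> 'm) \<Rightarrow> bool" where
  "aut A h \<longleftrightarrow> automorphism M h \<and> (\<forall>x\<in>A. h x = x)"

lemma aut_srts: "aut A h \<Longrightarrow> srts (map h a) = srts a" by (auto simp: aut_def automorphism_def)

lemma aut_mono: "aut B h \<Longrightarrow> A \<subseteq> B \<Longrightarrow> aut A h" by (auto simp: aut_def)

lemma aut_map: "aut A h \<Longrightarrow> set c \<subseteq> A \<Longrightarrow> map h c = c" by (rule map_idI) (auto simp: aut_def)

lemma aut_image: "aut A h \<Longrightarrow> C \<subseteq> A \<Longrightarrow> h ` C = C" by (force simp: aut_def)

lemma aut_inv: "aut A h \<Longrightarrow> aut A (inv h)"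
proof -
  assume h: "aut A h"
  then have "automorphism M (inv h)" using automorphism_inv[OF _ is_struct] by (simp add: aut_def)
  moreover have "inj h" using h by (simp add: aut_def automorphism_def bij_def)
  then have "inv h x = x" if "x \<in> A" for x using h that by (metis aut_def inv_f_f)
  ultimately show ?thesis by (simp add: aut_def)
qed

lemma aut_comp: "aut A h \<Longrightarrow> aut A g \<Longrightarrow> aut A (h \<circ> g)"
  using automorphism_comp by (auto simp: aut_def)

lemma aut_inv_map: assumes "aut A h" shows "map (inv h) (map h a) = a" "map h (map (inv h) a) = a" "h ` inv h ` X = X" "inv h ` h ` X = X"
proof -
  have b: "inj h" "surj h" using assms by (auto simp: aut_def automorphism_def bij_def)
  show "map (inv h) (map h a) = a" "inv h ` h ` X = X" using b(1) by (simp_all add: map_idI image_image)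
  show "map h (map (inv h) a) = a" "h ` inv h ` X = X" using b(2) by (simp_all add: map_idI surj_f_inv_f image_image)
qed

lemma definable_aut: "X \<in> definable A ss \<Longrightarrow> aut B h \<Longrightarrow> map h ` X \<in> definable (h ` A) ss"
proof -
  assume X: "X \<in> definable A ss" and h: "aut B h"
  obtain b Z where b: "set b \<subseteq> A" "Z \<in> definable0 (ss @ srts b)" "X = {a \<in> tuples ss. a @ b \<in> Z}" using X by (rule definableE)
  have "map h ` X = {a \<in> tuples ss. a @ map h b \<in> Z}"
  proof (intro equalityI subsetI)
    fix a assume "a \<in> map h ` X"
    then obtain a' where a': "a' \<in> X" "a = map h a'" by blast
    then have "map h (a' @ b) \<in> Z" using definable0_automorphism[OF _ b(2), of h "a' @ b"] h by (simp add: aut_def b(3))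
    then show "a \<in> {a \<in> tuples ss. a @ map h b \<in> Z}"
      using a' aut_srts[OF h, of a'] by (simp add: b(3))
  next
    fix a assume a: "a \<in> {a \<in> tuples ss. a @ map h b \<in> Z}"
    then have "map h (map (inv h) a @ b) \<in> Z" using aut_inv_map(2)[OF h] by simp
    then have "map (inv h) a @ b \<in> Z"
      using definable0_automorphism[OF _ b(2), of h "map (inv h) a @ b"] h unfolding aut_def by blast
    then have "map (inv h) a \<in> X" using a b aut_srts[OF aut_inv[OF h], of a] by simp
    then show "a \<in> map h ` X" using aut_inv_map(2)[OF h] by (metis imageI)
  qed
  moreover have "srts (map h b) = srts b" by (rule aut_srts[OF h])
  ultimately show ?thesis using b by (intro definableI[of "map h b" _ Z]) (auto simp del: map_map)
qed

lemma definable_aut_fix: assumes "X \<in> definable A ss" "aut A h" shows "map h a \<in> X \<longleftrightarrow> a \<in> X"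
proof -
  obtain b Z where b: "set b \<subseteq> A" "Z \<in> definable0 (ss @ srts b)" "X = {a \<in> tuples ss. a @ b \<in> Z}" using assms(1) by (rule definableE)
  have "map h b = b" using aut_map[OF assms(2) b(1)] .
  then have "map h a @ b \<in> Z \<longleftrightarrow> a @ b \<in> Z"
    using definable0_automorphism[OF _ b(2), of h "a @ b"] assms(2) by (simp add: aut_def)
  then show ?thesis using aut_srts[OF assms(2), of a] by (simp add: b(3) del: map_map)
qed

lemma aut_same_type: "aut A h \<Longrightarrow> same_type A a (map h a)"
  using aut_srts definable_aut_fix by (auto simp: same_type_def)

text \<open>
  Equality is part of the type, so \<open>G\<close> is the graph of a function, which fixes the elements of \<open>A\<close>
  in its domain. Together with the identity on \<open>A\<close> it is elementary, because the entries of a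
  finite tuple that lie in \<open>A\<close> may serve as parameters.
\<close>

lemma homogeneity:
  assumes small: "small M (A \<union> fst ` G)"
    and eq: "\<And>ps. set ps \<subseteq> G \<Longrightarrow> same_type A (map fst ps) (map snd ps)"
  obtains h where "aut A h" "\<And>u v. (u, v) \<in> G \<Longrightarrow> h u = v"
proof -
  define h where "h x = (if x \<in> A then x else (SOME v. (x, v) \<in> G))" for x
  have fun1: "v = v'" if "(u, v) \<in> G" "(u, v') \<in> G" for u v v'
  proof -
    have e: "same_type A [u, u] [v, v']" using eq[of "[(u, v), (u, v')]"] that by simp
    have "{c \<in> tuples ([srt M u] @ [srt M u]). take 1 c = drop 1 c} \<in> definable A ([srt M u] @ [srt M u])"
      using definable_diag[of "[srt M u]" A] by simp
    then have "[u, u] \<in> {c \<in> tuples ([srt M u] @ [srt M u]). take 1 c = drop 1 c} \<longleftrightarrow> [v, v'] \<in> {c \<in> tuples ([srt M u] @ [srt M u]). take 1 c = drop 1 c}"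
      by (intro same_typeD[OF e]) simp
    then show ?thesis by simp
  qed
  have hG: "h u = v" if "(u, v) \<in> G" for u v
  proof (cases "u \<in> A")
    case True
    have "same_type A [u] [v]" using eq[of "[(u, v)]"] that by simp
    then have "[v] = [u]" using True by (intro same_type_point) auto
    then show ?thesis using True by (simp add: h_def)
  next
    case False
    have "(u, SOME v. (u, v) \<in> G) \<in> G" using that by (rule someI)
    then show ?thesis using False fun1[OF that] by (simp add: h_def)
  qed
  have "elementary_on M (A \<union> fst ` G) h"
    unfolding elementary_on_def
  proof (intro allI impI)
    fix c assume c: "set c \<subseteq> A \<union> fst ` G"
    define u where "u = filter (\<lambda>x. x \<notin> A) c"
    define bA where "bA = filter (\<lambda>x. x \<in> A) c"
    define ps where "ps = map (\<lambda>x. (x, h x)) u"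
    have "set ps \<subseteq> G" using c hG by (fastforce simp: ps_def u_def)
    then have "same_type A (map fst ps) (map snd ps)" by (rule eq)
    then have e: "same_type A u (map h u)" by (simp add: ps_def o_def)
    have "set c \<subseteq> set (u @ bA)" by (auto simp: u_def bA_def)
    then obtain ks where ks: "length ks = length c" "\<And>i. i \<in> set ks \<Longrightarrow> i < length (u @ bA)" "c = map ((!) (u @ bA)) ks"
      using indices_of_sublist by blast
    have "map h bA = bA" by (auto simp: bA_def h_def intro: map_idI)
    then have "map h (u @ bA) = map h u @ bA" by simp
    moreover have "map h c = map ((!) (map h (u @ bA))) ks"
    proof -
      have "map h c = map (\<lambda>i. h ((u @ bA) ! i)) ks" by (subst ks(3)) simp
      also have "\<dots> = map ((!) (map h (u @ bA))) ks" using ks(2) by (intro map_cong refl) (metis nth_map)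
      finally show ?thesis .
    qed
    ultimately have hc: "map h c = map ((!) (map h u @ bA)) ks" by simp
    have "same_type A (u @ bA) (map h u @ bA)"
    proof (rule same_typeI)
      show "srts (map h u @ bA) = srts (u @ bA)" using e by (simp add: same_type_def)
      fix X assume X: "X \<in> definable A (srts (u @ bA))" "u @ bA \<in> X"
      have "{a \<in> tuples (srts u). a @ bA \<in> X} \<in> definable (A \<union> set bA) (srts u)" using X by (intro definable_subst) simp
      moreover have "A \<union> set bA = A" by (auto simp: bA_def)
      ultimately have Y: "{a \<in> tuples (srts u). a @ bA \<in> X} \<in> definable A (srts u)" by simp
      show "map h u @ bA \<in> X" using same_typeD[OF e Y] X(2) by simp
    qed
    then have "same_type A c (map h c)" unfolding hc using same_type_list[of A "u @ bA" "map h u @ bA" ks] ks by metis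
    then show "tp M (map h c) {} = tp M c {}" using tp_eq same_type_mono[of A] same_type_sym by blast
  qed
  then obtain g where g: "automorphism M g" "\<forall>x\<in>A \<union> fst ` G. g x = h x"
    using monster small unfolding monster_model_def strongly_homogeneous_def by blast
  have "aut A g" using g by (auto simp: aut_def h_def)
  moreover have "g u = v" if "(u, v) \<in> G" for u v using g(2) hG[OF that] that by force
  ultimately show ?thesis using that by blast
qed

lemma same_type_aut:
  assumes "small M A" "same_type A a b"
  obtains h where "aut A h" "map h a = b"
proof -
  have l: "length a = length b" using assms(2) by (metis same_type_def length_map)
  have eq: "same_type A (map fst ps) (map snd ps)" if ps: "set ps \<subseteq> set (zip a b)" for ps
  proof -
    obtain ks where ks: "\<And>i. i \<in> set ks \<Longrightarrow> i < length (zip a b)" "ps = map ((!) (zip a b)) ks"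
      using indices_of_sublist[OF ps] by metis
    have "map fst ps = map ((!) a) ks" "map snd ps = map ((!) b) ks" using ks l by auto
    then show ?thesis using same_type_list[OF assms(2), of ks] ks(1) l by simp
  qed
  have "small M (A \<union> fst ` set (zip a b))" using assms(1) by (intro small_Un) auto
  then obtain h where "aut A h" "\<And>u v. (u, v) \<in> set (zip a b) \<Longrightarrow> h u = v"
    using homogeneity[OF _ eq, of "set (zip a b)"]
    by (metis (no_types, lifting))
  note h = this
  have "map h a = b"
  proof (rule nth_equalityI)
    fix i assume "i < length (map h a)"
    then show "map h a ! i = b ! i" using h(2)[of "a ! i" "b ! i"] l by (auto simp: set_zip)
  qed (use l in simp)
  then show ?thesis using that h by blast
qed

section \<open>Algebraicity\<close>

definition alg :: "'m set \<Rightarrow> 'm list \<Rightarrow> bool" where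
  "alg A e \<longleftrightarrow> (\<exists>X\<in>definable A (srts e). e \<in> X \<and> finite X)"

lemma algebraic_over_iff: "algebraic_over M e A \<longleftrightarrow> alg A e"
  unfolding algebraic_over_def algebraic_type_def algebraic_pform_def alg_def definable_pforms tp_def by auto

lemma alg_mono: "alg A e \<Longrightarrow> A \<subseteq> B \<Longrightarrow> alg B e" using definable_mono by (auto simp: alg_def)

lemma map_mem_image: "aut A h \<Longrightarrow> map h a \<in> map h ` X \<longleftrightarrow> a \<in> X"
  using aut_inv_map(1)[of A h] by (metis image_iff)

lemma mem_image_inv: "aut A h \<Longrightarrow> a \<in> map h ` X \<longleftrightarrow> map (inv h) a \<in> X"
  using aut_inv_map(1,2)[of A h] by (metis image_iff)

lemma alg_aut: "aut B h \<Longrightarrow> alg A e \<Longrightarrow> alg (h ` A) (map h e)"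
  using definable_aut map_mem_image aut_srts unfolding alg_def by (metis finite_imageI)

lemma alg_aut_iff: "aut B h \<Longrightarrow> alg (h ` A) (map h e) \<longleftrightarrow> alg A e"
  using alg_aut[of B h A e] alg_aut[OF aut_inv, of B h "h ` A" "map h e"] aut_inv_map by metis

lemma definable_finite_part:
  assumes "X \<in> definable (D \<union> A) ss"
  obtains g where "set g \<subseteq> A" "X \<in> definable (D \<union> set g) ss"
proof -
  obtain b Z where b: "set b \<subseteq> D \<union> A" "Z \<in> definable0 (ss @ srts b)" "X = {a \<in> tuples ss. a @ b \<in> Z}" using assms by (rule definableE)
  have "set b \<subseteq> D \<union> set (filter (\<lambda>x. x \<in> A) b)" using b(1) by auto
  then have "X \<in> definable (D \<union> set (filter (\<lambda>x. x \<in> A) b)) ss" using b by (intro definableI) auto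
  then show ?thesis by (intro that[of "filter (\<lambda>x. x \<in> A) b"]) auto
qed

lemma alg_finite_part:
  assumes "alg (D \<union> A) e" obtains g where "set g \<subseteq> A" "alg (D \<union> set g) e"
  using assms unfolding alg_def by (metis definable_finite_part)

lemma definable_drop: "V \<in> definable A vs \<Longrightarrow> {c \<in> tuples (us @ vs). drop (length us) c \<in> V} \<in> definable A (us @ vs)"
  by (rule definable_sel[OF selects_drop])

lemma definable_take: "V \<in> definable A us \<Longrightarrow> {c \<in> tuples (us @ vs). take (length us) c \<in> V} \<in> definable A (us @ vs)"
  by (rule definable_sel[OF selects_take])

text \<open>
  If \<open>z\<close> lies in a fibre over \<open>u\<close> with fewer than \<open>N\<close> elements, the fibres with at least \<open>N\<close> elements
  can be removed from the definable set.
\<close>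

lemma alg_bound:
  assumes "alg (F \<union> set u) z"
  obtains W N where "W \<in> definable F (srts z @ srts u)" "z @ u \<in> W"
    "\<And>u'. srts u' = srts u \<Longrightarrow> \<not> atleast N {z'. z' @ u' \<in> W}"
proof -
  obtain X where X: "X \<in> definable (F \<union> set u) (srts z)" "z \<in> X" "finite X" using assms by (auto simp: alg_def)
  obtain V where V: "V \<in> definable F (srts z @ srts u)" "X = {a \<in> tuples (srts z). a @ u \<in> V}" using definable_unsubst[OF X(1)] by blast
  have fib: "srts z' = srts z" if "z' @ u' \<in> V" "srts u' = srts u" for z' u'
    using definable_sorts[OF V(1) that(1)] that(2) by (simp add: append_eq_append_conv)
  define N where "N = Suc (card X)"
  let ?L = "{v \<in> tuples (srts u). atleast N {z. z @ v \<in> V}}"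
  let ?W = "V - {c \<in> tuples (srts z @ srts u). drop (length (srts z)) c \<in> ?L}"
  have W: "?W \<in> definable F (srts z @ srts u)" by (intro definable_diff V(1) definable_drop definable_count[OF V(1)])
  have "{z'. z' @ u \<in> V} = X" using fib[of _ u] V(2) by auto
  then have "\<not> atleast N {z'. z' @ u \<in> V}" using X(3) by (simp add: atleast_finite N_def)
  then have 1: "z @ u \<in> ?W" using X(2) V(2) by simp
  have "\<not> atleast N {z'. z' @ u' \<in> ?W}" if u': "srts u' = srts u" for u'
  proof (cases "atleast N {z'. z' @ u' \<in> V}")
    case True
    have "z' @ u' \<notin> ?W" for z'
    proof
      assume z': "z' @ u' \<in> ?W"
      then have "srts z' = srts z" using fib u' by blast
      moreover from this have "length z' = length z" by (metis length_map)
      ultimately show False using z' True u' by simp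
    qed
    then have "{z'. z' @ u' \<in> ?W} = {}" by blast
    then show ?thesis by (simp only:) (simp add: atleast_finite N_def)
  next
    case False then show ?thesis using atleast_mono[of N "{z'. z' @ u' \<in> ?W}" "{z'. z' @ u' \<in> V}"] by auto
  qed
  then show ?thesis using that W 1 by blast
qed

section \<open>Thorn-dividing\<close>

text \<open>
  The base over which the formula strongly divides is \<open>C \<union> set d\<close>, and \<open>W\<close> is a single formula in the
  type of \<open>e\<close> that already forces \<open>k\<close>-inconsistency. Its existence is a consequence of
  compactness (\<open>k_inconsistent_uniform\<close>). Since only finitely many parameters occur in \<open>W\<close> and \<open>Z\<close>,
  a base that is finitely generated over \<open>C\<close> is general enough.
\<close>

definition strong_div :: "'m set \<Rightarrow> 'm list \<Rightarrow> 'm list \<Rightarrow> 's list \<Rightarrow> 'm list set \<Rightarrow> bool" where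
  "strong_div C d e ss Z \<longleftrightarrow> Z \<in> definable (C \<union> set d) (ss @ srts e) \<and> \<not> alg (C \<union> set d) e \<and>
     (\<exists>W\<in>definable (C \<union> set d) (srts e). \<exists>k. e \<in> W \<and> (\<forall>a\<in>tuples ss. \<not> atleast k {e' \<in> W. a @ e' \<in> Z}))"

definition thorn_div :: "'m set \<Rightarrow> 's list \<Rightarrow> 'm list set \<Rightarrow> bool" where
  "thorn_div C ss Y \<longleftrightarrow> (\<exists>d e Z. strong_div C d e ss Z \<and> Y = {a \<in> tuples ss. a @ e \<in> Z})"

lemma thorn_divE:
  assumes "thorn_div C ss Y"
  obtains d e Z W k where "Y = {a \<in> tuples ss. a @ e \<in> Z}" "Z \<in> definable (C \<union> set d) (ss @ srts e)"
    "\<not> alg (C \<union> set d) e" "W \<in> definable (C \<union> set d) (srts e)" "e \<in> W"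
    "\<And>a. srts a = ss \<Longrightarrow> \<not> atleast k {e' \<in> W. a @ e' \<in> Z}"
proof -
  obtain d e Z W k where *: "Y = {a \<in> tuples ss. a @ e \<in> Z}" "Z \<in> definable (C \<union> set d) (ss @ srts e)"
    "\<not> alg (C \<union> set d) e" "W \<in> definable (C \<union> set d) (srts e)" "e \<in> W"
    "\<forall>a\<in>tuples ss. \<not> atleast k {e' \<in> W. a @ e' \<in> Z}"
    using assms by (auto simp: thorn_div_def strong_div_def)
  show ?thesis using that[OF *(1-5), of k] *(6) by simp
qed

text \<open>
  A finite part of \<open>D\<close> contains all parameters of \<open>Z\<close> and \<open>W\<close>, and \<open>e\<close> remains nonalgebraic over a
  smaller set.
\<close>

lemma thorn_div_intro:
  assumes "C \<subseteq> D" and Z: "Z \<in> definable D (ss @ srts e)" and W: "W \<in> definable D (srts e)" "e \<in> W" and na: "\<not> alg D e"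
    and k: "\<And>a. srts a = ss \<Longrightarrow> \<not> atleast k {e' \<in> W. a @ e' \<in> Z}"
  shows "thorn_div C ss {a \<in> tuples ss. a @ e \<in> Z}"
proof -
  have D: "D = C \<union> D" using assms(1) by blast
  obtain g where g: "set g \<subseteq> D" "Z \<in> definable (C \<union> set g) (ss @ srts e)" using Z D definable_finite_part by metis
  obtain f where f: "set f \<subseteq> D" "W \<in> definable (C \<union> set f) (srts e)" using W D definable_finite_part by metis
  have "Z \<in> definable (C \<union> set (g @ f)) (ss @ srts e)" "W \<in> definable (C \<union> set (g @ f)) (srts e)"
    using definable_mono[OF g(2), of "C \<union> set (g @ f)"] definable_mono[OF f(2), of "C \<union> set (g @ f)"] by auto
  moreover have "\<not> alg (C \<union> set (g @ f)) e" using na alg_mono[of _ e D] g(1) f(1) assms(1) by auto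
  moreover have "\<forall>a\<in>tuples ss. \<not> atleast k {e' \<in> W. a @ e' \<in> Z}" using k by simp
  ultimately have "strong_div C (g @ f) e ss Z" using W(2) unfolding strong_div_def by (intro conjI bexI[of _ W] exI[of _ k])
  then show ?thesis unfolding thorn_div_def by blast
qed

lemma thorn_div_base: assumes "thorn_div D ss Y" "C \<subseteq> D" shows "thorn_div C ss Y"
proof -
  obtain d e Z W k where *: "Y = {a \<in> tuples ss. a @ e \<in> Z}" "Z \<in> definable (D \<union> set d) (ss @ srts e)"
    "\<not> alg (D \<union> set d) e" "W \<in> definable (D \<union> set d) (srts e)" "e \<in> W"
    "\<And>a. srts a = ss \<Longrightarrow> \<not> atleast k {e' \<in> W. a @ e' \<in> Z}" by (rule thorn_divE[OF assms(1)]) blast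
  show ?thesis unfolding *(1) by (rule thorn_div_intro[OF _ *(2,4,5,3,6)]) (use assms(2) in auto)
qed

lemma strong_div_aut:
  assumes h: "aut B h" and s: "strong_div C d e ss Z"
  shows "strong_div (h ` C) (map h d) (map h e) ss (map h ` Z)"
proof -
  obtain W k where W: "W \<in> definable (C \<union> set d) (srts e)" "e \<in> W" "\<forall>a\<in>tuples ss. \<not> atleast k {e' \<in> W. a @ e' \<in> Z}"
    and Z: "Z \<in> definable (C \<union> set d) (ss @ srts e)" and na: "\<not> alg (C \<union> set d) e" using s by (auto simp: strong_div_def)
  have im: "h ` (C \<union> set d) = h ` C \<union> set (map h d)" by auto
  have "\<not> atleast k {e' \<in> map h ` W. a @ e' \<in> map h ` Z}" if "srts a = ss" for a
  proof -
    have "{e' \<in> map h ` W. a @ e' \<in> map h ` Z} = map h ` {e' \<in> W. map (inv h) a @ e' \<in> Z}"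
      using mem_image_inv[OF h] aut_inv_map(1)[OF h] by auto
    moreover have "inj (map h)" using h by (auto simp: aut_def automorphism_def bij_def intro: inj_mapI)
    then have "atleast k (map h ` {e' \<in> W. map (inv h) a @ e' \<in> Z}) \<longleftrightarrow> atleast k {e' \<in> W. map (inv h) a @ e' \<in> Z}"
      by (rule atleast_image[OF inj_on_subset[OF _ subset_UNIV]])
    moreover have "map (inv h) a \<in> tuples ss" using aut_srts[OF aut_inv[OF h], of a] that by simp
    then have "\<not> atleast k {e' \<in> W. map (inv h) a @ e' \<in> Z}" using W(3) by blast
    ultimately show ?thesis by (simp only:) simp
  qed
  then have 1: "\<forall>a\<in>tuples ss. \<not> atleast k {e' \<in> map h ` W. a @ e' \<in> map h ` Z}" by simp
  have 2: "map h ` Z \<in> definable (h ` C \<union> set (map h d)) (ss @ srts (map h e))" "map h ` W \<in> definable (h ` C \<union> set (map h d)) (srts (map h e))"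
    using definable_aut[OF Z h] definable_aut[OF W(1) h] unfolding im aut_srts[OF h] by simp_all
  have 3: "\<not> alg (h ` C \<union> set (map h d)) (map h e)" using na alg_aut_iff[OF h, of "C \<union> set d" e] unfolding im by simp
  have 4: "map h e \<in> map h ` W" using W(2) by simp
  show ?thesis unfolding strong_div_def by (intro conjI bexI[OF _ 2(2)] exI[of _ k] 1 2(1) 3 4)
qed

lemma thorn_div_fibre_aut: "aut B h \<Longrightarrow> map h ` {a \<in> tuples ss. a @ e \<in> Z} = {a \<in> tuples ss. a @ map h e \<in> map h ` Z}"
proof -
  assume h: "aut B h"
  have "a @ map h e \<in> map h ` Z \<longleftrightarrow> map (inv h) a @ e \<in> Z" for a
    using mem_image_inv[OF h, of "a @ map h e" Z] aut_inv_map(1)[OF h, of e] by simp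
  then show ?thesis
    by (intro set_eqI) (simp only: mem_image_inv[OF h] mem_Collect_eq tuples_iff aut_srts[OF aut_inv[OF h]])
qed

lemma thorn_div_aut: "aut B h \<Longrightarrow> thorn_div C ss Y \<Longrightarrow> thorn_div (h ` C) ss (map h ` Y)"
proof -
  assume h: "aut B h" and "thorn_div C ss Y"
  then obtain d e Z where Y: "strong_div C d e ss Z" "Y = {a \<in> tuples ss. a @ e \<in> Z}" unfolding thorn_div_def by blast
  have "strong_div (h ` C) (map h d) (map h e) ss (map h ` Z)" by (rule strong_div_aut[OF h Y(1)])
  moreover have "map h ` Y = {a \<in> tuples ss. a @ map h e \<in> map h ` Z}" unfolding Y(2) by (rule thorn_div_fibre_aut[OF h])
  ultimately show ?thesis unfolding thorn_div_def by blast
qed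

text \<open>
  The formulas in the type of \<open>e\<close> are closed under conjunction, so monotonicity turns nonemptiness
  of the single sets \<open>K W\<close> into the finite intersection property.
\<close>

lemma type_compactness:
  assumes small: "small M A" and e: "\<And>W. W \<in> definable D (srts e) \<Longrightarrow> e \<in> W \<Longrightarrow> K W \<in> definable A ss \<and> K W \<noteq> {}"
    and mono: "\<And>W W'. W \<subseteq> W' \<Longrightarrow> K W \<subseteq> K W'"
  obtains a where "srts a = ss" "\<And>W. W \<in> definable D (srts e) \<Longrightarrow> e \<in> W \<Longrightarrow> a \<in> K W"
proof -
  let ?G = "{W \<in> definable D (srts e). e \<in> W}"
  have fip: "\<exists>a\<in>tuples ss. \<forall>X\<in>F. a \<in> X" if F: "F \<subseteq> K ` ?G" "finite F" for F
  proof -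
    obtain G where G: "G \<subseteq> ?G" "finite G" "F = K ` G" using finite_subset_image[OF F(2,1)] by blast
    let ?W = "{v \<in> tuples (srts e). \<forall>W\<in>G. v \<in> W}"
    have "?W \<in> definable D (srts e)" using G by (intro definable_INT) auto
    moreover have "e \<in> ?W" using G by auto
    ultimately have W: "K ?W \<in> definable A ss" "K ?W \<noteq> {}" using e by blast+
    then obtain a where a: "a \<in> K ?W" by blast
    have "K ?W \<subseteq> K W" if "W \<in> G" for W using that by (intro mono) blast
    then show ?thesis using a G(3) definable_sorts[OF W(1) a] by (intro bexI[of _ a]) auto
  qed
  have sub: "K ` ?G \<subseteq> definable A ss" using e by blast
  obtain a where a: "srts a = ss" "\<And>X. X \<in> K ` ?G \<Longrightarrow> a \<in> X"
    by (rule compactness[OF small sub fip]) blast+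
  show ?thesis by (rule that[OF a(1)]) (use a(2) in blast)
qed

lemma definable_fibre: "Z \<in> definable D (ss @ ts) \<Longrightarrow> srts a = ss \<Longrightarrow> {e \<in> tuples ts. a @ e \<in> Z} \<in> definable (D \<union> set a) ts"
proof -
  assume Z: "Z \<in> definable D (ss @ ts)" and a: "srts a = ss"
  have "{e \<in> tuples ts. e @ a \<in> {c \<in> tuples (ts @ ss). drop (length ts) c @ take (length ts) c \<in> Z}} \<in> definable (D \<union> set a) ts"
    by (rule definable_subst) (unfold a, rule definable_swap[OF Z])
  moreover have "{e \<in> tuples ts. e @ a \<in> {c \<in> tuples (ts @ ss). drop (length ts) c @ take (length ts) c \<in> Z}} = {e \<in> tuples ts. a @ e \<in> Z}"
    using a by (auto dest!: srts_length)
  ultimately show ?thesis by simp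
qed

text \<open>
  If every \<open>W\<close> in the type of \<open>e\<close> admits a fibre with \<open>k\<close> elements, then compactness finds one \<open>a\<close>
  which works for all \<open>W\<close>; a second application, over \<open>Da\<close>, finds \<open>k\<close> realizations of the whole type
  in the fibre of \<open>a\<close>.
\<close>

lemma k_inconsistent_uniform:
  assumes D: "small M D" and Z: "Z \<in> definable D (ss @ srts e)"
    and k: "\<And>a. srts a = ss \<Longrightarrow> \<not> atleast k {e'. same_type D e e' \<and> a @ e' \<in> Z}"
  obtains W where "W \<in> definable D (srts e)" "e \<in> W" "\<And>a. srts a = ss \<Longrightarrow> \<not> atleast k {e' \<in> W. a @ e' \<in> Z}"
proof (rule ccontr)
  note th = that
  assume nt: "\<not> thesis"
  have neg: "\<exists>a. srts a = ss \<and> atleast k {e' \<in> W. a @ e' \<in> Z}" if "W \<in> definable D (srts e)" "e \<in> W" for W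
    using th[OF that] nt by blast
  let ?n = "length (srts e)"
  let ?K = "\<lambda>W. {a \<in> tuples ss. atleast k {e' \<in> W. a @ e' \<in> Z}}"
  have K: "?K W \<in> definable D ss" if W: "W \<in> definable D (srts e)" for W
  proof -
    let ?X = "{c \<in> tuples (srts e @ ss). take ?n c \<in> W} \<inter> {c \<in> tuples (srts e @ ss). drop ?n c @ take ?n c \<in> Z}"
    have X: "?X \<in> definable D (srts e @ ss)" by (intro definable_inter definable_take definable_swap W Z)
    have "{e' \<in> W. a @ e' \<in> Z} = {z. z @ a \<in> ?X}" if a: "srts a = ss" for a
    proof -
      have 1: "srts z = srts e" if "z @ a \<in> ?X" for z
        using definable_sorts[OF X that] a by (simp add: append_eq_append_conv)
      have 2: "srts z = srts e" if "z \<in> W" for z by (rule definable_sorts[OF W that])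
      have "z \<in> W \<and> a @ z \<in> Z \<longleftrightarrow> z @ a \<in> ?X" for z
      proof (cases "srts z = srts e")
        case True
        then have "length z = length (srts e)" by (rule srts_length)
        then show ?thesis using True a by simp
      next
        case False then show ?thesis using 1 2 by blast
      qed
      then show ?thesis by blast
    qed
    then have "?K W = {v \<in> tuples ss. atleast k {z. z @ v \<in> ?X}}" by auto
    then show ?thesis using definable_count[OF X] by simp
  qed
  obtain a where a: "srts a = ss" "\<And>W. W \<in> definable D (srts e) \<Longrightarrow> e \<in> W \<Longrightarrow> a \<in> ?K W"
  proof (rule type_compactness[of D D e ?K ss])
    show "?K W \<in> definable D ss \<and> ?K W \<noteq> {}" if "W \<in> definable D (srts e)" "e \<in> W" for W using K[OF that(1)] neg[OF that] by auto
    show "?K W \<subseteq> ?K W'" if "W \<subseteq> W'" for W W'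
      using that by (auto elim!: atleast_mono)
  qed (use D in blast)+
  \<comment> \<open>\<open>?S\<close> is finite, so avoiding it is a condition with parameters from a small set.\<close>
  let ?S = "{e'. same_type D e e' \<and> a @ e' \<in> Z}"
  have fin: "finite ?S" "\<not> atleast k ?S" using k[OF a(1)] not_atleast_finite by blast+
  let ?A = "D \<union> set a \<union> (\<Union>e'\<in>?S. set e')"
  have sm: "small M ?A" using D fin(1) by (intro small_Un) auto
  let ?J = "\<lambda>W. {e' \<in> W. a @ e' \<in> Z} - ?S"
  have J: "?J W \<in> definable ?A (srts e)" if W: "W \<in> definable D (srts e)" for W
  proof -
    have 1: "{e' \<in> W. a @ e' \<in> Z} = W \<inter> {e' \<in> tuples (srts e). a @ e' \<in> Z}" using definable_sorts[OF W] by auto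
    have pt: "tuples (srts e) - {s} \<in> definable ?A (srts e)" if "s \<in> ?S" for s
    proof -
      have "srts s = srts e" using that by (simp add: same_type_def)
      moreover have "set s \<subseteq> ?A" using that by blast
      ultimately show ?thesis using definable_compl[OF definable_point[of s ?A]] by simp
    qed
    have 2: "{c \<in> tuples (srts e). \<forall>s\<in>?S. c \<in> tuples (srts e) - {s}} \<in> definable ?A (srts e)"
      by (rule definable_INT[OF fin(1) pt])
    have 3: "?J W = (W \<inter> {e' \<in> tuples (srts e). a @ e' \<in> Z}) \<inter> {c \<in> tuples (srts e). \<forall>s\<in>?S. c \<in> tuples (srts e) - {s}}"
      unfolding 1 by auto
    have 4: "{e' \<in> tuples (srts e). a @ e' \<in> Z} \<in> definable ?A (srts e)" using definable_mono[OF definable_fibre[OF Z a(1)]] by blast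
    have 5: "W \<in> definable ?A (srts e)" using definable_mono[OF W, of ?A] by blast
    show ?thesis unfolding 3 by (intro definable_inter 2 4 5)
  qed
  have ne: "?J W \<noteq> {}" if "W \<in> definable D (srts e)" "e \<in> W" for W
  proof
    assume "?J W = {}"
    then have "{e' \<in> W. a @ e' \<in> Z} \<subseteq> ?S" by blast
    then show False using atleast_mono fin(2) a(2)[OF that] by blast
  qed
  obtain e' where e': "srts e' = srts e" "\<And>W. W \<in> definable D (srts e) \<Longrightarrow> e \<in> W \<Longrightarrow> e' \<in> ?J W"
  proof (rule type_compactness[OF sm, of D e ?J "srts e"])
    show "?J W \<in> definable ?A (srts e) \<and> ?J W \<noteq> {}" if "W \<in> definable D (srts e)" "e \<in> W" for W using J[OF that(1)] ne[OF that] by blast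
    show "?J W \<subseteq> ?J W'" if "W \<subseteq> W'" for W W' using that by blast
  qed blast+
  have "e' \<in> ?J (tuples (srts e))" by (rule e'(2)[OF definable_top]) simp
  moreover have "same_type D e e'" using e' by (intro same_typeI) auto
  ultimately show False by blast
qed

text \<open>
  For a set \<open>Z\<close> with parameters \<open>b\<close> from \<open>D\<close>, the tuple \<open>e @ b\<close> is used in place of \<open>e\<close>. Its conjugates
  over \<open>D\<close> have the form \<open>e' @ b\<close>, so neither nonalgebraicity nor inconsistency is affected.
\<close>

lemma thorn_divides_iff:
  assumes C: "small M C"
  shows "(\<exists>\<theta>\<in>pforms_over M ss UNIV. thorn_divides M \<theta> C \<and> Y = {a. satisfies M a \<theta>}) \<longleftrightarrow> thorn_div C ss Y"
proof
  assume "\<exists>\<theta>\<in>pforms_over M ss UNIV. thorn_divides M \<theta> C \<and> Y = {a. satisfies M a \<theta>}"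
  then obtain \<theta> D where \<theta>: "\<theta> \<in> pforms_over M ss UNIV" "Y = {a. satisfies M a \<theta>}"
    and D: "C \<subseteq> D" "small M D" "strongly_divides M \<theta> D" by (auto simp: thorn_divides_def)
  then obtain \<phi> e where \<phi>: "\<theta> = PForm ss \<phi> e" "wf_fm M \<phi>" "fv \<phi> \<subseteq> tuple_vars (ss @ srts e)" by (auto simp: pforms_over_def)
  let ?Z = "{v \<in> tuples (ss @ srts e). holds M \<phi> v}"
  have Z: "?Z \<in> definable D (ss @ srts e)" using \<phi> by (intro definable0_definable) (auto simp: definable0_def)
  have na: "\<not> alg D e" using D(3) by (simp add: strongly_divides_def algebraic_over_iff \<phi>(1))
  obtain k where k: "k_inconsistent M k ss \<phi> {b'. same_type D e b'}"
    using D(3) by (auto simp: strongly_divides_def \<phi>(1) realizes_tp)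
  have "\<not> atleast k {e'. same_type D e e' \<and> a @ e' \<in> ?Z}" if a: "srts a = ss" for a
  proof
    assume "atleast k {e'. same_type D e e' \<and> a @ e' \<in> ?Z}"
    then obtain P where P: "P \<subseteq> {e'. same_type D e e' \<and> a @ e' \<in> ?Z}" "finite P" "card P = k" unfolding atleast_def by blast
    have "\<forall>b'\<in>P. satisfies M a (PForm ss \<phi> b')" using P(1) a by (auto simp: satisfies_def)
    moreover have "P \<subseteq> {b'. same_type D e b'}" using P(1) by blast
    ultimately show False using k a P(2,3) unfolding k_inconsistent_def by blast
  qed
  from k_inconsistent_uniform[OF D(2) Z this] obtain W where
    W: "W \<in> definable D (srts e)" "e \<in> W" "\<And>a. srts a = ss \<Longrightarrow> \<not> atleast k {e' \<in> W. a @ e' \<in> ?Z}" by blast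
  have "Y = {a \<in> tuples ss. a @ e \<in> ?Z}" by (auto simp: \<theta>(2) \<phi>(1) satisfies_def)
  then show "thorn_div C ss Y" using thorn_div_intro[OF D(1) Z W(1,2) na W(3)] by simp
next
  assume "thorn_div C ss Y"
  then obtain d e Z W k where Y: "Y = {a \<in> tuples ss. a @ e \<in> Z}" and Z: "Z \<in> definable (C \<union> set d) (ss @ srts e)"
    and na: "\<not> alg (C \<union> set d) e" and W: "W \<in> definable (C \<union> set d) (srts e)" "e \<in> W"
      "\<And>a. srts a = ss \<Longrightarrow> \<not> atleast k {e' \<in> W. a @ e' \<in> Z}" by (rule thorn_divE) blast
  let ?D = "C \<union> set d"
  obtain b Z0 where b: "set b \<subseteq> ?D" "Z0 \<in> definable0 ((ss @ srts e) @ srts b)" "Z = {a \<in> tuples (ss @ srts e). a @ b \<in> Z0}" using Z by (rule definableE)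
  then obtain \<phi> where \<phi>: "wf_fm M \<phi>" "fv \<phi> \<subseteq> tuple_vars ((ss @ srts e) @ srts b)" "Z0 = {v \<in> tuples ((ss @ srts e) @ srts b). holds M \<phi> v}"
    by (auto simp: definable0_def)
  let ?\<theta> = "PForm ss \<phi> (e @ b)"
  have sat: "satisfies M a (PForm ss \<phi> (e' @ b)) \<longleftrightarrow> srts a = ss \<and> a @ e' \<in> Z" if "srts e' = srts e" for a e'
    using that by (auto simp: satisfies_def b(3) \<phi>(3))
  have conj: "\<exists>e'. v = e' @ b \<and> same_type ?D e e'" if "same_type ?D (e @ b) v" for v
  proof -
    have 1: "same_type ?D e (take (length e) v)"
      using same_type_sel[OF that, of "srts e" "take (length e)"] selects_take[of "srts e" "srts b"] by simp
    have "same_type ?D b (drop (length e) v)"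
      using same_type_sel[OF that, of "srts b" "drop (length e)"] selects_drop[of "srts e" "srts b"] by simp
    then have "drop (length e) v = b" using b(1) by (rule same_type_point)
    then show ?thesis using 1 by (metis append_take_drop_id)
  qed
  have "\<not> alg ?D (e @ b)"
  proof
    assume "alg ?D (e @ b)"
    then obtain X where X: "X \<in> definable ?D (srts e @ srts b)" "e @ b \<in> X" "finite X" by (auto simp: alg_def)
    have "{v \<in> tuples (srts e). \<exists>w. v @ w \<in> X} \<in> definable ?D (srts e)" by (rule definable_ex[OF X(1)])
    moreover have "{v \<in> tuples (srts e). \<exists>w. v @ w \<in> X} \<subseteq> take (length e) ` X"
    proof
      fix v assume "v \<in> {v \<in> tuples (srts e). \<exists>w. v @ w \<in> X}"
      then obtain w where "v @ w \<in> X" "length v = length e" by (auto dest: srts_length)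
      then show "v \<in> take (length e) ` X" by (metis append_eq_conv_conj image_eqI)
    qed
    ultimately have "alg ?D e" using X(2,3) unfolding alg_def by (metis (mono_tags, lifting) finite_imageI finite_subset mem_Collect_eq tuples_iff)
    then show False using na by simp
  qed
  moreover have "k_inconsistent M k ss \<phi> {b'. same_type ?D (e @ b) b'}"
    unfolding k_inconsistent_def
  proof (intro allI impI notI, elim conjE exE)
    fix P a assume P: "P \<subseteq> {b'. same_type ?D (e @ b) b'}" "finite P" "card P = k" and a: "srts a = ss"
      "\<forall>b'\<in>P. satisfies M a (PForm ss \<phi> b')"
    have ex: "\<exists>e'. v = e' @ b \<and> same_type ?D e e'" if "v \<in> P" for v using conj P(1) that by blast
    have inj: "inj_on (take (length e)) P"
    proof (rule inj_onI)
      fix v w assume vw: "v \<in> P" "w \<in> P" "take (length e) v = take (length e) w"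
      obtain v' where v': "v = v' @ b" "same_type ?D e v'" using ex[OF vw(1)] by blast
      obtain w' where w': "w = w' @ b" "same_type ?D e w'" using ex[OF vw(2)] by blast
      have "length v' = length e" "length w' = length e" using v'(2) w'(2) by (metis same_type_def length_map)+
      then show "v = w" using vw v' w' by simp
    qed
    have "take (length e) ` P \<subseteq> {e' \<in> W. a @ e' \<in> Z}"
    proof
      fix x assume "x \<in> take (length e) ` P"
      then obtain v where v: "v \<in> P" "x = take (length e) v" by blast
      obtain v' where v': "v = v' @ b" "same_type ?D e v'" using ex[OF v(1)] by blast
      have l: "length v' = length e" "srts v' = srts e" using v'(2) by (metis same_type_def length_map, simp add: same_type_def)
      have "v' \<in> W" using same_typeD[OF v'(2) W(1)] W(2) by simp
      moreover have "a @ v' \<in> Z" using a(2) v(1) v'(1) sat[OF l(2)] by blast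
      ultimately show "x \<in> {e' \<in> W. a @ e' \<in> Z}" using v(2) v'(1) l(1) by simp
    qed
    then have "atleast k {e' \<in> W. a @ e' \<in> Z}" unfolding atleast_def
      using P card_image[OF inj] by (intro exI[of _ "take (length e) ` P"]) auto
    then show False using W(3) a(1) by simp
  qed
  ultimately have "strongly_divides M ?\<theta> ?D" by (auto simp: strongly_divides_def algebraic_over_iff realizes_tp)
  moreover have "small M ?D" using C by (intro small_Un) auto
  ultimately have "thorn_divides M ?\<theta> C" unfolding thorn_divides_def by blast
  moreover have "?\<theta> \<in> pforms_over M ss UNIV" using \<phi> by (auto simp: pforms_over_def)
  moreover have "Y = {a. satisfies M a ?\<theta>}" using sat[of e] Y by auto
  ultimately show "\<exists>\<theta>\<in>pforms_over M ss UNIV. thorn_divides M \<theta> C \<and> Y = {a. satisfies M a \<theta>}" by blast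
qed

definition forks :: "'m set \<Rightarrow> 's list \<Rightarrow> 'm list set \<Rightarrow> bool" where
  "forks C ss X \<longleftrightarrow> (\<exists>\<Y>. finite \<Y> \<and> (\<forall>Y\<in>\<Y>. thorn_div C ss Y) \<and> X \<subseteq> \<Union>\<Y>)"

lemma thorn_forks_iff:
  assumes C: "small M C" and \<psi>: "vsorts \<psi> = ss"
  shows "thorn_forks M \<psi> C \<longleftrightarrow> forks C ss {a. satisfies M a \<psi>}"
proof
  assume "thorn_forks M \<psi> C"
  then obtain \<Theta> where \<Theta>: "finite \<Theta>" "\<Theta> \<subseteq> pforms_over M ss UNIV" "\<forall>\<theta>\<in>\<Theta>. thorn_divides M \<theta> C"
        "\<forall>a. satisfies M a \<psi> \<longrightarrow> (\<exists>\<theta>\<in>\<Theta>. satisfies M a \<theta>)" using \<psi> by (auto simp: thorn_forks_def)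
  have "\<forall>Y\<in>(\<lambda>\<theta>. {a. satisfies M a \<theta>}) ` \<Theta>. thorn_div C ss Y" using thorn_divides_iff[OF C] \<Theta>(2,3) by blast
  then show "forks C ss {a. satisfies M a \<psi>}"
    unfolding forks_def using \<Theta>(1,4) by (intro exI[of _ "(\<lambda>\<theta>. {a. satisfies M a \<theta>}) ` \<Theta>"]) auto
next
  assume "forks C ss {a. satisfies M a \<psi>}"
  then obtain \<Y> where Y: "finite \<Y>" "\<And>Y. Y \<in> \<Y> \<Longrightarrow> thorn_div C ss Y" "{a. satisfies M a \<psi>} \<subseteq> \<Union>\<Y>" unfolding forks_def by blast
  have "\<exists>f. \<forall>Y\<in>\<Y>. f Y \<in> pforms_over M ss UNIV \<and> thorn_divides M (f Y) C \<and> Y = {a. satisfies M a (f Y)}"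
    by (rule bchoice) (use Y(2) thorn_divides_iff[OF C] in blast)
  then obtain f where f: "\<And>Y. Y \<in> \<Y> \<Longrightarrow> f Y \<in> pforms_over M ss UNIV \<and> thorn_divides M (f Y) C \<and> Y = {a. satisfies M a (f Y)}" by blast
  show "thorn_forks M \<psi> C" unfolding thorn_forks_def \<psi>
  proof (intro exI[of _ "f ` \<Y>"] conjI allI impI ballI)
    show "finite (f ` \<Y>)" using Y(1) by simp
    show "f ` \<Y> \<subseteq> pforms_over M ss UNIV" using f by blast
    show "\<theta> \<in> f ` \<Y> \<Longrightarrow> thorn_divides M \<theta> C" for \<theta> using f by blast
    fix a assume "satisfies M a \<psi>"
    then obtain Y where "Y \<in> \<Y>" "a \<in> Y" using Y(3) by blast
    then show "\<exists>\<theta>\<in>f ` \<Y>. satisfies M a \<theta>" using f[of Y] by blast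
  qed
qed

definition ind :: "'m list \<Rightarrow> 'm set \<Rightarrow> 'm set \<Rightarrow> bool" where
  "ind a C B \<longleftrightarrow> \<not> (\<exists>X\<in>definable (C \<union> B) (srts a). a \<in> X \<and> forks C (srts a) X)"

lemma type_thorn_forks_tp:
  assumes C: "small M C"
  shows "type_thorn_forks M (tp M a B) C \<longleftrightarrow> (\<exists>X\<in>definable B (srts a). a \<in> X \<and> forks C (srts a) X)"
proof -
  have "vsorts \<psi> = srts a" if "\<psi> \<in> pforms_over M (srts a) B" for \<psi> using that by (auto simp: pforms_over_def)
  then show ?thesis unfolding type_thorn_forks_def tp_def definable_pforms
    using thorn_forks_iff[OF C] by auto
qed

lemma indep_iff: "small M C \<Longrightarrow> indep M a C B \<longleftrightarrow> ind a C B"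
  unfolding indep_def ind_def using type_thorn_forks_tp by simp

section \<open>Extension and transitivity\<close>

lemma forks_Union:
  assumes "finite \<X>" "\<And>X. X \<in> \<X> \<Longrightarrow> forks C ss X" shows "forks C ss (\<Union>\<X>)"
proof -
  obtain f where f: "\<And>X. X \<in> \<X> \<Longrightarrow> finite (f X) \<and> (\<forall>Y\<in>f X. thorn_div C ss Y) \<and> X \<subseteq> \<Union>(f X)"
    using assms(2) unfolding forks_def by metis
  show ?thesis unfolding forks_def
  proof (intro exI[of _ "\<Union>(f ` \<X>)"] conjI ballI)
    show "finite (\<Union>(f ` \<X>))" using assms(1) f by simp
    show "thorn_div C ss Y" if "Y \<in> \<Union>(f ` \<X>)" for Y using that f by blast
    show "\<Union>\<X> \<subseteq> \<Union>(\<Union>(f ` \<X>))"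
    proof
      fix x assume "x \<in> \<Union>\<X>"
      then obtain X where X: "X \<in> \<X>" "x \<in> X" by blast
      then obtain Y where "Y \<in> f X" "x \<in> Y" using f[OF X(1)] by blast
      then show "x \<in> \<Union>(\<Union>(f ` \<X>))" using X(1) by blast
    qed
  qed
qed

lemma forks_subset: "forks C ss X \<Longrightarrow> X' \<subseteq> X \<Longrightarrow> forks C ss X'"
  unfolding forks_def by (meson order_trans)

lemma forks_thorn_div: "thorn_div C ss Y \<Longrightarrow> forks C ss Y"
  unfolding forks_def by (intro exI[of _ "{Y}"]) simp

lemma not_indI: "X \<in> definable (C \<union> B) (srts a) \<Longrightarrow> a \<in> X \<Longrightarrow> forks C (srts a) X \<Longrightarrow> \<not> ind a C B"
  unfolding ind_def by blast

lemma not_indE: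
  assumes "\<not> ind a C B"
  obtains X where "X \<in> definable (C \<union> B) (srts a)" "a \<in> X" "forks C (srts a) X"
  using assms unfolding ind_def by blast

lemma ind_mono: "ind a C B \<Longrightarrow> B' \<subseteq> C \<union> B \<Longrightarrow> ind a C B'"
  unfolding ind_def using definable_mono[of _ "C \<union> B'" _ "C \<union> B"] by blast

lemma ind_base: assumes "ind a C B" "C \<subseteq> D" "D \<subseteq> C \<union> B" shows "ind a D B"
proof (rule ccontr)
  assume "\<not> ind a D B"
  then obtain X where X: "X \<in> definable (D \<union> B) (srts a)" "a \<in> X" "forks D (srts a) X" by (rule not_indE)
  have "D \<union> B = C \<union> B" using assms by blast
  moreover have "forks C (srts a) X" using X(3) thorn_div_base[OF _ assms(2)] unfolding forks_def by blast
  ultimately show False using X assms(1) not_indI[of X C B a] by simp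
qed

lemma ind_finite:
  assumes "\<not> ind a C B" obtains b where "set b \<subseteq> B" "\<not> ind a C (set b)"
proof -
  obtain X where X: "X \<in> definable (C \<union> B) (srts a)" "a \<in> X" "forks C (srts a) X" using assms by (rule not_indE)
  obtain b where "set b \<subseteq> B" "X \<in> definable (C \<union> set b) (srts a)" using definable_finite_part[OF X(1)] by blast
  then show ?thesis using that not_indI X by blast
qed

lemma ind_aut1: assumes h: "aut A h" and i: "\<not> ind a C B" shows "\<not> ind (map h a) (h ` C) (h ` B)"
proof -
  obtain X where X: "X \<in> definable (C \<union> B) (srts a)" "a \<in> X" "forks C (srts a) X" using i by (rule not_indE)
  obtain \<Y> where Y: "finite \<Y>" "\<forall>Y\<in>\<Y>. thorn_div C (srts a) Y" "X \<subseteq> \<Union>\<Y>" using X(3) by (auto simp: forks_def)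
  show ?thesis
  proof (rule not_indI)
    show "map h ` X \<in> definable (h ` C \<union> h ` B) (srts (map h a))"
      unfolding aut_srts[OF h] image_Un[symmetric] by (rule definable_aut[OF X(1) h])
    show "map h a \<in> map h ` X" using X(2) by simp
    show "forks (h ` C) (srts (map h a)) (map h ` X)"
      unfolding aut_srts[OF h] forks_def
    proof (intro exI[of _ "(\<lambda>Y. map h ` Y) ` \<Y>"] conjI ballI)
      show "finite ((\<lambda>Y. map h ` Y) ` \<Y>)" using Y(1) by simp
      show "thorn_div (h ` C) (srts a) Y'" if "Y' \<in> (\<lambda>Y. map h ` Y) ` \<Y>" for Y' using that Y(2) thorn_div_aut[OF h] by auto
      show "map h ` X \<subseteq> \<Union>((\<lambda>Y. map h ` Y) ` \<Y>)" using Y(3) by (simp add: image_Union[symmetric] image_mono)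
    qed
  qed
qed

lemma ind_aut: "aut A h \<Longrightarrow> ind (map h a) (h ` C) (h ` B) \<longleftrightarrow> ind a C B"
  using ind_aut1[of A h a C B] ind_aut1[OF aut_inv, of A h "map h a" "h ` C" "h ` B"] aut_inv_map[of A h] by metis

text \<open>
  The preimage of a thorn-dividing set under a selector thorn-divides for the same reason, with the
  same parameters.
\<close>

lemma ind_left: assumes "ind a C B" "set a' \<subseteq> set a" shows "ind a' C B"
proof (rule ccontr)
  assume "\<not> ind a' C B"
  then obtain X where X: "X \<in> definable (C \<union> B) (srts a')" "a' \<in> X" "forks C (srts a') X" by (rule not_indE)
  obtain \<Y> where Y: "finite \<Y>" "\<forall>Y\<in>\<Y>. thorn_div C (srts a') Y" "X \<subseteq> \<Union>\<Y>" using X(3) by (auto simp: forks_def)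
  obtain ks where ks: "\<And>i. i \<in> set ks \<Longrightarrow> i < length a" "a' = map ((!) a) ks"
    using indices_of_sublist[OF assms(2)] by metis
  let ?f = "\<lambda>v. map ((!) v) ks"
  have kb: "map ((!) (srts a)) ks = srts a'" unfolding ks(2) using ks(1) by auto
  have f: "selects (srts a) (srts a') ?f" by (rule selects_list) (use ks(1) kb in auto)
  let ?p = "\<lambda>Y. {v \<in> tuples (srts a). ?f v \<in> Y}"
  have "thorn_div C (srts a) (?p Y)" if thorn_div: "thorn_div C (srts a') Y" for Y
  proof -
    obtain d e Z W k where Y: "Y = {a \<in> tuples (srts a'). a @ e \<in> Z}" and Z: "Z \<in> definable (C \<union> set d) (srts a' @ srts e)"
      and na: "\<not> alg (C \<union> set d) e" and W: "W \<in> definable (C \<union> set d) (srts e)" "e \<in> W"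
        "\<And>v. srts v = srts a' \<Longrightarrow> \<not> atleast k {e' \<in> W. v @ e' \<in> Z}" by (rule thorn_divE[OF thorn_div]) blast
    let ?g = "\<lambda>c. ?f (take (length (srts a)) c) @ drop (length (srts a)) c"
    let ?Z = "{c \<in> tuples (srts a @ srts e). ?g c \<in> Z}"
    have g: "selects (srts a @ srts e) (srts a' @ srts e) ?g"
      by (rule selects_append[OF selects_comp[OF selects_take f] selects_drop])
    have Z': "?Z \<in> definable (C \<union> set d) (srts a @ srts e)" by (rule definable_sel[OF g Z])
    have key: "v @ e' \<in> ?Z \<longleftrightarrow> srts e' = srts e \<and> ?f v @ e' \<in> Z" if "srts v = srts a" for v e'
    proof -
      have "length v = length (srts a)" using that by (rule srts_length)
      then show ?thesis using that by simp
    qed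
    have "\<not> atleast k {e' \<in> W. v @ e' \<in> ?Z}" if v: "srts v = srts a" for v
    proof
      assume "atleast k {e' \<in> W. v @ e' \<in> ?Z}"
      moreover have "{e' \<in> W. v @ e' \<in> ?Z} \<subseteq> {e' \<in> W. ?f v @ e' \<in> Z}" using key[OF v] by blast
      ultimately have "atleast k {e' \<in> W. ?f v @ e' \<in> Z}" by (rule atleast_mono)
      then show False using W(3) selects_sorts[OF f v] by simp
    qed
    from thorn_div_intro[OF _ Z' W(1,2) na this, of C]
    have "thorn_div C (srts a) {v \<in> tuples (srts a). v @ e \<in> ?Z}" by blast
    moreover have "{v \<in> tuples (srts a). v @ e \<in> ?Z} = ?p Y" using key[of _ e] selects_sorts[OF f] Y by auto
    ultimately show ?thesis by simp
  qed
  then have "forks C (srts a) (?p X)" unfolding forks_def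
    by (intro exI[of _ "?p ` \<Y>"]) (use Y in auto)
  moreover have "?p X \<in> definable (C \<union> B) (srts a)" by (rule definable_sel[OF f X(1)])
  moreover have "a \<in> ?p X" using X(2) ks(2) by simp
  ultimately show False using assms(1) not_indI by blast
qed

lemma local_character:
  assumes "small M B" obtains B0 where "B0 \<subseteq> B" "|B0| \<le>o |T|" "ind a B0 B"
proof -
  obtain B0 where B: "B0 \<subseteq> B" "|B0| \<le>o |T|" "indep M a B0 B" using rosy assms unfolding rosy_def by blast
  then show ?thesis using that indep_iff[OF small_le_T[OF B(2)]] by blast
qed

text \<open>
  Local character provides a subset of \<open>C\<close> over which \<open>a\<close> is independent from \<open>C\<close>, and this base may
  be enlarged to \<open>C\<close>.
\<close>

lemma ind_self: assumes "small M C" shows "ind a C C"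
proof -
  obtain C0 where C: "C0 \<subseteq> C" "ind a C0 C" using local_character[OF assms] by metis
  then show ?thesis using ind_base[of a C0 C C] by blast
qed

text \<open>
  Otherwise, by compactness, a formula in the type of \<open>a\<close> over \<open>CB\<close> would imply a finite disjunction of
  formulas that fork over \<open>C\<close>, and so would fork itself.
\<close>

lemma extension:
  assumes sm: "small M C" "small M B" "small M B'" and i: "ind a C B"
  obtains a' where "same_type (C \<union> B) a a'" "ind a' C (B \<union> B')"
proof -
  let ?s = "srts a" and ?A = "C \<union> (B \<union> B')"
  let ?F1 = "{W \<in> definable (C \<union> B) ?s. a \<in> W}"
  let ?V = "{V \<in> definable ?A ?s. forks C ?s V}"
  let ?F2 = "(\<lambda>V. tuples ?s - V) ` ?V"
  have sA: "small M ?A" using sm by (intro small_Un)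
  have sub: "?F1 \<union> ?F2 \<subseteq> definable ?A ?s"
  proof -
    have "?F1 \<subseteq> definable ?A ?s" using definable_mono[of _ "C \<union> B" ?s ?A] by blast
    then show ?thesis using definable_compl by blast
  qed
  have fip: "\<exists>v\<in>tuples ?s. \<forall>X\<in>F. v \<in> X" if F: "F \<subseteq> ?F1 \<union> ?F2" "finite F" for F
  proof (rule ccontr)
    assume no: "\<not> ?thesis"
    have fin: "finite (F \<inter> ?F2)" using F(2) by (rule finite_Int[OF disjI1])
    from finite_subset_image[OF fin Int_lower2] obtain G where G: "G \<subseteq> ?V" "finite G" "F \<inter> ?F2 = (\<lambda>V. tuples ?s - V) ` G"
      by blast
    let ?X = "{v \<in> tuples ?s. \<forall>X\<in>F \<inter> ?F1. v \<in> X}"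
    have X: "?X \<in> definable (C \<union> B) ?s" using F by (intro definable_INT) auto
    have "?X \<subseteq> \<Union>G"
    proof
      fix v assume v: "v \<in> ?X"
      then obtain Y where Y: "Y \<in> F" "v \<notin> Y" using no by blast
      then have "Y \<in> F \<inter> ?F2" using v F(1) by blast
      then show "v \<in> \<Union>G" using G(3) Y(2) v by auto
    qed
    moreover have "forks C ?s (\<Union>G)" using G by (intro forks_Union) auto
    ultimately have "forks C ?s ?X" using forks_subset by blast
    moreover have "a \<in> ?X" using F by auto
    ultimately show False using X i not_indI by blast
  qed
  obtain a' where a': "srts a' = ?s" "\<And>X. X \<in> ?F1 \<union> ?F2 \<Longrightarrow> a' \<in> X"
    by (rule compactness[OF sA sub fip]) blast+
  have "same_type (C \<union> B) a a'" using a' by (intro same_typeI) auto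
  moreover have "ind a' C (B \<union> B')"
  proof (rule ccontr)
    assume "\<not> ind a' C (B \<union> B')"
    then obtain X where X: "X \<in> definable ?A ?s" "a' \<in> X" "forks C ?s X" using a'(1) by (metis not_indE)
    then have "tuples ?s - X \<in> ?F1 \<union> ?F2" by blast
    then show False using a'(2) X(2) by blast
  qed
  ultimately show ?thesis using that by blast
qed

text \<open>
  Let \<open>e\<close> lie in the fibre over \<open>g\<close> of a set that is definable over \<open>D\<close> and has bounded fibres. Read
  as a condition on \<open>g\<close> with parameter \<open>e\<close>, this strongly divides over \<open>D\<close>: every \<open>g'\<close> satisfies
  boundedly many conjugates of it.
\<close>

lemma alg_fork:
  assumes "alg (D \<union> set g) e" "\<not> alg D e" "C \<subseteq> D" "D \<union> set e \<subseteq> C \<union> B"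
  shows "\<not> ind g C B"
proof -
  obtain V N where V: "V \<in> definable D (srts e @ srts g)" "e @ g \<in> V"
    "\<And>u'. srts u' = srts g \<Longrightarrow> \<not> atleast N {z'. z' @ u' \<in> V}" using alg_bound[OF assms(1)] by metis
  let ?Z = "{c \<in> tuples (srts g @ srts e). drop (length (srts g)) c @ take (length (srts g)) c \<in> V}"
  have Z: "?Z \<in> definable D (srts g @ srts e)" by (rule definable_swap[OF V(1)])
  have key: "v @ e' \<in> ?Z \<longleftrightarrow> srts e' = srts e \<and> e' @ v \<in> V" if "srts v = srts g" for v e'
  proof -
    have "length v = length (srts g)" using that by (rule srts_length)
    then show ?thesis using that by auto
  qed
  have b: "\<not> atleast N {e' \<in> tuples (srts e). v @ e' \<in> ?Z}" if v: "srts v = srts g" for v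
  proof
    assume "atleast N {e' \<in> tuples (srts e). v @ e' \<in> ?Z}"
    moreover have "{e' \<in> tuples (srts e). v @ e' \<in> ?Z} \<subseteq> {z'. z' @ v \<in> V}" using key[OF v] by blast
    ultimately have "atleast N {z'. z' @ v \<in> V}" by (rule atleast_mono)
    then show False using V(3)[OF v] by blast
  qed
  have thorn_div: "thorn_div C (srts g) {v \<in> tuples (srts g). v @ e \<in> ?Z}"
    by (rule thorn_div_intro[OF assms(3) Z definable_top _ assms(2) b]) simp_all
  have "{v \<in> tuples (srts g). v @ e \<in> ?Z} \<in> definable (D \<union> set e) (srts g)" by (rule definable_subst[OF Z])
  then have "{v \<in> tuples (srts g). v @ e \<in> ?Z} \<in> definable (C \<union> B) (srts g)" using assms(4) by (rule definable_mono)
  moreover have "g \<in> {v \<in> tuples (srts g). v @ e \<in> ?Z}" using key[of g e] V(2) by simp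
  ultimately show ?thesis using forks_thorn_div[OF thorn_div] not_indI by blast
qed

text \<open>
  A finite tuple \<open>f\<close> is moved in place of \<open>A\<close>, which may therefore be infinite. Whether a formula with
  parameters \<open>f\<close> forks over \<open>C\<close> depends on the type of \<open>f\<close> over \<open>CB\<close> only, so the requirements on \<open>f'\<close>
  amount to a set of formulas. Finitely many of them mention a finite tuple from \<open>A\<close>; \<open>extension\<close>
  moves that tuple away from \<open>f\<close>, and the inverse automorphism moves \<open>f\<close> away from it.
\<close>

lemma extension_right:
  assumes sm: "small M C" "small M B" "small M A" and i: "\<And>a. set a \<subseteq> A \<Longrightarrow> ind a C B"
  obtains f' where "same_type (C \<union> B) f f'" "\<And>a. set a \<subseteq> A \<Longrightarrow> ind a C (B \<union> set f')"
proof -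
  let ?s = "srts f" and ?D = "C \<union> B"
  let ?F1 = "{W \<in> definable ?D ?s. f \<in> W}"
  let ?P = "{(a, V). set a \<subseteq> A \<and> V \<in> definable ?D (srts a @ ?s) \<and> forks C (srts a) {x \<in> tuples (srts a). x @ f \<in> V}}"
  let ?K = "\<lambda>(a, V). {v \<in> tuples ?s. a @ v \<notin> V}"
  have sA: "small M (?D \<union> A)" using sm by (intro small_Un)
  have K: "?K p \<in> definable (?D \<union> A) ?s" if "p \<in> ?P" for p
  proof -
    obtain a V where p: "p = (a, V)" by (cases p)
    with that have p: "p = (a, V)" "set a \<subseteq> A" "V \<in> definable ?D (srts a @ ?s)" by auto
    have "{v \<in> tuples ?s. a @ v \<in> V} \<in> definable (?D \<union> set a) ?s" using p(3) by (rule definable_fibre) simp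
    then have "{v \<in> tuples ?s. a @ v \<in> V} \<in> definable (?D \<union> A) ?s" by (rule definable_mono) (use p(2) in blast)
    moreover have "?K p = tuples ?s - {v \<in> tuples ?s. a @ v \<in> V}" using p(1) by auto
    ultimately show ?thesis using definable_compl by simp
  qed
  have sub: "?F1 \<union> ?K ` ?P \<subseteq> definable (?D \<union> A) ?s"
  proof -
    have "?F1 \<subseteq> definable (?D \<union> A) ?s" using definable_mono[of _ ?D ?s "?D \<union> A"] by blast
    moreover have "?K ` ?P \<subseteq> definable (?D \<union> A) ?s" using K by (rule image_subsetI)
    ultimately show ?thesis by (rule Un_least)
  qed
  have fip: "\<exists>v\<in>tuples ?s. \<forall>X\<in>F. v \<in> X" if F: "F \<subseteq> ?F1 \<union> ?K ` ?P" "finite F" for F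
  proof -
    have fin: "finite (F \<inter> ?K ` ?P)" using F(2) by (rule finite_Int[OF disjI1])
    obtain G where "G \<subseteq> ?P \<and> finite G \<and> F \<inter> ?K ` ?P = ?K ` G"
      using finite_subset_image[OF fin Int_lower2] by (rule exE)
    note G = this[THEN conjunct1] this[THEN conjunct2, THEN conjunct1] this[THEN conjunct2, THEN conjunct2]
    obtain ps where ps: "set ps = G" using finite_list[OF G(2)] by blast
    let ?a = "concat (map fst ps)"
    have sa: "set a \<subseteq> set ?a" if "(a, V) \<in> G" for a V using that ps by force
    have "set ?a \<subseteq> A" using G(1) ps by fastforce
    then have "ind ?a C B" by (rule i)
    then obtain a' where a': "same_type ?D ?a a'" "ind a' C (B \<union> set f)" using extension[OF sm(1,2), of "set f"] by auto
    have "small M ?D" using sm by (intro small_Un)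
    then obtain h where h: "aut ?D h" "map h ?a = a'" using same_type_aut[OF _ a'(1)] by blast
    let ?v = "map (inv h) f"
    have "?v \<in> X" if X: "X \<in> F" for X
    proof (cases "X \<in> ?F1")
      case True
      then have "X \<in> definable ?D ?s" "f \<in> X" by simp_all
      then show ?thesis using definable_aut_fix[OF _ aut_inv[OF h(1)], of X ?s f] by simp
    next
      case False
      have "X \<in> ?K ` ?P" using subsetD[OF F(1) X]
      proof (rule UnE)
        assume "X \<in> ?F1"
        with False show "X \<in> ?K ` ?P" by (rule notE)
      qed
      then have "X \<in> F \<inter> ?K ` ?P" using X by (rule_tac IntI)
      then have "X \<in> ?K ` G" by (simp only: G(3))
      then obtain p where p: "p \<in> G" "X = ?K p" by (rule imageE)
      obtain a V where "p = (a, V)" by (cases p)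
      with p have aV: "(a, V) \<in> G" "X = ?K (a, V)" by simp_all
      have "(a, V) \<in> ?P" using subsetD[OF G(1) aV(1)] .
      then have V: "V \<in> definable ?D (srts a @ ?s)" and fk: "forks C (srts a) {x \<in> tuples (srts a). x @ f \<in> V}" by simp_all
      have "ind (map h a) C (B \<union> set f)"
        by (rule ind_left[OF a'(2)]) (use sa[OF aV(1)] h(2) in \<open>auto simp flip: h(2)\<close>)
      moreover have "{x \<in> tuples (srts a). x @ f \<in> V} \<in> definable (C \<union> (B \<union> set f)) (srts a)"
        using definable_subst[OF V] by (simp add: Un_assoc)
      ultimately have "map h a \<notin> {x \<in> tuples (srts a). x @ f \<in> V}"
        using not_indI[of "{x \<in> tuples (srts a). x @ f \<in> V}" C "B \<union> set f" "map h a"] fk aut_srts[OF h(1), of a] by metis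
      then have "map h a @ f \<notin> V" using aut_srts[OF h(1), of a] by simp
      then have "map h (a @ ?v) \<notin> V" using aut_inv_map(2)[OF h(1), of f] by (simp del: map_map)
      then have "a @ ?v \<notin> V" using definable_aut_fix[OF V h(1)] by blast
      then show ?thesis using aut_srts[OF aut_inv[OF h(1)], of f] aV(2) by (simp del: map_map)
    qed
    then show ?thesis using aut_srts[OF aut_inv[OF h(1)], of f] by (intro bexI[of _ ?v]) (auto simp del: map_map)
  qed
  obtain f' where f': "srts f' = ?s" "\<And>X. X \<in> ?F1 \<union> ?K ` ?P \<Longrightarrow> f' \<in> X"
    by (rule compactness[OF sA sub fip]) blast+
  have e: "same_type ?D f f'" using f' by (intro same_typeI) auto
  have sD: "small M ?D" using sm by (intro small_Un)
  obtain h where h: "aut ?D h" "map h f = f'" using same_type_aut[OF sD e] by blast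
  have "ind a C (B \<union> set f')" if a: "set a \<subseteq> A" for a
  proof (rule ccontr)
    assume "\<not> ind a C (B \<union> set f')"
    then obtain X where X: "X \<in> definable (C \<union> (B \<union> set f')) (srts a)" "a \<in> X" "forks C (srts a) X" by (rule not_indE)
    have "X \<in> definable (?D \<union> set f') (srts a)" using X(1) by (simp add: Un_assoc)
    from definable_unsubst[OF this] obtain V where V: "V \<in> definable ?D (srts a @ ?s)" "X = {x \<in> tuples (srts a). x @ f' \<in> V}"
      unfolding f'(1) by blast
    have "map (inv h) ` X = {x \<in> tuples (srts a). x @ f \<in> V}"
    proof (rule set_eqI)
      fix x
      have "x \<in> map (inv h) ` X \<longleftrightarrow> map h x \<in> X"
        using map_mem_image[OF aut_inv[OF h(1)], of "map h x" X] aut_inv_map(1)[OF h(1), of x] by simp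
      also have "\<dots> \<longleftrightarrow> srts x = srts a \<and> map h (x @ f) \<in> V" using h(2) aut_srts[OF h(1), of x] V(2) by (simp del: map_map)
      also have "\<dots> \<longleftrightarrow> x \<in> {x \<in> tuples (srts a). x @ f \<in> V}" using definable_aut_fix[OF V(1) h(1), of "x @ f"] by simp
      finally show "x \<in> map (inv h) ` X \<longleftrightarrow> x \<in> {x \<in> tuples (srts a). x @ f \<in> V}" .
    qed
    moreover have "forks C (srts a) (map (inv h) ` X)"
    proof -
      obtain \<Y> where Y: "finite \<Y>" "\<forall>Y\<in>\<Y>. thorn_div C (srts a) Y" "X \<subseteq> \<Union>\<Y>" using X(3) by (auto simp: forks_def)
      have C: "inv h ` C = C" using aut_image[OF aut_inv[OF h(1)]] by blast
      have "thorn_div C (srts a) (map (inv h) ` Y)" if "Y \<in> \<Y>" for Y using thorn_div_aut[OF aut_inv[OF h(1)], of C "srts a" Y] Y(2) that C by simp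
      moreover have "map (inv h) ` X \<subseteq> \<Union>((\<lambda>Y. map (inv h) ` Y) ` \<Y>)" using Y(3) by (simp add: image_Union[symmetric] image_mono)
      ultimately show ?thesis unfolding forks_def using Y(1) by (intro exI[of _ "(\<lambda>Y. map (inv h) ` Y) ` \<Y>"]) simp
    qed
    ultimately have "(a, V) \<in> ?P" using a V(1) by simp
    then have "?K (a, V) \<in> ?F1 \<union> ?K ` ?P" by blast
    then have "f' \<in> ?K (a, V)" by (rule f'(2))
    then show False using X(2) V(2) by simp
  qed
  then show ?thesis using that e by blast
qed

text \<open>
  The parameters of the finitely many thorn-dividing sets are listed in one tuple \<open>f\<close>; the image of
  \<open>f\<close> under an automorphism over \<open>C\<close> plays the same role for the image of \<open>X\<close>.
\<close>

lemma forks_parameters: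
  assumes "forks C ss X"
  obtains f where "\<And>h x. aut C h \<Longrightarrow> map (inv h) x \<in> X \<Longrightarrow>
     \<exists>d e Z. set d \<union> set e \<subseteq> set (map h f) \<and> strong_div C d e ss Z \<and> x @ e \<in> Z \<and> srts x = ss"
proof -
  obtain \<Y> where Y: "finite \<Y>" "\<forall>Y\<in>\<Y>. thorn_div C ss Y" "X \<subseteq> \<Union>\<Y>" using assms by (auto simp: forks_def)
  have "\<exists>q. case q of (d, e, Z) \<Rightarrow> strong_div C d e ss Z \<and> Y = {a \<in> tuples ss. a @ e \<in> Z}" if "Y \<in> \<Y>" for Y
  proof -
    have "thorn_div C ss Y" using Y(2) that by blast
    then show ?thesis unfolding thorn_div_def
    proof (elim exE)
      fix d e Z assume *: "strong_div C d e ss Z \<and> Y = {a \<in> tuples ss. a @ e \<in> Z}"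
      show ?thesis by (rule exI[of _ "(d, e, Z)"]) (unfold prod.case, rule *)
    qed
  qed
  then have "\<forall>Y\<in>\<Y>. \<exists>q. case q of (d, e, Z) \<Rightarrow> strong_div C d e ss Z \<and> Y = {a \<in> tuples ss. a @ e \<in> Z}" by (rule ballI)
  from bchoice[OF this] obtain p where "\<forall>Y\<in>\<Y>. case p Y of (d, e, Z) \<Rightarrow> strong_div C d e ss Z \<and> Y = {a \<in> tuples ss. a @ e \<in> Z}"
    by (rule exE)
  note p = bspec[OF this]
  obtain ys where ys: "set ys = \<Y>" using finite_list[OF Y(1)] by blast
  let ?f = "concat (map (\<lambda>Y. case p Y of (d, e, Z) \<Rightarrow> d @ e) ys)"
  have "\<exists>d e Z. set d \<union> set e \<subseteq> set (map h ?f) \<and> strong_div C d e ss Z \<and> x @ e \<in> Z \<and> srts x = ss"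
    if h: "aut C h" and x: "map (inv h) x \<in> X" for h x
  proof -
    obtain Yy where Yy: "Yy \<in> \<Y>" "map (inv h) x \<in> Yy" using x Y(3) by blast
    obtain d e Z where deZ: "p Yy = (d, e, Z)" by (cases "p Yy")
    then have s: "strong_div C d e ss Z" "Yy = {a \<in> tuples ss. a @ e \<in> Z}" using p[OF Yy(1)] by auto
    have "set (d @ e) \<subseteq> set ?f" using Yy(1) ys deZ by force
    then have 1: "set (map h d) \<union> set (map h e) \<subseteq> set (map h ?f)"
      unfolding set_map image_Un[symmetric] by (intro image_mono) simp
    have 2: "strong_div C (map h d) (map h e) ss (map h ` Z)" using strong_div_aut[OF h s(1)] aut_image[OF h order_refl] by simp
    have "x \<in> map h ` Yy" using mem_image_inv[OF h] Yy(2) by blast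
    then have "x \<in> {a \<in> tuples ss. a @ map h e \<in> map h ` Z}" unfolding s(2) thorn_div_fibre_aut[OF h] .
    then have 3: "x @ map h e \<in> map h ` Z" "srts x = ss" by simp_all
    show ?thesis by (rule exI[of _ "map h d"], rule exI[of _ "map h e"], rule exI[of _ "map h ` Z"]) (intro conjI 1 2 3)
  qed
  then show ?thesis by (rule that)
qed

text \<open>
  If the type of \<open>aa'\<close> over \<open>CB\<close> forks over \<open>C\<close>, then by extension the parameters involved may be
  assumed to be independent from \<open>A\<close> over \<open>C\<close>, and from \<open>a'\<close> over \<open>CA\<close>. One of the
  strongly dividing formulas, say \<open>\<theta>(x, y, e)\<close> over \<open>D\<close>, holds of \<open>aa'\<close>. Depending on
  whether \<open>e\<close> is algebraic over \<open>DA\<close>, this contradicts the independence of \<open>A\<close> (by \<open>alg_fork\<close>) or of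
  \<open>a'\<close> (because \<open>\<theta>(a, y, e)\<close> still strongly divides over \<open>DA\<close>).
\<close>

lemma transitivity_left:
  assumes sm: "small M C" "small M A" "small M B" and i: "\<And>a. set a \<subseteq> A \<Longrightarrow> ind a C B"
    and j: "ind a' (C \<union> A) B" and a: "set a \<subseteq> A"
  shows "ind (a @ a') C B"
proof (rule ccontr)
  assume "\<not> ind (a @ a') C B"
  then obtain X where X: "X \<in> definable (C \<union> B) (srts (a @ a'))" "a @ a' \<in> X" "forks C (srts (a @ a')) X" by (rule not_indE)
  obtain f0 where f0: "\<And>h x. aut C h \<Longrightarrow> map (inv h) x \<in> X \<Longrightarrow>
     \<exists>d e Z. set d \<union> set e \<subseteq> set (map h f0) \<and> strong_div C d e (srts (a @ a')) Z \<and> x @ e \<in> Z \<and> srts x = srts (a @ a')"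
    by (rule forks_parameters[OF X(3)]) blast
  have sm2: "small M (C \<union> B)" "small M (C \<union> A)" "small M (C \<union> A \<union> B)" using sm by (auto intro!: small_Un)
  obtain f where f: "same_type (C \<union> B) f0 f" "\<And>a. set a \<subseteq> A \<Longrightarrow> ind a C (B \<union> set f)"
    by (rule extension_right[OF sm(1,3,2) i]) blast+
  obtain h where h: "aut (C \<union> B) h" "map h f0 = f" using same_type_aut[OF sm2(1) f(1)] by blast
  have hC: "aut C h" using h(1) by (rule aut_mono) blast
  obtain a'' where a'': "same_type (C \<union> A \<union> B) a' a''" "ind a'' (C \<union> A) (B \<union> set f)"
    using extension[OF sm2(2) sm(3) small_finite[OF finite_set] j] by blast
  obtain g where g: "aut (C \<union> A \<union> B) g" "map g a' = a''" using same_type_aut[OF sm2(3) a''(1)] by blast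
  have "map g a = a" using aut_map[OF g(1)] a by blast
  then have "map g (a @ a') = a @ a''" using g(2) by simp
  moreover have "aut (C \<union> B) g" using g(1) by (rule aut_mono) blast
  then have "map g (a @ a') \<in> X" using definable_aut_fix[OF X(1)] X(2) by blast
  ultimately have "a @ a'' \<in> X" by simp
  then have "map (inv h) (a @ a'') \<in> X" using definable_aut_fix[OF X(1) aut_inv[OF h(1)]] by blast
  from f0[OF hC this] obtain d e Z where deZ: "set d \<union> set e \<subseteq> set f" "strong_div C d e (srts (a @ a')) Z" "(a @ a'') @ e \<in> Z"
    unfolding h(2) by blast
  let ?D = "C \<union> set d"
  obtain W k where Z: "Z \<in> definable ?D (srts (a @ a') @ srts e)" and na: "\<not> alg ?D e"
    and W: "W \<in> definable ?D (srts e)" "e \<in> W" "\<forall>v\<in>tuples (srts (a @ a')). \<not> atleast k {e' \<in> W. v @ e' \<in> Z}"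
    using deZ(2) by (auto simp: strong_div_def)
  show False
  proof (cases "alg (?D \<union> A) e")
    case True
    then obtain g where g: "set g \<subseteq> A" "alg (?D \<union> set g) e" by (rule alg_finite_part)
    have "\<not> ind g C (B \<union> set f)" by (rule alg_fork[OF g(2) na]) (use deZ(1) in auto)
    then show False using f(2)[OF g(1)] by blast
  next
    case False
    let ?Z = "{c \<in> tuples (srts a' @ srts e). a @ c \<in> Z}"
    have "?Z \<in> definable (?D \<union> set a) (srts a' @ srts e)" by (rule definable_fibre[of Z _ "srts a"]) (use Z in simp_all)
    then have Z': "?Z \<in> definable (?D \<union> A) (srts a' @ srts e)" by (rule definable_mono) (use a in blast)
    have W': "W \<in> definable (?D \<union> A) (srts e)" using W(1) by (rule definable_mono) blast
    have b: "\<not> atleast k {e' \<in> W. y @ e' \<in> ?Z}" if y: "srts y = srts a'" for y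
    proof
      assume "atleast k {e' \<in> W. y @ e' \<in> ?Z}"
      moreover have "{e' \<in> W. y @ e' \<in> ?Z} \<subseteq> {e' \<in> W. (a @ y) @ e' \<in> Z}" by auto
      ultimately have "atleast k {e' \<in> W. (a @ y) @ e' \<in> Z}" by (rule atleast_mono)
      moreover have "a @ y \<in> tuples (srts (a @ a'))" using y by simp
      ultimately show False using W(3) by blast
    qed
    have thorn_div: "thorn_div (C \<union> A) (srts a') {y \<in> tuples (srts a'). y @ e \<in> ?Z}"
      by (rule thorn_div_intro[OF _ Z' W' W(2) False b]) auto
    have s: "srts a'' = srts a'" using a''(1) by (simp add: same_type_def)
    have "{y \<in> tuples (srts a'). y @ e \<in> ?Z} \<in> definable (?D \<union> A \<union> set e) (srts a')" by (rule definable_subst[OF Z'])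
    then have "{y \<in> tuples (srts a'). y @ e \<in> ?Z} \<in> definable (C \<union> A \<union> (B \<union> set f)) (srts a'')" unfolding s
      by (rule definable_mono) (use deZ(1) in auto)
    moreover have "a'' \<in> {y \<in> tuples (srts a'). y @ e \<in> ?Z}" using s deZ(3) by simp
    moreover have "forks (C \<union> A) (srts a'') {y \<in> tuples (srts a'). y @ e \<in> ?Z}" unfolding s by (rule forks_thorn_div[OF thorn_div])
    ultimately have "\<not> ind a'' (C \<union> A) (B \<union> set f)" by (rule not_indI)
    then show False using a''(2) by blast
  qed
qed

text \<open>
  If there is no such \<open>E\<close>, tuples \<open>c\<^sub>i\<close> can be chosen for all \<open>i < |T|\<^sup>+\<close> such that \<open>b\<close> depends on \<open>c\<^sub>i\<close> over
  \<open>C\<close> and the earlier tuples; finite character of \<open>P\<close> takes care of the limit stages. Since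
  \<open>|T|\<^sup>+ \<le> 2\<^bsup>|T|\<^esup> < \<kappa>\<close>, local character applies to all these tuples together and gives a set of size
  \<open>|T|\<close> over which \<open>b\<close> is independent from them. By regularity of \<open>|T|\<^sup>+\<close> this set is contained in an
  early stage, a contradiction.
\<close>

lemma chain_maximal:
  assumes sm: "small M C" and PC: "P C"
    and fc: "\<And>E. C \<subseteq> E \<Longrightarrow> P E \<longleftrightarrow> (\<forall>F. finite F \<longrightarrow> F \<subseteq> E \<longrightarrow> P (C \<union> F))"
  obtains E where "C \<subseteq> E" "|E - C| \<le>o |T|" "P E" "\<And>c. P (E \<union> set c) \<Longrightarrow> ind b E (set c)"
proof (rule ccontr)
  note th = that
  assume nt: "\<not> thesis"
  have neg: "\<exists>c. P (E \<union> set c) \<and> \<not> ind b E (set c)" if "C \<subseteq> E" "|E - C| \<le>o |T|" "P E" for E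
    using th[OF that] nt by blast
  let ?r = "cardSuc |T|"
  have r: "Card_order ?r" "\<not> finite (Field ?r)"
    using cardSuc_Card_order[OF card_of_Card_order] infinite_T cardSuc_finite[OF card_of_Card_order, of T] by (simp_all add: Field_card_of)
  have wo: "Well_order ?r" using r(1) by (simp add: card_order_on_def)
  have wf: "wf (?r - Id)" using wo by (simp add: well_order_on_def)
  have lin: "Linear_order ?r" using wo by (simp add: well_order_on_def)
  then have tr: "trans ?r" and as: "antisym ?r" by (auto simp: order_on_defs)
  have tot: "(y, z) \<in> ?r \<or> (z, y) \<in> ?r" if "y \<in> Field ?r" "z \<in> Field ?r" for y z
    using lin that by (cases "y = z") (auto simp: order_on_defs total_on_def refl_on_def)
  have FU: "y \<in> Field ?r" if "y \<in> underS ?r x" for x y using that by (auto simp: underS_def Field_def)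
  \<comment> \<open>\<open>E f x\<close> is the stage before \<open>x\<close>, and \<open>G f x\<close> the stage after \<open>x\<close>.\<close>
  define E where "E f x = C \<union> (\<Union>y\<in>underS ?r x. set (f y))" for f :: "('s, 'f, 'r) fm set \<Rightarrow> 'm list" and x
  define G where "G f x = E f x \<union> set (f x)" for f x
  have GE: "G f y \<subseteq> E f z" if "y \<in> underS ?r z" for f y z
  proof -
    have "underS ?r y \<subseteq> underS ?r z"
      using that tr as unfolding underS_def by (auto dest: transD antisymD)
    then show ?thesis using that by (auto simp: G_def E_def)
  qed
  have GG: "G f y \<subseteq> G f z" if "(y, z) \<in> ?r" for f y z
    using that GE[of y z f] by (cases "y = z") (auto simp: underS_def G_def)
  have step: "\<exists>c. x \<in> Field ?r \<longrightarrow> P (E f x \<union> set c) \<and> \<not> ind b (E f x) (set c)"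
    if IH: "\<And>y. (y, x) \<in> ?r - Id \<Longrightarrow> y \<in> Field ?r \<longrightarrow> P (E f y \<union> set (f y)) \<and> \<not> ind b (E f y) (set (f y))" for x f
  proof (cases "x \<in> Field ?r")
    case x: True
    have IH': "P (G f y)" if "y \<in> underS ?r x" for y using IH[of y] that FU[OF that] by (auto simp: underS_def G_def)
    have CE: "C \<subseteq> E f x" by (auto simp: E_def)
    have "P (C \<union> F)" if F: "finite F" "F \<subseteq> E f x" for F
    proof -
      let ?\<C> = "insert C (G f ` underS ?r x)"
      have "F \<subseteq> \<Union>?\<C>" using F(2) by (auto simp: E_def G_def)
      moreover have "subset.chain UNIV ?\<C>"
      proof -
        have "G f y \<subseteq> G f z \<or> G f z \<subseteq> G f y" if "y \<in> underS ?r x" "z \<in> underS ?r x" for y z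
          using tot[OF FU[OF that(1)] FU[OF that(2)]] GG by blast
        moreover have "C \<subseteq> G f y" for y by (auto simp: G_def E_def)
        ultimately show ?thesis unfolding subset_chain_def by blast
      qed
      ultimately obtain Y where Y: "Y \<in> ?\<C>" "F \<subseteq> Y" using finite_subset_Union_chain[OF F(1)] by (metis insert_not_empty)
      have "P Y" "C \<subseteq> Y" using Y(1) IH' PC by (auto simp: G_def E_def)
      then show ?thesis using fc F(1) Y(2) by blast
    qed
    then have PE: "P (E f x)" using fc[OF CE] by blast
    have "|underS ?r x| <o ?r" by (rule card_of_underS[OF r(1) x])
    then have "|underS ?r x| \<le>o |T|" using cardSuc_ordLess_ordLeq[OF card_of_Card_order card_of_Card_order]
      by (meson cardSuc_ordLeq_ordLess card_of_Card_order ordLess_or_ordLeq not_ordLess_ordLeq card_of_Well_order)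
    then have "|\<Union>y\<in>underS ?r x. set (f y)| \<le>o |T|" by (rule UN_le_T) (auto intro: finite_le_T)
    then have "|E f x - C| \<le>o |T|" by (rule mono_le_T) (auto simp: E_def)
    then show ?thesis using neg[OF CE _ PE] by blast
  qed simp
  have "\<exists>f. \<forall>x. x \<in> Field ?r \<longrightarrow> P (E f x \<union> set (f x)) \<and> \<not> ind b (E f x) (set (f x))"
  proof (rule dependent_wf_choice[OF wf])
    fix f g :: "('s, 'f, 'r) fm set \<Rightarrow> 'm list" and x and c assume "\<And>z. (z, x) \<in> ?r - Id \<Longrightarrow> f z = g z"
    then have "E f x = E g x" by (auto simp: E_def underS_def)
    then show "(x \<in> Field ?r \<longrightarrow> P (E f x \<union> set c) \<and> \<not> ind b (E f x) (set c)) = (x \<in> Field ?r \<longrightarrow> P (E g x \<union> set c) \<and> \<not> ind b (E g x) (set c))" by simp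
  qed (rule step)
  then obtain f where f: "\<And>x. x \<in> Field ?r \<Longrightarrow> \<not> ind b (E f x) (set (f x))" by blast
  let ?U = "\<Union>x\<in>Field ?r. set (f x)"
  have "|?U| \<le>o ?r"
    by (rule card_of_UNION_ordLeq_infinite_Field[OF r(2,1)])
       (use r card_of_Field_ordIso ordIso_imp_ordLeq finite_le_T cardSuc_ordLeq[OF card_of_Card_order] ordLeq_transitive in blast)+
  moreover have "?r \<le>o |Pow T|" using cardSuc_ordLess_ordLeq[OF card_of_Card_order card_of_Card_order] card_of_Pow by blast
  ultimately have "small M ?U" unfolding small_def using Pow_T_less ordLeq_ordLess_trans ordLeq_transitive by blast
  then have "small M (C \<union> ?U)" using sm by (intro small_Un)
  then obtain B0 where B0: "B0 \<subseteq> C \<union> ?U" "|B0| \<le>o |T|" "ind b B0 (C \<union> ?U)" by (rule local_character)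
  have "relChain ?r (G f)" unfolding relChain_def using GG by blast
  moreover have ne: "Field ?r \<noteq> {}" using r(2) by auto
  then have "B0 \<subseteq> (\<Union>x\<in>Field ?r. G f x)" using B0(1) by (auto simp: G_def E_def)
  ultimately obtain i where i: "i \<in> Field ?r" "B0 \<subseteq> G f i"
    using cardSuc_UNION[OF card_of_Card_order, of T "G f" B0] infinite_T B0(2) by (auto simp: Field_card_of)
  \<comment> \<open>An infinite cardinal has no last element, so that another tuple was chosen after \<open>B0\<close> had been reached.\<close>
  obtain j where j: "j \<in> Field ?r" "i \<noteq> j" "(i, j) \<in> ?r" using infinite_Card_order_limit[OF r i(1)] by blast
  then have sub: "B0 \<subseteq> E f j" using GE[of i j f] i(2) by (auto simp: underS_def)
  have "E f j \<subseteq> C \<union> ?U" using FU by (auto simp: E_def)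
  then have "ind b (E f j) (C \<union> ?U)" using ind_base[OF B0(3) sub] by blast
  then have "ind b (E f j) (set (f j))" by (rule ind_mono) (use j(1) in auto)
  then show False using f[OF j(1)] by blast
qed

section \<open>Symmetry\<close>

definition type_definable :: "'m set \<Rightarrow> 's list \<Rightarrow> 'm list set \<Rightarrow> bool" where
  "type_definable F ss K \<longleftrightarrow> (\<exists>\<G>. \<G> \<subseteq> definable F ss \<and> K = {a \<in> tuples ss. \<forall>X\<in>\<G>. a \<in> X})"

lemma type_definableI: "\<G> \<subseteq> definable F ss \<Longrightarrow> K = {a \<in> tuples ss. \<forall>X\<in>\<G>. a \<in> X} \<Longrightarrow> type_definable F ss K"
  unfolding type_definable_def by blast

lemma type_definableE:
  assumes "type_definable F ss K" obtains \<G> where "\<G> \<subseteq> definable F ss" "K = {a \<in> tuples ss. \<forall>X\<in>\<G>. a \<in> X}"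
  using assms unfolding type_definable_def by blast

lemma type_definable_mono: "type_definable F ss K \<Longrightarrow> F \<subseteq> F' \<Longrightarrow> type_definable F' ss K"
  by (erule type_definableE, rule type_definableI[rotated], assumption) (use definable_mono in blast)

lemma type_definable_inter: "type_definable F ss K \<Longrightarrow> type_definable F ss L \<Longrightarrow> type_definable F ss (K \<inter> L)"
proof -
  assume "type_definable F ss K" "type_definable F ss L"
  then obtain \<G> \<H> where "\<G> \<subseteq> definable F ss" "K = {a \<in> tuples ss. \<forall>X\<in>\<G>. a \<in> X}" "\<H> \<subseteq> definable F ss" "L = {a \<in> tuples ss. \<forall>X\<in>\<H>. a \<in> X}"
    by (elim type_definableE) blast
  then show ?thesis by (intro type_definableI[of "\<G> \<union> \<H>"]) auto
qed

lemma type_definable_top: "type_definable F ss (tuples ss)"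
  by (rule type_definableI[of "{}"]) auto

lemma type_definable_sel: assumes f: "selects ts ss f" and K: "type_definable F ss K" shows "type_definable F ts {a \<in> tuples ts. f a \<in> K}"
proof -
  obtain \<G> where G: "\<G> \<subseteq> definable F ss" "K = {a \<in> tuples ss. \<forall>X\<in>\<G>. a \<in> X}" using K by (rule type_definableE)
  show ?thesis
  proof (rule type_definableI)
    show "(\<lambda>X. {a \<in> tuples ts. f a \<in> X}) ` \<G> \<subseteq> definable F ts" using definable_sel[OF f] G(1) by blast
    show "{a \<in> tuples ts. f a \<in> K} = {a \<in> tuples ts. \<forall>X\<in>(\<lambda>X. {a \<in> tuples ts. f a \<in> X}) ` \<G>. a \<in> X}"
      using selects_sorts[OF f] G(2) by auto
  qed
qed

lemma type_definable_type: "type_definable F (srts a) {v \<in> tuples (srts a). same_type F a v}"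
proof (rule type_definableI)
  show "{X \<in> definable F (srts a). a \<in> X} \<subseteq> definable F (srts a)" by blast
  have "same_type F a v \<longleftrightarrow> (\<forall>X\<in>{X \<in> definable F (srts a). a \<in> X}. v \<in> X)" if "srts v = srts a" for v
  proof
    assume e: "same_type F a v" show "\<forall>X\<in>{X \<in> definable F (srts a). a \<in> X}. v \<in> X" using same_typeD[OF e] by blast
  qed (use that in \<open>intro same_typeI, auto\<close>)
  then show "{v \<in> tuples (srts a). same_type F a v} = {v \<in> tuples (srts a). \<forall>X\<in>{X \<in> definable F (srts a). a \<in> X}. v \<in> X}"
    by auto
qed

text \<open>
  By compactness a fibre is nonempty if it meets every finite intersection of the defining sets.
\<close>

lemma type_definable_proj:
  assumes F: "small M F" and K: "type_definable F (us @ ws) K"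
  shows "type_definable F us {u \<in> tuples us. \<exists>w. u @ w \<in> K}"
proof -
  obtain \<G> where G: "\<G> \<subseteq> definable F (us @ ws)" "K = {a \<in> tuples (us @ ws). \<forall>X\<in>\<G>. a \<in> X}" using K by (rule type_definableE)
  let ?p = "\<lambda>H. {u \<in> tuples us. \<exists>w. u @ w \<in> {a \<in> tuples (us @ ws). \<forall>X\<in>H. a \<in> X}}"
  let ?H = "{H. H \<subseteq> \<G> \<and> finite H}"
  show ?thesis
  proof (rule type_definableI)
    show "?p ` ?H \<subseteq> definable F us"
    proof (rule image_subsetI)
      fix H assume H: "H \<in> ?H"
      then show "?p H \<in> definable F us" using G(1) by (intro definable_ex[where ts = ws] definable_INT) auto
    qed
    have "\<exists>w. u @ w \<in> K" if u: "srts u = us" and *: "\<And>H. H \<in> ?H \<Longrightarrow> u \<in> ?p H" for u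
    proof -
      let ?f = "\<lambda>X. {w \<in> tuples ws. u @ w \<in> X}"
      have sm: "small M (F \<union> set u)" using F by (intro small_Un) auto
      have sub: "?f ` \<G> \<subseteq> definable (F \<union> set u) ws"
        by (rule image_subsetI, rule definable_fibre[OF _ u]) (use G(1) in blast)
      have fip: "\<exists>w\<in>tuples ws. \<forall>X\<in>S. w \<in> X" if S: "S \<subseteq> ?f ` \<G>" "finite S" for S
      proof -
        obtain H where H: "H \<subseteq> \<G>" "finite H" "S = ?f ` H" using finite_subset_image[OF S(2,1)] by blast
        then have "u \<in> ?p H" using * by blast
        then obtain w where "srts w = ws" "\<forall>X\<in>H. u @ w \<in> X" using u by auto
        then show ?thesis using H(3) by (intro bexI[of _ w]) auto
      qed
      obtain w where "srts w = ws" "\<And>X. X \<in> ?f ` \<G> \<Longrightarrow> w \<in> X" by (rule compactness[OF sm sub fip]) blast+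
      then have "u @ w \<in> K" using u G(2) by auto
      then show ?thesis by blast
    qed
    moreover have "u \<in> ?p H" if "u @ w \<in> K" "srts u = us" "H \<in> ?H" for u w H
      using that G(2) by auto
    ultimately show "{u \<in> tuples us. \<exists>w. u @ w \<in> K} = {a \<in> tuples us. \<forall>X\<in>?p ` ?H. a \<in> X}"
      by (intro set_eqI) (smt (verit, del_insts) image_eqI image_iff mem_Collect_eq tuples_iff)
  qed
qed

text \<open>
  By \<open>alg_bound\<close>, algebraicity is a disjunction of formulas with bounded fibres.
\<close>

lemma type_definable_nonalg: "type_definable F (vs @ es) {c \<in> tuples (vs @ es). \<not> alg (F \<union> set (take (length vs) c)) (drop (length vs) c)}"
proof -
  let ?n = "length vs"
  let ?V = "{V \<in> definable F (es @ vs). \<exists>N. \<forall>u\<in>tuples vs. \<not> atleast N {z. z @ u \<in> V}}"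
  let ?f = "\<lambda>V. tuples (vs @ es) - {c \<in> tuples (vs @ es). drop ?n c @ take ?n c \<in> V}"
  show ?thesis
  proof (rule type_definableI)
    show "?f ` ?V \<subseteq> definable F (vs @ es)"
      by (rule image_subsetI, rule definable_compl, rule definable_swap) blast
    have "alg (F \<union> set u) z \<longleftrightarrow> (\<exists>V\<in>?V. z @ u \<in> V)" if u: "srts u = vs" "srts z = es" for u z
    proof
      assume "alg (F \<union> set u) z"
      then obtain W N where "W \<in> definable F (srts z @ srts u)" "z @ u \<in> W"
        "\<And>u'. srts u' = srts u \<Longrightarrow> \<not> atleast N {z'. z' @ u' \<in> W}" by (rule alg_bound) blast
      then show "\<exists>V\<in>?V. z @ u \<in> V" using u by (intro bexI[of _ W]) (auto intro!: exI[of _ N])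
    next
      assume "\<exists>V\<in>?V. z @ u \<in> V"
      then obtain V N where V: "V \<in> definable F (es @ vs)" "\<forall>u\<in>tuples vs. \<not> atleast N {z. z @ u \<in> V}" "z @ u \<in> V" by blast
      have "u \<in> tuples vs" using u(1) by simp
      then have "finite {z. z @ u \<in> V}" using V(2) not_atleast_finite by blast
      then have "finite {z \<in> tuples es. z @ u \<in> V}" by (rule rev_finite_subset) blast
      moreover have "{z \<in> tuples es. z @ u \<in> V} \<in> definable (F \<union> set u) es" using definable_subst[of V F es u] V(1) u(1) by simp
      moreover have "z \<in> {z \<in> tuples es. z @ u \<in> V}" using V(3) u(2) by simp
      ultimately show "alg (F \<union> set u) z" unfolding alg_def u(2) by (intro bexI conjI)
    qed
    note key = this
    have "\<not> alg (F \<union> set (take ?n c)) (drop ?n c) \<longleftrightarrow> (\<forall>X\<in>?f ` ?V. c \<in> X)" if c: "srts c = vs @ es" for c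
    proof -
      have s: "srts (take ?n c) = vs" "srts (drop ?n c) = es" using c by (simp_all add: take_map[symmetric] drop_map[symmetric])
      have "(\<forall>X\<in>?f ` ?V. c \<in> X) \<longleftrightarrow> (\<forall>V\<in>?V. drop ?n c @ take ?n c \<notin> V)" using c by simp
      also have "\<dots> \<longleftrightarrow> \<not> alg (F \<union> set (take ?n c)) (drop ?n c)" using key[OF s] by blast
      finally show ?thesis by (rule sym)
    qed
    then show "{c \<in> tuples (vs @ es). \<not> alg (F \<union> set (take ?n c)) (drop ?n c)} = {a \<in> tuples (vs @ es). \<forall>X\<in>?f ` ?V. a \<in> X}"
      by (intro Collect_cong conj_cong refl) simp
  qed
qed

primrec tower :: "('m set \<Rightarrow> 'm list \<Rightarrow> bool) \<Rightarrow> nat \<Rightarrow> 'm set \<Rightarrow> bool" where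
  "tower G 0 E \<longleftrightarrow> True"
| "tower G (Suc n) E \<longleftrightarrow> (\<exists>w. G E w \<and> tower G n (E \<union> set w))"

lemma tower_antimono:
  assumes "\<And>E E' w. E \<subseteq> E' \<Longrightarrow> G E' w \<Longrightarrow> G E w"
  shows "tower G n E' \<Longrightarrow> E \<subseteq> E' \<Longrightarrow> tower G n E"
proof (induction n arbitrary: E E')
  case (Suc n)
  then obtain w where w: "G E' w" "tower G n (E' \<union> set w)" by auto
  have "tower G n (E \<union> set w)" by (rule Suc.IH[OF w(2)]) (use Suc.prems in blast)
  then show ?case using assms[OF Suc.prems(2) w(1)] by auto
qed simp

lemma tower_le: "tower G n E \<Longrightarrow> m \<le> n \<Longrightarrow> tower G m E"
proof (induction n arbitrary: m E)
  case (Suc n)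
  then show ?case by (cases m) auto
qed simp

text \<open>
  Fix a formula \<open>\<theta>(y, e)\<close>, given by \<open>Z\<close>, which strongly divides over \<open>Cd\<close> and holds of \<open>b\<close>. The
  relation \<open>G E w\<close> says that \<open>w = d'e'\<close> is a conjugate of \<open>de\<close> over \<open>Cb\<close> for which \<open>e'\<close> is not algebraic
  over \<open>Ed'\<close>. Then \<open>\<theta>(y, e')\<close> strongly divides over \<open>Ed'\<close>, so that \<open>b\<close> depends on \<open>w\<close> over \<open>E\<close>.
  A tower of \<open>G\<close> is a chain of such dependences. Local character excludes towers of unbounded
  height, while independence of \<open>de\<close> from \<open>b\<close> over \<open>C\<close> would produce them.
\<close>

context
  fixes C :: "'m set" and b d e :: "'m list" and Z :: "'m list set" and G
  assumes C: "small M C" and s: "strong_div C d e (srts b) Z" and bZ: "b @ e \<in> Z"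
  defines "G \<equiv> \<lambda>E w. same_type (C \<union> set b) (d @ e) w \<and> \<not> alg (E \<union> set (take (length d) w)) (drop (length d) w)"
begin

lemma G_antimono: "E \<subseteq> E' \<Longrightarrow> G E' w \<Longrightarrow> G E w"
  unfolding G_def using alg_mono[of "E \<union> set (take (length d) w)" _ "E' \<union> set (take (length d) w)"] by blast

lemma G_conj:
  assumes "same_type (C \<union> set b) (d @ e) w"
  obtains Z' where "strong_div C (take (length d) w) (drop (length d) w) (srts b) Z'" "b @ drop (length d) w \<in> Z'"
proof -
  have "small M (C \<union> set b)" using C by (intro small_Un) auto
  then obtain h where h: "aut (C \<union> set b) h" "map h (d @ e) = w" using same_type_aut[OF _ assms] by blast
  have w: "take (length d) w = map h d" "drop (length d) w = map h e" using h(2) by auto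
  have "h ` C = C" using aut_image[OF h(1)] by blast
  then have "strong_div C (map h d) (map h e) (srts b) (map h ` Z)" using strong_div_aut[OF h(1) s] by simp
  moreover have "map h b = b" using aut_map[OF h(1)] by blast
  then have "b @ map h e \<in> map h ` Z" using bZ by (metis image_eqI map_append)
  ultimately show ?thesis using that unfolding w by blast
qed

lemma G_fork: assumes "C \<subseteq> E" "G E w" shows "\<not> ind b E (set w)"
proof -
  let ?d = "take (length d) w" and ?e = "drop (length d) w"
  have na: "\<not> alg (E \<union> set ?d) ?e" using assms(2) by (simp add: G_def)
  obtain Z' where s': "strong_div C ?d ?e (srts b) Z'" "b @ ?e \<in> Z'" using G_conj assms(2) by (metis G_def)
  obtain W k where Z': "Z' \<in> definable (C \<union> set ?d) (srts b @ srts ?e)"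
    and W: "W \<in> definable (C \<union> set ?d) (srts ?e)" "?e \<in> W" "\<forall>v\<in>tuples (srts b). \<not> atleast k {e' \<in> W. v @ e' \<in> Z'}"
    using s'(1) by (auto simp: strong_div_def)
  have sub: "C \<union> set ?d \<subseteq> E \<union> set ?d" using assms(1) by blast
  have thorn_div: "thorn_div E (srts b) {y \<in> tuples (srts b). y @ ?e \<in> Z'}"
    by (rule thorn_div_intro[OF _ definable_mono[OF Z' sub] definable_mono[OF W(1) sub] W(2) na, of E k]) (use W(3) in auto)
  have "{y \<in> tuples (srts b). y @ ?e \<in> Z'} \<in> definable (C \<union> set ?d \<union> set ?e) (srts b)" by (rule definable_subst[OF Z'])
  then have "{y \<in> tuples (srts b). y @ ?e \<in> Z'} \<in> definable (E \<union> set w) (srts b)"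
    by (rule definable_mono) (use assms(1) set_take_subset set_drop_subset in fastforce)
  then show ?thesis using not_indI[OF _ _ forks_thorn_div[OF thorn_div]] s'(2) by simp
qed

lemma tower_type_definable:
  "small M E \<Longrightarrow> C \<subseteq> E \<Longrightarrow> type_definable (E \<union> set b) us {u \<in> tuples us. tower G n (E \<union> set u)}"
proof (induction n arbitrary: us)
  case 0 then show ?case using type_definable_top[of _ us] by (simp add: tuples_def)
next
  case (Suc n)
  let ?ws = "srts d @ srts e"
  let ?F = "E \<union> set b"
  let ?m = "length us" and ?k = "length (us @ srts d)"
  let ?K1 = "{c \<in> tuples (us @ ?ws). drop ?m c \<in> {v \<in> tuples (srts (d @ e)). same_type (C \<union> set b) (d @ e) v}}"
  let ?K2 = "{c \<in> tuples ((us @ srts d) @ srts e). \<not> alg (E \<union> set (take ?k c)) (drop ?k c)}"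
  let ?K3 = "{c \<in> tuples (us @ ?ws). tower G n (E \<union> set c)}"
  have "type_definable (C \<union> set b) (us @ ?ws) ?K1"
    unfolding map_append by (rule type_definable_sel[OF selects_drop type_definable_type[of "C \<union> set b" "d @ e", unfolded map_append]])
  then have K1: "type_definable ?F (us @ ?ws) ?K1" by (rule type_definable_mono) (use Suc.prems in blast)
  have K2: "type_definable ?F (us @ ?ws) ?K2" using type_definable_mono[OF type_definable_nonalg[of E "us @ srts d" "srts e"], of ?F] by simp
  have K3: "type_definable ?F (us @ ?ws) ?K3" by (rule Suc.IH[OF Suc.prems])
  have "small M ?F" using Suc.prems by (intro small_Un) auto
  from type_definable_proj[OF this type_definable_inter[OF K1 type_definable_inter[OF K2 K3]]]
  have *: "type_definable ?F us {u \<in> tuples us. \<exists>w. u @ w \<in> ?K1 \<inter> (?K2 \<inter> ?K3)}" .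
  have "tower G (Suc n) (E \<union> set u) \<longleftrightarrow> (\<exists>w. u @ w \<in> ?K1 \<inter> (?K2 \<inter> ?K3))" if u: "srts u = us" for u
  proof -
    have lu: "length us = length u" using srts_length[OF u] by simp
    have "u @ w \<in> ?K1 \<inter> (?K2 \<inter> ?K3) \<longleftrightarrow> G (E \<union> set u) w \<and> tower G n ((E \<union> set u) \<union> set w)" for w
    proof -
      have sw: "srts w = srts d @ srts e" if "same_type (C \<union> set b) (d @ e) w" using that by (simp add: same_type_def)
      have "u @ w \<in> ?K1 \<longleftrightarrow> same_type (C \<union> set b) (d @ e) w" using u lu sw by auto
      moreover have "u @ w \<in> ?K2 \<longleftrightarrow> \<not> alg ((E \<union> set u) \<union> set (take (length d) w)) (drop (length d) w)"
        if "srts w = srts d @ srts e" using that u lu by (simp add: Un_assoc)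
      moreover have "u @ w \<in> ?K3 \<longleftrightarrow> tower G n ((E \<union> set u) \<union> set w)"
        if "srts w = srts d @ srts e" using that u by (simp add: Un_assoc)
      ultimately show ?thesis unfolding G_def using sw by blast
    qed
    then show ?thesis by simp
  qed
  then have "{u \<in> tuples us. tower G (Suc n) (E \<union> set u)} = {u \<in> tuples us. \<exists>w. u @ w \<in> ?K1 \<inter> (?K2 \<inter> ?K3)}"
    by (intro Collect_cong conj_cong refl) (simp only: tuples_iff)
  then show ?case using * by (simp only:)
qed

text \<open>
  For each \<open>n\<close> and each finite \<open>F\<close>, the set of bottom members of towers of height \<open>n + 1\<close> over
  \<open>C \<union> F\<close> is type-definable. These sets are directed, so they have a common element.
\<close>

lemma tower_extend:
  assumes E: "small M E" "C \<subseteq> E" and P: "\<And>n F. finite F \<Longrightarrow> F \<subseteq> E \<Longrightarrow> tower G n (C \<union> F)"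
  obtains w where "G E w" "\<And>n F. finite F \<Longrightarrow> F \<subseteq> E \<union> set w \<Longrightarrow> tower G n (C \<union> F)"
proof -
  let ?ws = "srts d @ srts e"
  let ?A = "E \<union> set b"
  let ?I = "{(n :: nat, F). finite F \<and> F \<subseteq> E}"
  let ?K = "\<lambda>n F. {w \<in> tuples ?ws. G (C \<union> F) w \<and> tower G n (C \<union> F \<union> set w)}"
  have sA: "small M ?A" using E by (intro small_Un) auto
  have cl: "type_definable ?A ?ws (?K n F)" if F: "finite F" "F \<subseteq> E" for n F
  proof -
    have sm: "small M (C \<union> F)" using C F by (intro small_Un) auto
    let ?L1 = "{v \<in> tuples (srts (d @ e)). same_type (C \<union> set b) (d @ e) v}"
    let ?L2 = "{c \<in> tuples (srts d @ srts e). \<not> alg ((C \<union> F) \<union> set (take (length (srts d)) c)) (drop (length (srts d)) c)}"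
    let ?L3 = "{w \<in> tuples ?ws. tower G n (C \<union> F \<union> set w)}"
    have 1: "type_definable ?A ?ws ?L1" using type_definable_mono[OF type_definable_type[of "C \<union> set b" "d @ e"], of ?A] E(2) by auto
    have 2: "type_definable ?A ?ws ?L2" by (rule type_definable_mono[OF type_definable_nonalg]) (use E(2) F(2) in auto)
    have 3: "type_definable ?A ?ws ?L3" by (rule type_definable_mono[OF tower_type_definable[OF sm]]) (use E(2) F(2) in auto)
    have "?K n F = ?L1 \<inter> (?L2 \<inter> ?L3)" by (auto simp: G_def)
    then show ?thesis using type_definable_inter[OF 1 type_definable_inter[OF 2 3]] by (simp only:)
  qed
  define g where "g n F = (SOME \<G>. \<G> \<subseteq> definable ?A ?ws \<and> ?K n F = {a \<in> tuples ?ws. \<forall>X\<in>\<G>. a \<in> X})" for n F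
  have g: "g n F \<subseteq> definable ?A ?ws \<and> ?K n F = {a \<in> tuples ?ws. \<forall>X\<in>g n F. a \<in> X}" if "finite F" "F \<subseteq> E" for n F
    unfolding g_def by (rule someI_ex) (use cl[OF that] in \<open>unfold type_definable_def\<close>)
  let ?\<G> = "\<Union>i\<in>?I. g (fst i) (snd i)"
  have sub: "?\<G> \<subseteq> definable ?A ?ws"
  proof (rule UN_least)
    fix i assume "i \<in> ?I"
    then have "finite (snd i)" "snd i \<subseteq> E" by (auto simp: case_prod_beta)
    then show "g (fst i) (snd i) \<subseteq> definable ?A ?ws" using g[of "snd i" "fst i"] by (rule_tac conjunct1)
  qed
  have fip: "\<exists>w\<in>tuples ?ws. \<forall>X\<in>S. w \<in> X" if S: "S \<subseteq> ?\<G>" "finite S" for S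
  proof -
    have "\<forall>X\<in>S. \<exists>i. i \<in> ?I \<and> X \<in> g (fst i) (snd i)" using S(1) by blast
    then obtain j where j: "\<And>X. X \<in> S \<Longrightarrow> j X \<in> ?I \<and> X \<in> g (fst (j X)) (snd (j X))" by metis
    let ?F = "\<Union>X\<in>S. snd (j X)"
    have F: "finite ?F" "?F \<subseteq> E" using S(2) j by fastforce+
    define N where "N = Max (insert 0 ((\<lambda>X. fst (j X)) ` S))"
    have N: "fst (j X) \<le> N" if "X \<in> S" for X unfolding N_def using S(2) that by (intro Max_ge) auto
    have "tower G (Suc N) (C \<union> ?F)" using P[OF F] .
    then obtain w where w: "G (C \<union> ?F) w" "tower G N (C \<union> ?F \<union> set w)" by auto
    have sw: "srts w = ?ws" using w(1) by (simp add: G_def same_type_def)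
    have "w \<in> X" if X: "X \<in> S" for X
    proof -
      let ?n = "fst (j X)" and ?G = "snd (j X)"
      have G: "finite ?G" "?G \<subseteq> E" using j[OF X] by (auto simp: case_prod_beta)
      have "G (C \<union> ?G) w" by (rule G_antimono[OF _ w(1)]) (use X in blast)
      moreover have "tower G ?n (C \<union> ?G \<union> set w)"
        by (rule tower_antimono[OF G_antimono tower_le[OF w(2) N[OF X]]]) (use X in auto)
      ultimately have "w \<in> ?K ?n ?G" using sw by simp
      then show ?thesis using g[OF G, of ?n] j[OF X] by blast
    qed
    then show ?thesis using sw by (intro bexI[of _ w]) auto
  qed
  obtain w where w: "srts w = ?ws" "\<And>X. X \<in> ?\<G> \<Longrightarrow> w \<in> X" by (rule compactness[OF sA sub fip]) blast+
  have wK: "G (C \<union> F) w \<and> tower G n (C \<union> F \<union> set w)" if F: "finite F" "F \<subseteq> E" for n F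
  proof -
    have "w \<in> X" if X: "X \<in> g n F" for X
    proof (rule w(2), rule UN_I[of "(n, F)"])
      show "(n, F) \<in> ?I" using F by simp
      show "X \<in> g (fst (n, F)) (snd (n, F))" using X by simp
    qed
    then have "w \<in> ?K n F" using g[OF F, of n] w(1) by simp
    then show ?thesis by simp
  qed
  have "G E w"
  proof -
    have "same_type (C \<union> set b) (d @ e) w" using wK[of "{}"] by (simp add: G_def)
    moreover have "\<not> alg (E \<union> set (take (length d) w)) (drop (length d) w)"
    proof
      assume "alg (E \<union> set (take (length d) w)) (drop (length d) w)"
      then have "alg ((C \<union> set (take (length d) w)) \<union> E) (drop (length d) w)" by (rule alg_mono) blast
      then obtain q where q: "set q \<subseteq> E" "alg ((C \<union> set (take (length d) w)) \<union> set q) (drop (length d) w)" by (rule alg_finite_part)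
      have "G (C \<union> set q) w" using wK[OF _ q(1)] by simp
      then show False using q(2) unfolding G_def by (simp add: Un_ac)
    qed
    ultimately show ?thesis by (simp add: G_def)
  qed
  moreover have "tower G n (C \<union> F)" if F: "finite F" "F \<subseteq> E \<union> set w" for n F
  proof -
    have *: "tower G n (C \<union> (F \<inter> E) \<union> set w)" using wK[of "F \<inter> E"] F by simp
    show ?thesis by (rule tower_antimono[OF G_antimono *]) (use F in auto)
  qed
  ultimately show ?thesis using that by blast
qed

text \<open>
  Let \<open>E\<close> be maximal, in the sense of \<open>chain_maximal\<close>, among the sets that carry towers of every
  height. Then \<open>b\<close> depends over \<open>E\<close> on the tuple supplied by \<open>tower_extend\<close>, against maximality.
\<close>

lemma no_towers: "\<exists>n. \<not> tower G n C"
proof (rule ccontr)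
  assume "\<nexists>n. \<not> tower G n C"
  then have all: "\<And>n. tower G n C" by blast
  define P where "P E \<longleftrightarrow> (\<forall>n F. finite F \<longrightarrow> F \<subseteq> E \<longrightarrow> tower G n (C \<union> F))" for E
  have PC: "P C" unfolding P_def using all by (simp add: Un_absorb2)
  have fc: "P E \<longleftrightarrow> (\<forall>F. finite F \<longrightarrow> F \<subseteq> E \<longrightarrow> P (C \<union> F))" if "C \<subseteq> E" for E
  proof
    assume PE: "P E"
    show "\<forall>F. finite F \<longrightarrow> F \<subseteq> E \<longrightarrow> P (C \<union> F)"
    proof (intro allI impI)
      fix F assume F: "finite F" "F \<subseteq> E"
      show "P (C \<union> F)" unfolding P_def
      proof (intro allI impI)
        fix n F' assume "finite F'" "F' \<subseteq> C \<union> F"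
        then show "tower G n (C \<union> F')" using F \<open>P E\<close> unfolding P_def
          using tower_antimono[of G n "C \<union> F" "C \<union> F'"] G_antimono by blast
      qed
    qed
  next
    assume "\<forall>F. finite F \<longrightarrow> F \<subseteq> E \<longrightarrow> P (C \<union> F)"
    then show "P E" unfolding P_def by blast
  qed
  obtain E where E: "C \<subseteq> E" "|E - C| \<le>o |T|" "P E" "\<And>c. P (E \<union> set c) \<Longrightarrow> ind b E (set c)"
    by (rule chain_maximal[where P = P and b = b, OF C PC fc]) blast+
  have "E = C \<union> (E - C)" using E(1) by blast
  then have "small M E" using small_Un[OF C small_le_T[OF E(2)]] by simp
  then obtain w where w: "G E w" "\<And>n F. finite F \<Longrightarrow> F \<subseteq> E \<union> set w \<Longrightarrow> tower G n (C \<union> F)"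
    using tower_extend[OF _ E(1)] E(3) unfolding P_def by blast
  have "P (E \<union> set w)" unfolding P_def using w(2) by blast
  then show False using E(4) G_fork[OF E(1) w(1)] by blast
qed

text \<open>
  In a sequence of conjugates of \<open>de\<close>, each independent over \<open>C\<close> from \<open>b\<close> and its predecessors, the
  later members are jointly independent from \<open>f m\<close>. By \<open>alg_fork\<close> they do not make the second part of
  \<open>f m\<close> algebraic. Listing the sequence backwards therefore gives a tower.
\<close>

lemma morley_tower: assumes i: "ind (d @ e) C (set b)" shows "tower G N C"
proof -
  have "\<exists>f :: nat \<Rightarrow> 'm list. \<forall>i. same_type (C \<union> set b) (d @ e) (f i) \<and> ind (f i) C (set b \<union> (\<Union>j<i. set (f j)))"
  proof (rule dependent_wf_choice[where P = "\<lambda>(f :: nat \<Rightarrow> 'm list) i r. same_type (C \<union> set b) (d @ e) r \<and> ind r C (set b \<union> (\<Union>j<i. set (f j)))" and R = less_than])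
    show "wf less_than" by (rule wf_less_than)
  next
    fix f g :: "nat \<Rightarrow> 'm list" and x r assume "\<And>z. (z, x) \<in> less_than \<Longrightarrow> f z = g z"
    then have "(\<Union>j<x. set (f j)) = (\<Union>j<x. set (g j))" by auto
    then show "(same_type (C \<union> set b) (d @ e) r \<and> ind r C (set b \<union> (\<Union>j<x. set (f j)))) = (same_type (C \<union> set b) (d @ e) r \<and> ind r C (set b \<union> (\<Union>j<x. set (g j))))" by simp
  next
    fix f :: "nat \<Rightarrow> 'm list" and x
    show "\<exists>r. same_type (C \<union> set b) (d @ e) r \<and> ind r C (set b \<union> (\<Union>j<x. set (f j)))"
    proof -
      have "small M (\<Union>j<x. set (f j))" by simp
      from extension[OF C small_finite[OF finite_set] this i] show ?thesis by blast
    qed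
  qed
  then obtain f :: "nat \<Rightarrow> 'm list" where f0: "\<forall>i. same_type (C \<union> set b) (d @ e) (f i) \<and> ind (f i) C (set b \<union> (\<Union>j<i. set (f j)))"
    by (rule exE)
  have f: "\<And>i. same_type (C \<union> set b) (d @ e) (f i)" "\<And>i. ind (f i) C (set b \<union> (\<Union>j<i. set (f j)))" using f0 by simp_all
  have later: "ind (concat (map f [Suc m..<k])) C (set (f m))" if "Suc m \<le> k" for m k
    using that
  proof (induction k rule: dec_induct)
    case base
    have "ind (f (Suc m)) C (set (f m))" using f(2)[of "Suc m"] by (rule ind_mono) auto
    then show ?case by (rule ind_left) simp
  next
    case (step k)
    let ?g = "concat (map f [Suc m..<k])"
    have "ind (f k) (C \<union> set ?g) (set b \<union> (\<Union>j<k. set (f j)))" by (rule ind_base[OF f(2)]) auto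
    then have 1: "ind (f k) (C \<union> set ?g) (set (f m))" by (rule ind_mono) (use step in auto)
    have "ind (?g @ f k) C (set (f m))"
      by (rule transitivity_left[OF C _ _ _ 1]) (use ind_left[OF step.IH] in auto)
    then show ?case using step by simp
  qed
  have "tower G m (C \<union> (\<Union>i\<in>{m..<N}. set (f i)))" if "m \<le> N" for m
    using that
  proof (induction m)
    case (Suc m)
    let ?E = "C \<union> (\<Union>i\<in>{Suc m..<N}. set (f i))"
    let ?d = "take (length d) (f m)" and ?e = "drop (length d) (f m)"
    obtain Z' where s': "strong_div C ?d ?e (srts b) Z'" using G_conj[OF f(1)] by blast
    have "\<not> alg (?E \<union> set ?d) ?e"
    proof
      assume *: "alg (?E \<union> set ?d) ?e"
      let ?g = "concat (map f [Suc m..<N])"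
      have "alg ((C \<union> set ?d) \<union> set ?g) ?e" using * by (rule alg_mono) auto
      then have "\<not> ind ?g C (set (f m))"
        by (rule alg_fork) (use s' set_take_subset[of _ "f m"] set_drop_subset[of _ "f m"] in \<open>auto simp: strong_div_def\<close>)
      then show False using later[OF Suc.prems] by blast
    qed
    then have "G ?E (f m)" using f(1) by (simp add: G_def)
    moreover have "{m..<N} = insert m {Suc m..<N}" using Suc.prems by auto
    then have "?E \<union> set (f m) = C \<union> (\<Union>i\<in>{m..<N}. set (f i))" by auto
    then have "tower G m (?E \<union> set (f m))" using Suc by simp
    ultimately show ?case by auto
  qed simp
  from this[of N] show ?thesis by simp
qed

lemma strong_div_not_ind: "\<not> ind (d @ e) C (set b)"
  using morley_tower no_towers by blast

end

text \<open>
  If \<open>b\<close> depends on \<open>a\<close>, the parameters of the strongly dividing formulas can be chosen independent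
  from \<open>b\<close> over \<open>Ca\<close>, hence, by left transitivity, over \<open>C\<close>. This is what \<open>strong_div_not_ind\<close> forbids.
\<close>

theorem symmetry:
  assumes C: "small M C" and i: "ind a C (set b)"
  shows "ind b C (set a)"
proof (rule ccontr)
  assume "\<not> ind b C (set a)"
  then obtain X where X: "X \<in> definable (C \<union> set a) (srts b)" "b \<in> X" "forks C (srts b) X" by (rule not_indE)
  obtain f where f: "\<And>h x. aut C h \<Longrightarrow> map (inv h) x \<in> X \<Longrightarrow>
     \<exists>d e Z. set d \<union> set e \<subseteq> set (map h f) \<and> strong_div C d e (srts b) Z \<and> x @ e \<in> Z \<and> srts x = srts b"
    by (rule forks_parameters[OF X(3)]) blast
  have sm: "small M (C \<union> set a)" using C by (intro small_Un) auto
  have "ind f (C \<union> set a) {}" using ind_self[OF sm] by (rule ind_mono) blast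
  then obtain f' where f': "same_type (C \<union> set a \<union> {}) f f'" "ind f' (C \<union> set a) ({} \<union> set b)"
    using extension[OF sm, of "{}" "set b" f] by auto
  obtain h where h: "aut (C \<union> set a) h" "map h f = f'" using same_type_aut[OF sm, of f f'] f'(1) by auto
  have "ind (a @ f') C (set b)"
    by (rule transitivity_left[OF C, of "set a"]) (use f'(2) ind_left[OF i] in auto)
  then have if': "ind f' C (set b)" by (rule ind_left) simp
  have "map (inv h) b \<in> X" using definable_aut_fix[OF X(1) aut_inv[OF h(1)]] X(2) by blast
  moreover have "aut C h" using h(1) by (rule aut_mono) blast
  ultimately obtain d e Z where deZ: "set d \<union> set e \<subseteq> set f'" "strong_div C d e (srts b) Z" "b @ e \<in> Z"
    using f[of h b] h(2) by auto
  have "ind (d @ e) C (set b)" by (rule ind_left[OF if']) (use deZ(1) in simp)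
  then show False using strong_div_not_ind[OF C deZ(2,3)] by blast
qed

section \<open>Independence of sets\<close>

lemma small_Un_iff [simp]: "small M (A \<union> B) \<longleftrightarrow> small M A \<and> small M B"
  using small_Un small_mono by blast

text \<open>
  Independence for infinite sets \<open>X\<close>. Finite character then holds on both sides.
\<close>

definition Ind :: "'m set \<Rightarrow> 'm set \<Rightarrow> 'm set \<Rightarrow> bool" where
  "Ind X C Y \<longleftrightarrow> (\<forall>a. set a \<subseteq> X \<longrightarrow> ind a C Y)"

lemma Ind_set: "Ind (set a) C Y \<longleftrightarrow> ind a C Y"
  unfolding Ind_def using ind_left by blast

lemma Ind_mono: "Ind X C Y \<Longrightarrow> X' \<subseteq> X \<Longrightarrow> Y' \<subseteq> C \<union> Y \<Longrightarrow> Ind X' C Y'"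
  unfolding Ind_def using ind_mono by (meson order_trans)

lemma Ind_base: "Ind X C Y \<Longrightarrow> C \<subseteq> D \<Longrightarrow> D \<subseteq> C \<union> Y \<Longrightarrow> Ind X D Y"
  unfolding Ind_def using ind_base by blast

lemma Ind_finite:
  assumes "\<And>c. set c \<subseteq> Y \<Longrightarrow> Ind X C (set c)" shows "Ind X C Y"
  unfolding Ind_def
proof (intro allI impI, rule ccontr)
  fix a assume a: "set a \<subseteq> X" and "\<not> ind a C Y"
  then obtain c where "set c \<subseteq> Y" "\<not> ind a C (set c)" using ind_finite by metis
  then show False using assms a unfolding Ind_def by blast
qed

lemma Ind_sym: assumes "small M C" "Ind X C Y" shows "Ind Y C X"
proof (rule Ind_finite)
  fix x assume x: "set x \<subseteq> X"
  show "Ind Y C (set x)" unfolding Ind_def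
  proof (intro allI impI)
    fix y assume y: "set y \<subseteq> Y"
    have "ind x C Y" using assms(2) x by (simp add: Ind_def)
    then have "ind x C (set y)" by (rule ind_mono) (use y in blast)
    then show "ind y C (set x)" by (rule symmetry[OF assms(1)])
  qed
qed

lemma Ind_trans_left:
  assumes "small M C" "small M X" "small M Y" "Ind X C Y" "Ind X' (C \<union> X) Y"
  shows "Ind (X \<union> X') C Y"
  unfolding Ind_def
proof (intro allI impI)
  fix z assume z: "set z \<subseteq> X \<union> X'"
  let ?a = "filter (\<lambda>x. x \<in> X) z" and ?a' = "filter (\<lambda>x. x \<in> X') z"
  have a': "set ?a' \<subseteq> X'" by auto
  have "ind (?a @ ?a') C Y"
    by (rule transitivity_left[OF assms(1,2,3)]) (use assms(4,5) a' in \<open>unfold Ind_def, blast, blast, auto\<close>)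
  then show "ind z C Y" by (rule ind_left) (use z in auto)
qed

lemma Ind_trans:
  assumes "small M C" "small M X" "small M X'" "small M Y" "Ind Y C X" "Ind Y (C \<union> X) X'"
  shows "Ind Y C (X \<union> X')"
  using Ind_trans_left[of C X Y X'] Ind_sym[of C Y X] Ind_sym[of "C \<union> X" Y X'] Ind_sym[of C "X \<union> X'" Y] assms by simp

lemma Ind_trans':
  assumes "small M D" "small M X" "small M Y" "Ind Y C D" "Ind Y D X" "C \<subseteq> D"
  shows "Ind Y C (D \<union> X)"
proof -
  have "small M C" using assms(1,6) small_mono by blast
  moreover have "C \<union> D = D" using assms(6) by blast
  ultimately show ?thesis using Ind_trans[of C D X Y] assms by simp
qed

lemma Ind_down:
  assumes "small M D" "small M X" "small M Y" "Ind Y C D" "Ind Y D X" "C \<subseteq> D" "Z \<subseteq> D \<union> X"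
  shows "Ind Y C Z"
  by (rule Ind_mono[OF Ind_trans'[OF assms(1-6)]]) (use assms(7) in auto)

lemma Ind_split:
  assumes "small M C" "small M X" "Ind (X \<union> X') C Y" shows "Ind X' (C \<union> X) Y"
proof -
  have "Ind Y C (X \<union> X')" by (rule Ind_sym[OF assms(1,3)])
  then have "Ind Y (C \<union> X) (X \<union> X')" by (rule Ind_base) auto
  then have "Ind Y (C \<union> X) X'" by (rule Ind_mono) auto
  then show ?thesis by (rule Ind_sym[rotated]) (use assms in simp)
qed

text \<open>
  An independence over \<open>X\<close> persists over every larger base that is independent from both sides.
\<close>

lemma Ind_up:
  assumes "small M X" "small M X'" "small M P" "small M Q" "Ind P X Q" "Ind (P \<union> Q) X X'" "X \<subseteq> X'"
  shows "Ind P X' Q"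
proof -
  have "Ind P (X \<union> Q) X'" by (rule Ind_split[OF assms(1,4)]) (use assms(6) in \<open>simp add: Un_commute\<close>)
  then have "Ind P X (Q \<union> X')" using Ind_trans[OF assms(1,4,2,3,5)] by simp
  then have "Ind P X' (Q \<union> X')" by (rule Ind_base) (use assms(7) in auto)
  then show ?thesis by (rule Ind_mono) auto
qed

lemma Ind_self: "small M C \<Longrightarrow> Ind X C C"
  unfolding Ind_def using ind_self by blast

lemma Ind_empty: "small M C \<Longrightarrow> Ind {} C Y"
  by (rule Ind_sym, assumption, rule Ind_mono[OF Ind_self]) auto

lemma Ind_aut1: assumes "aut A h" "Ind X C Y" shows "Ind (h ` X) (h ` C) (h ` Y)"
  unfolding Ind_def
proof (intro allI impI)
  fix a assume a: "set a \<subseteq> h ` X"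
  have "set (map (inv h) a) \<subseteq> X" using a aut_inv_map(4)[OF assms(1), of X] by (metis image_mono set_map)
  then have "ind (map (inv h) a) C Y" using assms(2) by (simp add: Ind_def)
  then have "ind (map h (map (inv h) a)) (h ` C) (h ` Y)" using ind_aut[OF assms(1)] by blast
  then show "ind a (h ` C) (h ` Y)" using aut_inv_map(2)[OF assms(1), of a] by simp
qed

lemma Ind_aut: "aut A h \<Longrightarrow> Ind (h ` X) (h ` C) (h ` Y) \<longleftrightarrow> Ind X C Y"
  using Ind_aut1[of A h X C Y] Ind_aut1[OF aut_inv, of A h "h ` X" "h ` C" "h ` Y"] aut_inv_map(4)[of A h] by metis

lemma Ind_UN_chain:
  assumes "\<And>n. Ind X C (Y n)" "\<And>n. Y n \<subseteq> Y (Suc n)" shows "Ind X C (\<Union>n :: nat. Y n)"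
proof (rule Ind_finite)
  fix c assume c: "set c \<subseteq> (\<Union>n. Y n)"
  have mono: "Y m \<subseteq> Y n" if "m \<le> n" for m n using that by (rule lift_Suc_mono_le[of Y, OF assms(2)])
  have "\<exists>n. set c \<subseteq> Y n" using c
  proof (induction c)
    case (Cons x c)
    then obtain n m where "set c \<subseteq> Y n" "x \<in> Y m" by auto
    then have "set (x # c) \<subseteq> Y (max m n)" using mono[of m "max m n"] mono[of n "max m n"] by auto
    then show ?case by blast
  qed simp
  then show "Ind X C (set c)" using Ind_mono[OF assms(1)] by blast
qed

text \<open>
  Consider partial elementary maps over \<open>C\<close> from \<open>U\<close> onto sets that are independent from \<open>V\<close>. By
  extension and transitivity such a map can be prolonged to any further element, so that a
  maximal one is defined on \<open>U\<close>, and homogeneity extends it to an automorphism.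
\<close>

lemma free_extension:
  assumes sm: "small M C" "small M U" "small M V"
  obtains h where "aut C h" "Ind (h ` U) C V"
proof -
  define Q where "Q G \<longleftrightarrow> (\<forall>ps. set ps \<subseteq> G \<longrightarrow> fst ` set ps \<subseteq> U \<and> same_type C (map fst ps) (map snd ps) \<and> ind (map snd ps) C V)" for G
  have fc: "Q G \<longleftrightarrow> (\<forall>F. F \<subseteq> G \<and> finite F \<longrightarrow> Q F)" for G
  proof
    assume "Q G" then show "\<forall>F. F \<subseteq> G \<and> finite F \<longrightarrow> Q F" unfolding Q_def by (meson order_trans)
  next
    assume *: "\<forall>F. F \<subseteq> G \<and> finite F \<longrightarrow> Q F"
    show "Q G" unfolding Q_def
    proof (intro allI impI)
      fix ps assume "set ps \<subseteq> G"
      then have "Q (set ps)" using * by blast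
      then show "fst ` set ps \<subseteq> U \<and> same_type C (map fst ps) (map snd ps) \<and> ind (map snd ps) C V" unfolding Q_def by blast
    qed
  qed
  have Q0: "Q {}" unfolding Q_def using Ind_empty[OF sm(1), of V] by (simp add: Ind_def)
  obtain G where G: "Q G" "\<And>G'. G \<subseteq> G' \<Longrightarrow> Q G' \<Longrightarrow> G' = G"
    by (rule finite_character_maximal[of Q "{}", OF Q0 fc]) blast
  have QG: "fst ` set ps \<subseteq> U" "same_type C (map fst ps) (map snd ps)" "ind (map snd ps) C V" if "set ps \<subseteq> G" for ps
    using G(1) that unfolding Q_def by blast+
  have fG: "fst ` G \<subseteq> U"
  proof (rule image_subsetI)
    fix p assume "p \<in> G" then show "fst p \<in> U" using QG(1)[of "[p]"] by simp
  qed
  have sG: "small M (C \<union> fst ` G)" using sm(1) small_mono[OF sm(2) fG] by simp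
  obtain h where h: "aut C h" "\<And>u v. (u, v) \<in> G \<Longrightarrow> h u = v" by (rule homogeneity[OF sG QG(2)]) blast+
  have ss: "snd p = h (fst p)" if "p \<in> G" for p using h(2)[of "fst p" "snd p"] that by simp
  have "U \<subseteq> fst ` G"
  proof (rule ccontr)
    assume "\<not> U \<subseteq> fst ` G"
    then obtain u where u: "u \<in> U" "u \<notin> fst ` G" by blast
    let ?R = "snd ` G"
    have "?R = h ` fst ` G" using ss by (force simp: image_iff)
    then have sR: "small M ?R" using small_image small_mono[OF sm(2) fG] by simp
    have sCR: "small M (C \<union> ?R)" using sR sm(1) by simp
    have "ind [h u] (C \<union> ?R) {}" using ind_self[OF sCR] by (rule ind_mono) simp
    from extension[OF sCR _ sm(3) this] obtain x where x: "same_type (C \<union> ?R) [h u] x" "ind x (C \<union> ?R) V" by auto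
    obtain k where k: "aut (C \<union> ?R) k" "map k [h u] = x" using same_type_aut[OF sCR x(1)] by blast
    let ?v = "k (h u)"
    have xv: "x = [?v]" using k(2) by simp
    let ?G = "insert (u, ?v) G"
    have kh: "aut C (k \<circ> h)" using aut_comp[OF aut_mono[OF k(1)] h(1)] by blast
    have map: "snd p = (k \<circ> h) (fst p)" if "p \<in> ?G" for p
    proof (cases "p \<in> G")
      case True
      then have "k (snd p) = snd p" using k(1) by (simp add: aut_def)
      then show ?thesis using ss[OF True] by simp
    next
      case False then show ?thesis using that by simp
    qed
    have "Q ?G" unfolding Q_def
    proof (intro allI impI conjI)
      fix ps assume ps: "set ps \<subseteq> ?G"
      have "fst ` set ps \<subseteq> insert u (fst ` G)" using image_mono[OF ps, of fst] by simp
      then show "fst ` set ps \<subseteq> U" using fG u(1) by blast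
      have "map snd ps = map (k \<circ> h) (map fst ps)" using ps map by auto
      then show "same_type C (map fst ps) (map snd ps)" using aut_same_type[OF kh] by metis
      let ?r = "filter (\<lambda>y. y \<in> ?R) (map snd ps)"
      have "ind (?r @ [?v]) C V"
      proof (rule transitivity_left[OF sm(1) sR sm(3)])
        show "ind [?v] (C \<union> ?R) V" using x(2) xv by simp
        show "set ?r \<subseteq> ?R" by auto
        fix r assume "set r \<subseteq> ?R"
        then obtain qs where "r = map snd qs" "set qs \<subseteq> G"
          by (induction r) (auto, metis insert_subset list.simps(15) list.simps(9) snd_conv)
        then show "ind r C V" using QG(3) by simp
      qed
      then show "ind (map snd ps) C V" by (rule ind_left) (use ps in force)
    qed
    then have "?G = G" by (intro G(2)) auto
    then show False using u(2) by force
  qed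
  have "Ind (h ` U) C V" unfolding Ind_def
  proof (intro allI impI)
    fix a assume a: "set a \<subseteq> h ` U"
    let ?ps = "map (\<lambda>x. (inv h x, x)) a"
    have i: "inj h" using h(1) by (auto simp: aut_def automorphism_def bij_def)
    have "set ?ps \<subseteq> G"
    proof
      fix p assume "p \<in> set ?ps"
      then obtain u where "u \<in> U" "p = (u, h u)" using a i by auto
      then show "p \<in> G" using \<open>U \<subseteq> fst ` G\<close> ss by (metis (no_types, lifting) image_iff prod.collapse subsetD)
    qed
    from QG(3)[OF this] show "ind a C V" by (simp add: o_def)
  qed
  then show ?thesis using that h(1) by blast
qed

text \<open>
  Induction on the length: if \<open>b\<^sub>i\<close> is independent from the other members listed so far, and all of
  them are independent from \<open>b\<^sub>N\<close>, then \<open>b\<^sub>i\<close> is also independent from the others together with \<open>b\<^sub>N\<close>.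
\<close>

lemma linear_independence:
  fixes b :: "nat \<Rightarrow> 'm list"
  assumes B: "small M B" and lin: "\<And>i. i < N \<Longrightarrow> Ind (\<Union>j<i. set (b j)) B (set (b i))"
  shows "i < N \<Longrightarrow> Ind (set (b i)) B (\<Union>j\<in>{..<N} - {i}. set (b j))"
  using lin
proof (induction N)
  case (Suc N)
  show ?case
  proof (cases "i = N")
    case True
    then have "{..<Suc N} - {i} = {..<i}" by auto
    then show ?thesis using Ind_sym[OF B] Suc.prems by simp
  next
    case False
    then have i: "i < N" using Suc.prems by simp
    let ?R = "\<Union>j\<in>{..<N} - {i}. set (b j)"
    have IH: "Ind (set (b i)) B ?R" using Suc i by simp
    have eq: "?R \<union> set (b i) = (\<Union>j<N. set (b j))" using i by auto
    have "Ind (?R \<union> set (b i)) B (set (b N))" unfolding eq using Suc.prems by simp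
    then have "Ind (set (b i)) (B \<union> ?R) (set (b N))" using B by (rule_tac Ind_split) simp_all
    then have "Ind (set (b i)) B (?R \<union> set (b N))" using B IH by (rule_tac Ind_trans) simp_all
    moreover have "?R \<union> set (b N) = (\<Union>j\<in>{..<Suc N} - {i}. set (b j))" using False by (auto simp: less_Suc_eq)
    ultimately show ?thesis by simp
  qed
qed simp

lemma linear_independence_infinite:
  fixes b :: "nat \<Rightarrow> 'm list"
  assumes B: "small M B" and lin: "\<And>i. Ind (\<Union>j<i. set (b j)) B (set (b i))"
  shows "Ind (set (b i)) B (\<Union>j\<in>UNIV - {i}. set (b j))"
proof -
  have "Ind (set (b i)) B (\<Union>n. \<Union>j\<in>{..<n} - {i}. set (b j))"
  proof (rule Ind_UN_chain)
    fix n
    have "Ind (set (b i)) B (\<Union>j\<in>{..<max n (Suc i)} - {i}. set (b j))"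
      by (rule linear_independence[OF B lin]) simp
    then show "Ind (set (b i)) B (\<Union>j\<in>{..<n} - {i}. set (b j))" by (rule Ind_mono) auto
    show "(\<Union>j\<in>{..<n} - {i}. set (b j)) \<subseteq> (\<Union>j\<in>{..<Suc n} - {i}. set (b j))" by (rule UN_mono) auto
  qed
  moreover have "(\<Union>n. \<Union>j\<in>{..<n} - {i}. set (b j)) = (\<Union>j\<in>UNIV - {i}. set (b j))" by auto
  ultimately show ?thesis by simp
qed

section \<open>Domination and weight one\<close>

definition dominating :: "'m set \<Rightarrow> 'm set \<Rightarrow> 'm set \<Rightarrow> bool" where
  "dominating C X Y \<longleftrightarrow> (\<forall>c. Ind X C (set c) \<longrightarrow> Ind Y C (set c))"

lemma dominating_Ind: "dominating C X Y \<Longrightarrow> Ind X C Z \<Longrightarrow> Ind Y C Z"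
  unfolding dominating_def by (rule Ind_finite) (meson Ind_mono order_refl sup.coboundedI2)

lemma dominating_mono: "dominating C X Y \<Longrightarrow> Y' \<subseteq> Y \<Longrightarrow> dominating C X Y'"
  unfolding dominating_def by (meson Ind_mono sup_ge2)

lemma dominating_up:
  assumes "dominating C X Y" "C \<subseteq> D" "small M D" "small M X" "Ind X C D" shows "dominating D X Y"
  unfolding dominating_def
proof (intro allI impI)
  fix c assume "Ind X D (set c)"
  then have "Ind X C (D \<union> set c)" using assms by (rule_tac Ind_trans') simp_all
  then have "Ind Y C (D \<union> set c)" by (rule dominating_Ind[OF assms(1)])
  then have "Ind Y D (D \<union> set c)" by (rule Ind_base) (use assms(2) in auto)
  then show "Ind Y D (set c)" by (rule Ind_mono) auto
qed

text \<open>
  Thorn-weight at most one, formulated for \<open>D\<close> itself and not for the realizations of its type, so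
  that automorphisms can be avoided. An independent family with more members contains an
  independent pair.
\<close>

definition weight_le_1 :: "'m set \<Rightarrow> 'm set \<Rightarrow> bool" where
  "weight_le_1 D X \<longleftrightarrow> (\<forall>Y c0 c1. X \<subseteq> Y \<longrightarrow> small M Y \<longrightarrow> Ind D X Y \<longrightarrow> Ind (set c0) Y (set c1) \<longrightarrow>
     Ind D Y (set c0) \<or> Ind D Y (set c1))"

lemma weight_le_1D: "weight_le_1 D X \<Longrightarrow> small M X \<Longrightarrow> Ind (set c0) X (set c1) \<Longrightarrow> Ind D X (set c0) \<or> Ind D X (set c1)"
  unfolding weight_le_1_def using Ind_self by blast

lemma weight_le_1_up:
  assumes "weight_le_1 D X" "X \<subseteq> X'" "small M X'" "small M D" "Ind D X X'" shows "weight_le_1 D X'"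
  unfolding weight_le_1_def
proof (intro allI impI)
  fix Y c0 c1 assume Y: "X' \<subseteq> Y" "small M Y" "Ind D X' Y" "Ind (set c0) Y (set c1)"
  have "Ind D X Y" by (rule Ind_down[OF assms(3) Y(2) assms(4,5) Y(3) assms(2)]) blast
  then show "Ind D Y (set c0) \<or> Ind D Y (set c1)" using assms(1,2) Y unfolding weight_le_1_def by blast
qed

text \<open>
  Rudimentarily finite thorn-weight, formulated for one fixed realization \<open>a\<close>.
\<close>

definition rudimentary :: "'m set \<Rightarrow> 'm set \<Rightarrow> bool" where
  "rudimentary a A \<longleftrightarrow> (\<forall>B. A \<subseteq> B \<longrightarrow> small M B \<longrightarrow> Ind a A B \<longrightarrow>
     \<not> (\<exists>b :: nat \<Rightarrow> 'm list. (\<forall>i. Ind (set (b i)) B (\<Union>j\<in>UNIV - {i}. set (b j))) \<and> (\<forall>i. \<not> Ind a B (set (b i)))))"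

lemma rudimentary_up:
  assumes "rudimentary a A" "A \<subseteq> X" "small M X" "small M a" "Ind a A X" shows "rudimentary a X"
  unfolding rudimentary_def
proof (intro allI impI)
  fix B assume B: "X \<subseteq> B" "small M B" "Ind a X B"
  have "Ind a A B" by (rule Ind_down[OF assms(3) B(2) assms(4,5) B(3) assms(2)]) blast
  then show "\<not> (\<exists>b :: nat \<Rightarrow> 'm list. (\<forall>i. Ind (set (b i)) B (\<Union>j\<in>UNIV - {i}. set (b j))) \<and> (\<forall>i. \<not> Ind a B (set (b i))))"
    using assms(1,2) B unfolding rudimentary_def by blast
qed

lemma small_by_le: "small M A \<Longrightarrow> |X - A| \<le>o |T| \<Longrightarrow> small M X"
proof -
  assume A: "small M A" and X: "|X - A| \<le>o |T|"
  have "small M (A \<union> (X - A))" by (rule small_Un[OF A small_le_T[OF X]])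
  then show ?thesis by (rule small_mono) blast
qed

lemma le_T_trans: "|Y - X| \<le>o |T| \<Longrightarrow> |X - A| \<le>o |T| \<Longrightarrow> |Y - A| \<le>o |T|"
  by (rule mono_le_T[OF Un_le_T[of "Y - X" "X - A"]]) auto

text \<open>
  The tuples are only required to be independent over growing bases. Since \<open>e\<^sub>0\<dots>e\<^bsub>n-1\<^esub>\<close> is independent
  over \<open>B n\<close> from everything that is added later, the whole sequence becomes independent over the
  union of the bases. As \<open>\<kappa>\<close> may be singular, the bound \<open>|B n - A| \<le> |T|\<close> is needed to keep this
  union small.
\<close>

lemma rudimentary_no_chain:
  fixes B :: "nat \<Rightarrow> 'm set" and e :: "nat \<Rightarrow> 'm list"
  assumes A: "small M A" and a: "small M a" and rudimentary: "rudimentary a A"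
    and AB: "A \<subseteq> B 0" and BB: "\<And>n. B n \<subseteq> B (Suc n)" and sz: "\<And>n. |B n - A| \<le>o |T|"
    and aB: "\<And>n. Ind a A (B n)" and dep: "\<And>n. \<not> Ind a (B (Suc n)) (set (e n))"
    and E: "\<And>n. Ind (\<Union>j<n. set (e j)) (B n) (B (Suc n) \<union> set (e n))"
  shows False
proof -
  let ?E = "\<lambda>n. \<Union>j<n. set (e j)"
  have mono: "B m \<subseteq> B n" if "m \<le> n" for m n using that by (rule lift_Suc_mono_le[of B, OF BB])
  have sB: "small M (B n)" for n by (rule small_by_le[OF A sz])
  let ?W = "\<Union>n. B n"
  have "|UNIV :: nat set| \<le>o |T|" using infinite_T infinite_iff_card_of_nat by blast
  then have "|\<Union>n\<in>UNIV. B n - A| \<le>o |T|" using sz by (rule UN_le_T)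
  then have "|?W - A| \<le>o |T|" by (rule mono_le_T) auto
  then have sW: "small M ?W" by (rule small_by_le[OF A])
  have AW: "A \<subseteq> ?W" using AB by blast
  have aW: "Ind a A ?W" by (rule Ind_UN_chain[of a A B, OF aB BB])
  have step: "Ind (?E n) (B n) (B m \<union> (\<Union>j\<in>{n..<m}. set (e j)))" if "n \<le> m" for n m
    using that
  proof (induction m rule: dec_induct)
    case base show ?case using Ind_self[OF sB] by simp
  next
    case (step m)
    let ?F = "\<Union>j\<in>{n..<m}. set (e j)"
    have "{..<m} = {n..<m} \<union> {..<n}" using step(1) by auto
    then have "?F \<union> ?E n = ?E m" by (simp add: UN_Un)
    then have "Ind (?F \<union> ?E n) (B m) (B (Suc m) \<union> set (e m))" using E[of m] by simp
    then have "Ind (?E n) (B m \<union> ?F) (B (Suc m) \<union> set (e m))" using sB by (rule_tac Ind_split) simp_all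
    moreover have "B n \<subseteq> B m \<union> ?F" using mono[OF step(1)] by blast
    ultimately have "Ind (?E n) (B n) ((B m \<union> ?F) \<union> (B (Suc m) \<union> set (e m)))"
      using sB step.IH by (rule_tac Ind_trans') simp_all
    then show ?case by (rule Ind_mono) (use step(1) in \<open>auto simp: less_Suc_eq\<close>)
  qed
  have lin: "Ind (?E i) ?W (set (e i))" for i
  proof -
    have "Ind (?E i) (B i) (\<Union>m. B (Suc (i + m)) \<union> set (e i))"
    proof (rule Ind_UN_chain)
      show "Ind (?E i) (B i) (B (Suc (i + n)) \<union> set (e i))" for n
        by (rule Ind_mono[OF step[of i "Suc (i + n)"]]) auto
    qed (use BB in auto)
    then have 1: "Ind (?E i) (B i) (?W \<union> set (e i))"
    proof (rule Ind_mono)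
      have "B n \<subseteq> (\<Union>m. B (Suc (i + m)) \<union> set (e i))" for n
        using mono[of n "Suc (i + n)"] by auto
      then show "?W \<union> set (e i) \<subseteq> B i \<union> (\<Union>m. B (Suc (i + m)) \<union> set (e i))" by blast
    qed simp
    have "Ind (?E i) ?W (?W \<union> set (e i))" by (rule Ind_base[OF 1]) auto
    then show ?thesis by (rule Ind_mono) auto
  qed
  have "\<not> Ind a ?W (set (e i))" for i
  proof
    assume "Ind a ?W (set (e i))"
    then have "Ind a A (?W \<union> set (e i))" using Ind_trans'[OF sW _ a aW _ AW] by simp
    then have "Ind a (B (Suc i)) (?W \<union> set (e i))" by (rule Ind_base) (use AB mono[of 0 "Suc i"] in auto)
    then have "Ind a (B (Suc i)) (set (e i))" by (rule Ind_mono) auto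
    then show False using dep by blast
  qed
  then show False using rudimentary AW sW aW linear_independence_infinite[OF sW lin] unfolding rudimentary_def by blast
qed

section \<open>Finding types of weight one\<close>

text \<open>
  Enlarging the base as long as possible makes \<open>a\<close> dominate \<open>d\<close>. But full domination may be
  incompatible with the independence of \<open>E\<close> from \<open>d\<close>. Only those extensions are used here which
  preserve it; the result is domination restricted to those \<open>c\<close> for which \<open>E\<close> is
  independent from \<open>cd\<close>.
\<close>

lemma maximal_base:
  assumes B: "small M B" and fin: "small M a" "small M E" and E: "Ind E B (set d)"
  obtains X where "B \<subseteq> X" "|X - B| \<le>o |T|" "Ind a B X" "Ind E B (X \<union> set d)"
    "\<And>c. Ind a X (set c) \<Longrightarrow> Ind E X (set c \<union> set d) \<Longrightarrow> Ind (set d) X (set c)"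
proof -
  define P where "P X \<longleftrightarrow> Ind a B X \<and> Ind E B (X \<union> set d)" for X
  have P0: "P B" unfolding P_def using Ind_self[OF B] Ind_mono[OF E, of E "B \<union> set d"] by simp
  have fc: "P X \<longleftrightarrow> (\<forall>F. finite F \<longrightarrow> F \<subseteq> X \<longrightarrow> P (B \<union> F))" if "B \<subseteq> X" for X
  proof
    assume P: "P X"
    show "\<forall>F. finite F \<longrightarrow> F \<subseteq> X \<longrightarrow> P (B \<union> F)"
    proof (intro allI impI)
      fix F assume F: "F \<subseteq> X"
      have "Ind a B X" "Ind E B (X \<union> set d)" using P by (simp_all add: P_def)
      then show "P (B \<union> F)" unfolding P_def
        using Ind_mono[of a B X a "B \<union> F"] Ind_mono[of E B "X \<union> set d" E "B \<union> F \<union> set d"] F by blast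
    qed
  next
    assume *: "\<forall>F. finite F \<longrightarrow> F \<subseteq> X \<longrightarrow> P (B \<union> F)"
    have "Ind a B X"
    proof (rule Ind_finite)
      fix c assume "set c \<subseteq> X"
      then have "P (B \<union> set c)" using * by blast
      then have "Ind a B (B \<union> set c)" by (simp add: P_def)
      then show "Ind a B (set c)" by (rule Ind_mono) auto
    qed
    moreover have "Ind E B (X \<union> set d)"
    proof (rule Ind_finite)
      fix c assume c: "set c \<subseteq> X \<union> set d"
      have "P (B \<union> (set c \<inter> X))" using * by blast
      then have "Ind E B (B \<union> (set c \<inter> X) \<union> set d)" by (simp add: P_def)
      then show "Ind E B (set c)" by (rule Ind_mono) (use c in auto)
    qed
    ultimately show "P X" by (simp add: P_def)
  qed
  obtain X where X: "B \<subseteq> X" "|X - B| \<le>o |T|" "P X" "\<And>c. P (X \<union> set c) \<Longrightarrow> ind d X (set c)"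
    by (rule chain_maximal[where P = P and b = d, OF B P0 fc]) blast+
  have sX: "small M X" by (rule small_by_le[OF B X(2)])
  have PX: "Ind a B X" "Ind E B (X \<union> set d)" using X(3) by (simp_all add: P_def)
  have "Ind (set d) X (set c)" if c: "Ind a X (set c)" "Ind E X (set c \<union> set d)" for c
  proof -
    have "Ind a B (X \<union> set c)" by (rule Ind_trans'[OF sX _ fin(1) PX(1) c(1) X(1)]) simp
    moreover have EX: "Ind E B X" using PX(2) by (rule Ind_mono) auto
    have "Ind E B (X \<union> (set c \<union> set d))" by (rule Ind_trans'[OF sX _ fin(2) EX c(2) X(1)]) simp
    ultimately have "P (X \<union> set c)" unfolding P_def by (simp add: Un_assoc)
    then show ?thesis using X(4) Ind_set by blast
  qed
  then show ?thesis using that X(1,2) PX by blast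
qed

lemma dominating_base:
  assumes B: "small M B" and fin: "small M a"
  obtains X where "B \<subseteq> X" "|X - B| \<le>o |T|" "Ind a B X" "dominating X a (set d)"
proof -
  obtain X where X: "B \<subseteq> X" "|X - B| \<le>o |T|" "Ind a B X"
    "\<And>c. Ind a X (set c) \<Longrightarrow> Ind {} X (set c \<union> set d) \<Longrightarrow> Ind (set d) X (set c)"
    using maximal_base[OF B fin small_finite[OF finite.emptyI] Ind_empty[OF B]] by metis
  have "small M X" by (rule small_by_le[OF B X(2)])
  then have "dominating X a (set d)" unfolding dominating_def using X(4) Ind_empty by blast
  then show ?thesis using that X by blast
qed

text \<open>
  Let \<open>c0\<close> and \<open>c1\<close> be independent over \<open>Y\<close> and both depend on \<open>d\<close>. After moving \<open>Yc0c1\<close> over \<open>Bd\<close>, it is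
  independent from \<open>aE\<close> over \<open>Bd\<close>. Then \<open>E\<close> is independent from all of it, which is exactly the case in
  which the restricted domination \<open>G\<close> applies, and \<open>a\<close> depends on the images of \<open>c0\<close> and \<open>c1\<close>.
\<close>

lemma weight_split:
  assumes B: "small M B" and fin: "small M a" "small M E" and E: "Ind E B (set d)"
    and G: "\<And>c. Ind a B (set c) \<Longrightarrow> Ind E B (set c \<union> set d) \<Longrightarrow> Ind (set d) B (set c)"
    and nw: "\<not> weight_le_1 (set d) B"
  obtains X d0 d1 where "B \<subseteq> X" "|X - B| \<le>o |T|" "Ind a B X" "Ind (set d0) X (set d1)"
    "\<not> Ind a X (set d0)" "\<not> Ind a X (set d1)" "Ind E B (X \<union> set d0 \<union> set d1)"
proof -
  obtain Y c0 c1 where Y: "B \<subseteq> Y" "small M Y" "Ind (set d) B Y" "Ind (set c0) Y (set c1)"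
     "\<not> Ind (set d) Y (set c0)" "\<not> Ind (set d) Y (set c1)" using nw unfolding weight_le_1_def by blast
  \<comment> \<open>Local character replaces \<open>Y\<close> by an extension of \<open>B\<close> by at most \<open>|T|\<close> elements.\<close>
  obtain Y0 where Y0: "Y0 \<subseteq> Y" "|Y0| \<le>o |T|" "ind (d @ c0 @ c1) Y0 Y" using local_character[OF Y(2)] by blast
  let ?Y = "B \<union> Y0"
  have sY: "small M ?Y" using B small_le_T[OF Y0(2)] by simp
  have sub: "?Y \<subseteq> Y" using Y(1) Y0(1) by blast
  have "Ind (set (d @ c0 @ c1)) Y0 Y" using Y0(3) Ind_set by blast
  then have loc: "Ind (set (d @ c0 @ c1)) ?Y Y" by (rule Ind_base) (use sub in auto)
  have d: "Ind (set d) B ?Y" using Y(3) by (rule Ind_mono) (use sub in auto)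
  have cc: "Ind (set c0) ?Y (set c1)"
  proof -
    have 1: "Ind (set c0) ?Y Y" using loc by (rule Ind_mono) auto
    show ?thesis by (rule Ind_down[OF Y(2) _ _ 1 Y(4) sub]) auto
  qed
  have dep: "\<not> Ind (set d) ?Y (set c)" if c: "set c \<subseteq> set (c0 @ c1)" "\<not> Ind (set d) Y (set c)" for c
  proof
    assume i: "Ind (set d) ?Y (set c)"
    have "Ind (set c \<union> set d) ?Y Y" using loc by (rule Ind_mono) (use c(1) in auto)
    then have "Ind (set d) (?Y \<union> set c) Y" using sY by (rule_tac Ind_split) simp_all
    then have "Ind (set d) ?Y (set c \<union> Y)" using sY Y(2) i by (rule_tac Ind_trans) simp_all
    then have "Ind (set d) Y (set c \<union> Y)" by (rule Ind_base) (use sub in auto)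
    then have "Ind (set d) Y (set c)" by (rule Ind_mono) auto
    then show False using c(2) by blast
  qed
  let ?U = "?Y \<union> set c0 \<union> set c1"
  obtain h where h: "aut (B \<union> set d) h" "Ind (h ` ?U) (B \<union> set d) (a \<union> E)"
    using free_extension[of "B \<union> set d" ?U "a \<union> E"] B sY fin by auto
  let ?X = "h ` ?Y" and ?d0 = "map h c0" and ?d1 = "map h c1"
  have hB: "h ` B = B" "h ` set d = set d" using aut_image[OF h(1)] by blast+
  have BX: "B \<subseteq> ?X" using hB by blast
  have "|h ` Y0| \<le>o |T|" using card_of_image[of h Y0] Y0(2) ordLeq_transitive by blast
  then have sz: "|?X - B| \<le>o |T|" by (rule mono_le_T) (use hB in auto)
  have sX: "small M ?X" by (rule small_by_le[OF B sz])
  have i1: "Ind (set ?d0) ?X (set ?d1)" using cc Ind_aut[OF h(1), of "set c0" ?Y "set c1"] by simp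
  have n0: "\<not> Ind (set d) ?X (set ?d0)" using dep[OF _ Y(5)] Ind_aut[OF h(1), of "set d" ?Y "set c0"] hB by auto
  have n1: "\<not> Ind (set d) ?X (set ?d1)" using dep[OF _ Y(6)] Ind_aut[OF h(1), of "set d" ?Y "set c1"] hB by auto
  have dX: "Ind (set d) B ?X" using d Ind_aut[OF h(1), of "set d" B ?Y] hB by simp
  let ?W = "?X \<union> set ?d0 \<union> set ?d1"
  have W: "Ind ?W (B \<union> set d) (a \<union> E)" using h(2) by (simp add: image_Un)
  have "Ind ?X (B \<union> set d) (a \<union> E)" using W by (rule Ind_mono) auto
  then have "Ind ?X B (set d \<union> (a \<union> E))" using B sX fin Ind_sym[OF B dX] by (rule_tac Ind_trans) simp_all
  then have "Ind ?X B a" by (rule Ind_mono) auto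
  then have aX: "Ind a B ?X" by (rule Ind_sym[OF B])
  have EW: "Ind E B (set d \<union> ?W)"
  proof (rule Ind_trans[OF B _ _ fin(2) E])
    have "Ind (a \<union> E) (B \<union> set d) ?W" using W B by (rule_tac Ind_sym) simp_all
    then show "Ind E (B \<union> set d) ?W" by (rule Ind_mono) auto
  qed (use sX in simp_all)
  have na: "\<not> Ind a ?X (set c)" if c: "set c \<subseteq> ?W" "\<not> Ind (set d) ?X (set c)" for c
  proof
    assume "Ind a ?X (set c)"
    then have ac: "Ind a B (?X \<union> set c)" using Ind_trans'[OF sX _ fin(1) aX _ BX] by simp
    have "Ind (set d) B (?X \<union> set c)"
    proof (rule Ind_finite)
      fix z assume z: "set z \<subseteq> ?X \<union> set c"
      have "Ind a B (set z)" using ac by (rule Ind_mono) (use z in auto)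
      moreover have "Ind E B (set z \<union> set d)" using EW by (rule Ind_mono) (use z c(1) in auto)
      ultimately show "Ind (set d) B (set z)" by (rule G)
    qed
    then have "Ind (set d) ?X (?X \<union> set c)" by (rule Ind_base) (use BX in auto)
    then have "Ind (set d) ?X (set c)" by (rule Ind_mono) auto
    then show False using c(2) by blast
  qed
  have "Ind E B ?W" using EW by (rule Ind_mono) auto
  then show ?thesis using that[OF BX sz aX i1] na[OF _ n0] na[OF _ n1] by blast
qed

text \<open>
  Otherwise \<open>maximal_base\<close> and \<open>weight_split\<close> can be applied in turn without end. Each round splits the
  current tuple \<open>d\<close> into \<open>d0\<close>, which joins the set \<open>F\<close> of independent tuples collected so far, and
  \<open>d1\<close>, which is independent from \<open>F\<close> and \<open>d0\<close> and is split in the next round. Since \<open>a\<close> depends on all the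
  tuples \<open>d0\<close>, this contradicts \<open>rudimentary_no_chain\<close>.
\<close>

lemma weight_one_exists:
  assumes B: "small M B" and fin: "small M a" "small M E" and rudimentary: "rudimentary a B"
    and E: "Ind E B (set c)" and dep: "\<not> Ind a B (set c)"
  obtains X d where "B \<subseteq> X" "|X - B| \<le>o |T|" "Ind a B X" "Ind E B (X \<union> set d)" "\<not> Ind a X (set d)" "weight_le_1 (set d) X"
proof (rule ccontr)
  note th = that
  assume nt: "\<not> thesis"
  have neg: "\<not> weight_le_1 (set d) X" if "B \<subseteq> X" "|X - B| \<le>o |T|" "Ind a B X" "Ind E B (X \<union> set d)" "\<not> Ind a X (set d)" for X d
    using th[OF that] nt by blast
  define I :: "'m set \<times> 'm set \<times> 'm list \<times> 'm list \<Rightarrow> bool" where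
    "I s \<longleftrightarrow> (case s of (X, F, d, e) \<Rightarrow> B \<subseteq> X \<and> |X - B| \<le>o |T| \<and> Ind a B X \<and> Ind E B (X \<union> set d) \<and> small M F \<and> E \<subseteq> F \<and>
        Ind F X (set d) \<and> \<not> Ind a X (set d))" for s
  define J :: "'m set \<times> 'm set \<times> 'm list \<times> 'm list \<Rightarrow> 'm set \<times> 'm set \<times> 'm list \<times> 'm list \<Rightarrow> bool" where
    "J s s' \<longleftrightarrow> (case s of (X, F, d, e) \<Rightarrow> case s' of (X', F', d', e') \<Rightarrow> X \<subseteq> X' \<and> F' = F \<union> set e' \<and>
        \<not> Ind a X' (set e') \<and> Ind F X (X' \<union> set e'))" for s s'
  have I0: "I (B, E, c, [])" unfolding I_def
    using Ind_self[OF B] E dep fin(2) Ind_mono[OF E, of E "B \<union> set c"] finite_le_T[of "{}"] by simp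
  have step: "\<exists>s'. I s' \<and> J s s'" if Is: "I s" for s
  proof -
    obtain Xn F d e where s: "s = (Xn, F, d, e)" by (cases s)
    have X: "B \<subseteq> Xn" "|Xn - B| \<le>o |T|" "Ind a B Xn" "Ind E B (Xn \<union> set d)" "small M F" "E \<subseteq> F" "Ind F Xn (set d)" "\<not> Ind a Xn (set d)"
      using Is by (simp_all add: I_def s)
    have sX: "small M Xn" by (rule small_by_le[OF B X(2)])
    obtain Y where Y: "Xn \<subseteq> Y" "|Y - Xn| \<le>o |T|" "Ind a Xn Y" "Ind F Xn (Y \<union> set d)"
       "\<And>c. Ind a Y (set c) \<Longrightarrow> Ind F Y (set c \<union> set d) \<Longrightarrow> Ind (set d) Y (set c)"
      by (rule maximal_base[OF sX fin(1) X(5,7)]) blast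
    have sY: "small M Y" by (rule small_by_le[OF sX Y(2)])
    have FY: "Ind F Xn Y" using Y(4) by (rule Ind_mono) auto
    have BY: "B \<subseteq> Y" using X(1) Y(1) by blast
    have szY: "|Y - B| \<le>o |T|" by (rule le_T_trans[OF Y(2) X(2)])
    have aY: "Ind a B Y" by (rule Ind_down[OF sX sY fin(1) X(3) Y(3) X(1)]) blast
    have EY: "Ind E B (Y \<union> set d)"
    proof -
      have 1: "Ind E B Xn" using X(4) by (rule Ind_mono) auto
      have 2: "Ind E Xn (Y \<union> set d)" using Y(4) by (rule Ind_mono) (use X(6) in auto)
      show ?thesis by (rule Ind_down[OF sX _ fin(2) 1 2 X(1)]) (use sY in auto)
    qed
    have nY: "\<not> Ind a Y (set d)"
    proof
      assume ad: "Ind a Y (set d)"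
      have "Ind a Xn (set d)" by (rule Ind_down[OF sY _ fin(1) Y(3) ad Y(1)]) auto
      then show False using X(8) by blast
    qed
    have nw: "\<not> weight_le_1 (set d) Y" by (rule neg[OF BY szY aY EY nY])
    have Fd: "Ind F Y (set d)"
      by (rule Ind_mono[OF Ind_base[OF Y(4) Y(1)]]) auto
    obtain Z d0 d1 where Z: "Y \<subseteq> Z" "|Z - Y| \<le>o |T|" "Ind a Y Z" "Ind (set d0) Z (set d1)"
      "\<not> Ind a Z (set d0)" "\<not> Ind a Z (set d1)" "Ind F Y (Z \<union> set d0 \<union> set d1)"
      by (rule weight_split[OF sY fin(1) X(5) Fd Y(5) nw]) blast+
    have sZ: "small M Z" by (rule small_by_le[OF sY Z(2)])
    have szZ: "|Z - B| \<le>o |T|" by (rule le_T_trans[OF Z(2) szY])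
    have aZ: "Ind a B Z" by (rule Ind_down[OF sY sZ fin(1) aY Z(3) BY]) blast
    have EZ: "Ind E B (Z \<union> set d1)"
    proof -
      have 1: "Ind E B Y" using EY by (rule Ind_mono) auto
      have 2: "Ind E Y (Z \<union> set d1)" using Z(7) by (rule Ind_mono) (use X(6) in auto)
      show ?thesis by (rule Ind_down[OF sY _ fin(2) 1 2 BY]) (use sZ in auto)
    qed
    have F1: "Ind (set d0 \<union> F) Z (set d1)"
    proof (rule Ind_trans_left[OF sZ _ _ Z(4)])
      have "Ind F (Z \<union> set d0) (Z \<union> set d0 \<union> set d1)" using Z(7) by (rule Ind_base) (use Z(1) in auto)
      then show "Ind F (Z \<union> set d0) (set d1)" by (rule Ind_mono) auto
    qed simp_all
    have F2: "Ind F Xn (Z \<union> set d0)"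
      by (rule Ind_down[OF sY _ X(5) FY Z(7) Y(1)]) (use sZ in auto)
    have "I (Z, F \<union> set d0, d1, d0)" unfolding I_def prod.case
      using BY Z(1) szZ aZ EZ X(5,6) F1 Z(6) by (auto simp: Un_commute)
    moreover have "J s (Z, F \<union> set d0, d1, d0)" unfolding J_def s prod.case
      using Y(1) Z(1,5) F2 by auto
    ultimately show ?thesis by blast
  qed
  obtain s where s: "\<And>n :: nat. I (s n)" "\<And>n. J (s n) (s (Suc n))"
    using dependent_nat_choice[of "\<lambda>_. I" "\<lambda>_. J"] I0 step by blast
  define X where "X n = fst (s n)" for n
  define F where "F n = fst (snd (s n))" for n
  define e where "e n = snd (snd (snd (s (Suc n))))" for n
  have sn: "s n = (X n, F n, fst (snd (snd (s n))), snd (snd (snd (s n))))" for n by (simp add: X_def F_def)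
  have IX: "B \<subseteq> X n \<and> |X n - B| \<le>o |T| \<and> Ind a B (X n)" for n
    using s(1)[of n] by (subst (asm) sn) (simp add: I_def)
  have JX: "X n \<subseteq> X (Suc n) \<and> F (Suc n) = F n \<union> set (e n) \<and> \<not> Ind a (X (Suc n)) (set (e n)) \<and> Ind (F n) (X n) (X (Suc n) \<union> set (e n))" for n
    using s(2)[of n] by (simp add: J_def e_def X_def F_def case_prod_beta)
  have FU: "(\<Union>j<n. set (e j)) \<subseteq> F n" for n
  proof (induction n)
    case (Suc n)
    have "F (Suc n) = F n \<union> set (e n)" using JX[of n] by blast
    then show ?case using Suc by (simp only: lessThan_Suc UN_insert) blast
  qed simp
  show False
  proof (rule rudimentary_no_chain[OF B fin(1) rudimentary, of X e])
    show "Ind (\<Union>j<n. set (e j)) (X n) (X (Suc n) \<union> set (e n))" for n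
      using JX[of n] FU[of n] Ind_mono by blast
  qed (use IX JX in blast)+
qed

section \<open>Decomposition\<close>

lemma dominating_refl: "dominating C X X" by (simp add: dominating_def)

lemma take_concat_set: "set (concat (take i bs)) \<subseteq> set (concat bs)"
  by (auto dest: in_set_takeD)

lemma take_nth_concat_set:
  assumes "i < length bs" shows "set (concat (take i bs)) \<union> set (bs ! i) \<subseteq> set (concat bs)"
  unfolding Un_subset_iff using take_concat_set[of i bs] UN_upper[OF nth_mem[OF assms], of set] by simp

text \<open>
  The clause on domination concerns \<open>a\<close> together with \<open>bs\<close>. Domination of \<open>bs\<close> alone would not be
  inherited by longer sequences.
\<close>

definition partial_basis :: "'m list \<Rightarrow> 'm set \<Rightarrow> 'm set \<Rightarrow> 'm list list \<Rightarrow> bool" where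
  "partial_basis a A X bs \<longleftrightarrow> A \<subseteq> X \<and> |X - A| \<le>o |T| \<and> Ind (set a) A X \<and>
     dominating X (set a) (set a \<union> set (concat bs)) \<and>
     (\<forall>i<length bs. Ind (set (concat (take i bs))) X (set (bs ! i))) \<and>
     (\<forall>b\<in>set bs. \<not> Ind (set a) X (set b) \<and> weight_le_1 (set b) X)"

lemma partial_basisD:
  assumes "partial_basis a A X bs"
  shows "A \<subseteq> X" "|X - A| \<le>o |T|" "Ind (set a) A X" "dominating X (set a) (set a \<union> set (concat bs))"
    "\<And>i. i < length bs \<Longrightarrow> Ind (set (concat (take i bs))) X (set (bs ! i))"
    "\<And>b. b \<in> set bs \<Longrightarrow> \<not> Ind (set a) X (set b)" "\<And>b. b \<in> set bs \<Longrightarrow> weight_le_1 (set b) X"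
  using assms unfolding partial_basis_def by blast+

text \<open>
  If \<open>bs\<close> does not dominate \<open>a\<close>, then \<open>weight_one_exists\<close> provides a tuple \<open>b\<close> of weight one on which \<open>a\<close>
  depends and which is independent from \<open>bs\<close>. To see that \<open>a\<close> dominates \<open>bs\<close> and \<open>b\<close> together, let \<open>g\<close>
  be independent from \<open>a\<close>, hence from \<open>a\<close> and \<open>bs\<close>. If \<open>g\<close> depended on \<open>bs\<close> and \<open>b\<close>, then over \<open>bs\<close> the
  tuple \<open>b\<close> would depend both on \<open>g\<close> and on \<open>a\<close>; but these are independent over \<open>bs\<close>, while \<open>b\<close> has
  weight one.
\<close>

lemma partial_basis_extend:
  assumes A: "small M A" and RF: "rudimentary (set a) A" and basis: "partial_basis a A X bs"
    and nd: "\<not> dominating X (set (concat bs)) (set a)"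
  obtains X' b where "X \<subseteq> X'" "partial_basis a A X' (bs @ [b])" "Ind (set (concat bs)) X (X' \<union> set b)"
proof -
  let ?U = "set (concat bs)" and ?a = "set a"
  note X = partial_basisD(1-3)[OF basis] and dm = partial_basisD(4)[OF basis]
    and lin = partial_basisD(5)[OF basis] and wt = partial_basisD(6,7)[OF basis]
  have sX: "small M X" by (rule small_by_le[OF A X(2)])
  have RX: "rudimentary ?a X" by (rule rudimentary_up[OF RF X(1) sX _ X(3)]) simp
  obtain c where c: "Ind ?U X (set c)" "\<not> Ind ?a X (set c)" using nd unfolding dominating_def by blast
  obtain Y b where Y: "X \<subseteq> Y" "|Y - X| \<le>o |T|" "Ind ?a X Y" "Ind ?U X (Y \<union> set b)" "\<not> Ind ?a Y (set b)" "weight_le_1 (set b) Y"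
    by (rule weight_one_exists[OF sX _ _ RX c]) simp_all
  have sY: "small M Y" by (rule small_by_le[OF sX Y(2)])
  have dmY: "dominating Y ?a (?a \<union> ?U)" by (rule dominating_up[OF dm Y(1) sY _ Y(3)]) simp
  have Ub: "Ind ?U Y (set b)" by (rule Ind_mono[OF Ind_base[OF Y(4,1)]]) auto
  have bU: "Ind (set b) Y ?U" by (rule Ind_sym[OF sY Ub])
  have dom2: "dominating Y ?a (?U \<union> set b)" unfolding dominating_def
  proof (intro allI impI, rule ccontr)
    fix g assume g: "Ind ?a Y (set g)" and n: "\<not> Ind (?U \<union> set b) Y (set g)"
    have aUg: "Ind (?a \<union> ?U) Y (set g)" by (rule dominating_Ind[OF dmY g])
    have "Ind ?U Y (set g)" using aUg by (rule Ind_mono) auto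
    then have nb: "\<not> Ind (set b) (Y \<union> ?U) (set g)" using n Ind_trans_left[OF sY, of ?U "set g" "set b"] by auto
    have "Ind (set b) Y (Y \<union> ?U)" using bU by (rule Ind_mono) auto
    then have w: "weight_le_1 (set b) (Y \<union> ?U)" using sY by (intro weight_le_1_up[OF Y(6)]) simp_all
    have "Ind ?a (Y \<union> ?U) (set g)" by (rule Ind_split[OF sY]) (use aUg in \<open>simp_all add: Un_commute\<close>)
    then have "Ind (set g) (Y \<union> ?U) ?a" using sY by (rule_tac Ind_sym) simp_all
    then have "Ind (set b) (Y \<union> ?U) ?a" using weight_le_1D[OF w] nb sY by (metis small_Un_iff small_finite finite_set)
    then have "Ind (set b) Y (?U \<union> ?a)" using sY bU by (rule_tac Ind_trans) simp_all
    then have "Ind (set b) Y ?a" by (rule Ind_mono) auto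
    then show False using Ind_sym[OF sY] Y(5) by blast
  qed
  \<comment> \<open>This second extension preserves what is known about \<open>bs\<close> and \<open>b\<close>, as they are dominated by \<open>a\<close>.\<close>
  obtain Z where Z: "Y \<subseteq> Z" "|Z - Y| \<le>o |T|" "Ind ?a Y Z" "dominating Z ?a (set (a @ concat bs @ b))"
    by (rule dominating_base[OF sY, of ?a "a @ concat bs @ b"]) simp_all
  have sZ: "small M Z" by (rule small_by_le[OF sY Z(2)])
  have UbZ: "Ind (?U \<union> set b) Y Z" by (rule dominating_Ind[OF dom2 Z(3)])
  have UZ: "Ind ?U X Z"
  proof -
    have 1: "Ind ?U X Y" using Y(4) by (rule Ind_mono) auto
    have 2: "Ind ?U Y Z" using UbZ by (rule Ind_mono) auto
    show ?thesis by (rule Ind_down[OF sY sZ _ 1 2 Y(1)]) auto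
  qed
  have aXZ: "Ind ?a X Z" by (rule Ind_down[OF sY sZ _ Y(3) Z(3) Y(1)]) auto
  have XZ: "X \<subseteq> Z" using Y(1) Z(1) by blast
  have "|Y - A| \<le>o |T|" by (rule le_T_trans[OF Y(2) X(2)])
  then have szZ: "|Z - A| \<le>o |T|" by (rule le_T_trans[OF Z(2)])
  have aZ: "Ind ?a A Z" by (rule Ind_down[OF sX sZ _ X(3) aXZ X(1)]) auto
  have lin': "Ind (set (concat (take i (bs @ [b])))) Z (set ((bs @ [b]) ! i))" if i: "i < length (bs @ [b])" for i
  proof (cases "i < length bs")
    case True
    have sub: "set (concat (take i bs)) \<union> set (bs ! i) \<subseteq> ?U" by (rule take_nth_concat_set[OF True])
    have "Ind (set (concat (take i bs))) Z (set (bs ! i))"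
      by (rule Ind_up[OF sX sZ _ _ lin[OF True] Ind_mono[OF UZ sub] XZ]) auto
    then show ?thesis using True by (simp add: nth_append)
  next
    case False
    then have "i = length bs" using i by simp
    moreover have "Ind ?U Z (set b)" by (rule Ind_up[OF sY sZ _ _ Ub UbZ Z(1)]) auto
    ultimately show ?thesis by simp
  qed
  have wt': "\<not> Ind ?a Z (set b') \<and> weight_le_1 (set b') Z" if b': "b' \<in> set (bs @ [b])" for b'
  proof (cases "b' \<in> set bs")
    case True
    have bZ: "Ind (set b') X Z" using UZ by (rule Ind_mono) (use True in auto)
    have "weight_le_1 (set b') Z" by (rule weight_le_1_up[OF _ XZ sZ _ bZ]) (use wt[OF True] in auto)
    moreover have "\<not> Ind ?a Z (set b')"
    proof
      assume i: "Ind ?a Z (set b')"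
      have "Ind ?a X (set b')" by (rule Ind_down[OF sZ _ _ aXZ i XZ]) auto
      then show False using wt[OF True] by blast
    qed
    ultimately show ?thesis by blast
  next
    case False
    then have bb: "b' = b" using b' by simp
    have bZ: "Ind (set b) Y Z" using UbZ by (rule Ind_mono) auto
    have "weight_le_1 (set b) Z" by (rule weight_le_1_up[OF Y(6) Z(1) sZ _ bZ]) auto
    moreover have "\<not> Ind ?a Z (set b)"
    proof
      assume i: "Ind ?a Z (set b)"
      have "Ind ?a Y (set b)" by (rule Ind_down[OF sZ _ _ Z(3) i Z(1)]) auto
      then show False using Y(5) by blast
    qed
    ultimately show ?thesis using bb by blast
  qed
  have "Ind ?U (Y \<union> set b) Z" by (rule Ind_split[OF sY]) (use UbZ in \<open>simp_all add: Un_commute\<close>)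
  then have "Ind ?U X ((Y \<union> set b) \<union> Z)" using sY sZ Y(1,4) by (rule_tac Ind_trans') auto
  then have UZb: "Ind ?U X (Z \<union> set b)" by (rule Ind_mono) auto
  have "dominating Z ?a (?a \<union> set (concat (bs @ [b])))" using Z(4) by (rule dominating_mono) auto
  moreover have "A \<subseteq> Z" using X(1) XZ by blast
  ultimately have "partial_basis a A Z (bs @ [b])" unfolding partial_basis_def using szZ aZ lin' wt' by blast
  then show ?thesis using that XZ UZb by blast
qed

lemma decomposition:
  assumes A: "small M A" and RF: "rudimentary (set a) A"
  obtains X bs where "partial_basis a A X bs" "dominating X (set (concat bs)) (set a)"
proof (rule ccontr)
  note th = that
  assume nt: "\<not> thesis"
  define I where "I s = partial_basis a A (fst s) (snd s)" for s
  define J where "J s s' \<longleftrightarrow> fst s \<subseteq> fst s' \<and>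
      (\<exists>b. snd s' = snd s @ [b] \<and> Ind (set (concat (snd s))) (fst s) (fst s' \<union> set b))" for s s' :: "'m set \<times> 'm list list"
  have I0: "I (A, [])" unfolding I_def partial_basis_def
    using Ind_self[OF A] finite_le_T[of "{}"] by (simp add: dominating_refl)
  have step: "\<exists>s'. I s' \<and> J s s'" if "I s" for s
  proof -
    have basis: "partial_basis a A (fst s) (snd s)" using that by (simp add: I_def)
    have "\<not> dominating (fst s) (set (concat (snd s))) (set a)" using th[OF basis] nt by blast
    from partial_basis_extend[OF A RF basis this] obtain X' b where X': "fst s \<subseteq> X'"
      "partial_basis a A X' (snd s @ [b])" "Ind (set (concat (snd s))) (fst s) (X' \<union> set b)" by blast
    then show ?thesis by (intro exI[of _ "(X', snd s @ [b])"]) (auto simp: I_def J_def)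
  qed
  obtain s where s: "\<And>n :: nat. I (s n)" "\<And>n. J (s n) (s (Suc n))"
    using dependent_nat_choice[of "\<lambda>_. I" "\<lambda>_. J"] I0 step by blast
  define X where "X n = fst (s n)" for n
  define bs where "bs n = snd (s n)" for n
  define e where "e n = last (bs (Suc n))" for n
  have IX: "partial_basis a A (X n) (bs n)" for n using s(1)[of n] by (simp add: I_def X_def bs_def)
  have JX: "X n \<subseteq> X (Suc n) \<and> bs (Suc n) = bs n @ [e n] \<and> Ind (set (concat (bs n))) (X n) (X (Suc n) \<union> set (e n))" for n
    using s(2)[of n] by (auto simp: J_def X_def bs_def e_def)
  have U: "(\<Union>j<n. set (e j)) \<subseteq> set (concat (bs n))" for n
  proof (induction n)
    case (Suc n)
    have "set (concat (bs (Suc n))) = set (concat (bs n)) \<union> set (e n)" using JX[of n] by simp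
    then show ?case using Suc by (simp only: lessThan_Suc UN_insert) blast
  qed simp
  show False
  proof (rule rudimentary_no_chain[OF A _ RF, of X e])
    show "Ind (\<Union>j<n. set (e j)) (X n) (X (Suc n) \<union> set (e n))" for n
      using JX[of n] U[of n] Ind_mono by blast
    show "\<not> Ind (set a) (X (Suc n)) (set (e n))" for n using partial_basisD(6)[OF IX[of "Suc n"]] JX[of n] by simp
  qed (use partial_basisD(1-3)[OF IX] JX in auto)
qed

text \<open>
  Induction on \<open>bs\<close>. The last member \<open>b\<close> is independent from all but one of the tuples \<open>c i\<close> taken
  together: for a maximal \<open>J\<close> such that \<open>b\<close> is independent from the tuples with index in \<open>J\<close>, and \<open>k\<close>
  outside of \<open>J\<close>, the tuple \<open>b\<close> depends over them on \<open>c k\<close>, and having weight one it cannot also depend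
  on the remaining tuples. These stay independent when \<open>b\<close> is added to the base, and they still depend
  on the shorter sequence.
\<close>

lemma weight_one_bound:
  fixes c :: "nat \<Rightarrow> 'm list"
  assumes "small M Y" and "\<And>i. i < length bs \<Longrightarrow> Ind (set (concat (take i bs))) Y (set (bs ! i))"
    and "\<And>b. b \<in> set bs \<Longrightarrow> weight_le_1 (set b) Y"
    and "finite I" "\<And>i. i \<in> I \<Longrightarrow> Ind (set (c i)) Y (\<Union>j\<in>I - {i}. set (c j))"
    and "\<And>i. i \<in> I \<Longrightarrow> \<not> Ind (set (concat bs)) Y (set (c i))"
  shows "card I \<le> length bs"
  using assms
proof (induction bs arbitrary: Y I rule: rev_induct)
  case Nil
  then have "I = {}" using Ind_empty by auto
  then show ?case by simp
next
  case (snoc b bs)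
  note Y = snoc.prems(1) and fin = snoc.prems(4) and fam = snoc.prems(5) and dep = snoc.prems(6)
  let ?U = "set (concat bs)" and ?C = "\<lambda>J. \<Union>j\<in>J. set (c j)"
  have Ub: "Ind ?U Y (set b)" using snoc.prems(2)[of "length bs"] by simp
  have wb: "weight_le_1 (set b) Y" using snoc.prems(3) by simp
  have "\<exists>I'\<subseteq>I. card I \<le> Suc (card I') \<and> Ind (set b) Y (?C I')"
  proof -
    let ?S = "{J. J \<subseteq> I \<and> Ind (set b) Y (?C J)}"
    have "finite ?S" using fin by simp
    moreover have "{} \<in> ?S" using Ind_mono[OF Ind_self[OF Y], of "set b" "set b" "{}"] by simp
    ultimately obtain J where J: "J \<in> ?S" "\<And>J'. J' \<in> ?S \<Longrightarrow> J \<subseteq> J' \<Longrightarrow> J = J'"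
      using finite_has_maximal[of ?S] by (metis (no_types, lifting) empty_iff)
    have finJ: "finite J" using J(1) fin finite_subset by blast
    then have sJ: "small M (?C J)" by simp
    show ?thesis
    proof (cases "J = I")
      case True then show ?thesis using J(1) by (intro exI[of _ I]) auto
    next
      case False
      then obtain k where k: "k \<in> I" "k \<notin> J" using J(1) by blast
      have "insert k J \<notin> ?S" using J(2)[of "insert k J"] k(2) by blast
      then have "\<not> Ind (set b) Y (?C J \<union> set (c k))" using J(1) k(1) by (auto simp: Un_commute)
      then have nk: "\<not> Ind (set b) (Y \<union> ?C J) (set (c k))"
        using Ind_trans[OF Y sJ, of "set (c k)" "set b"] J(1) by auto
      let ?K = "I - {k}"
      obtain r where r: "set r = ?C ?K" using finite_list[of "?C ?K"] fin by auto
      have "Ind (set (c k)) Y (?C ?K)" by (rule fam[OF k(1)])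
      moreover have JK: "?C J \<subseteq> ?C ?K" using J(1) k(2) by blast
      ultimately have "Ind (set (c k)) (Y \<union> ?C J) (?C ?K)" by (rule_tac Ind_mono[OF Ind_base]) auto
      moreover have "weight_le_1 (set b) (Y \<union> ?C J)"
        by (rule weight_le_1_up[OF wb _ _ _ Ind_mono[of "set b" Y "?C J"]]) (use J(1) Y sJ in auto)
      ultimately have "Ind (set b) (Y \<union> ?C J) (?C ?K)" using weight_le_1D[of "set b" "Y \<union> ?C J" "c k" r] nk r Y sJ by simp
      then have "Ind (set b) Y (?C J \<union> ?C ?K)" using Y sJ fin J(1) by (rule_tac Ind_trans) auto
      then have "Ind (set b) Y (?C ?K)" by (rule Ind_mono) auto
      then show ?thesis using fin k(1) by (intro exI[of _ ?K]) (auto simp: card_Diff_singleton)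
    qed
  qed
  then obtain I' where I': "I' \<subseteq> I" "card I \<le> Suc (card I')" "Ind (set b) Y (?C I')" by blast
  have fin': "finite I'" using I'(1) fin finite_subset by blast
  let ?Y = "Y \<union> set b"
  have sY: "small M ?Y" using Y by simp
  have UY: "Ind ?U Y ?Y" using Ub by (rule Ind_mono) auto
  have CY: "Ind (?C I') Y ?Y" using Ind_sym[OF Y I'(3)] by (rule Ind_mono) auto
  have "card I' \<le> length bs"
  proof (rule snoc.IH[OF sY])
    fix i assume i: "i < length bs"
    have sub: "set (concat (take i bs)) \<union> set (bs ! i) \<subseteq> ?U" by (rule take_nth_concat_set[OF i])
    have 1: "Ind (set (concat (take i bs))) Y (set (bs ! i))" using snoc.prems(2)[of i] i by (simp add: nth_append)
    show "Ind (set (concat (take i bs))) ?Y (set (bs ! i))"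
      by (rule Ind_up[OF Y sY _ _ 1 Ind_mono[OF UY sub]]) auto
  next
    fix b' assume b': "b' \<in> set bs"
    have "Ind (set b') Y ?Y" using UY by (rule Ind_mono) (use b' in auto)
    then show "weight_le_1 (set b') ?Y" by (rule weight_le_1_up[OF _ _ sY, rotated -1]) (use snoc.prems(3) b' in auto)
  next
    show "finite I'" by (rule fin')
  next
    fix i assume i: "i \<in> I'"
    have 1: "Ind (set (c i)) Y (?C (I' - {i}))" using fam[of i] by (rule Ind_mono) (use i I'(1) in auto)
    have "Ind (set (c i) \<union> ?C (I' - {i})) Y ?Y" using CY by (rule Ind_mono) (use i in auto)
    then show "Ind (set (c i)) ?Y (?C (I' - {i}))" using fin' by (rule_tac Ind_up[OF Y sY _ _ 1]) auto
  next
    fix i assume i: "i \<in> I'"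
    show "\<not> Ind ?U ?Y (set (c i))"
    proof
      assume *: "Ind ?U ?Y (set (c i))"
      have "Ind (set b) Y (set (c i))" using I'(3) by (rule Ind_mono) (use i in auto)
      then have "Ind (set b \<union> ?U) Y (set (c i))" using * Y by (rule_tac Ind_trans_left) simp_all
      then have "Ind (set (concat (bs @ [b]))) Y (set (c i))" by (rule Ind_mono) auto
      then show False using dep i I'(1) by blast
    qed
  qed
  then show ?case using I'(2) by simp
qed

section \<open>Weights of types\<close>

lemma indep_Ind: "small M C \<Longrightarrow> indep M a C B \<longleftrightarrow> Ind (set a) C B"
  by (simp add: indep_iff Ind_set)

lemma pforms_over_mono: "A \<subseteq> B \<Longrightarrow> pforms_over M ss A \<subseteq> pforms_over M ss B"
  unfolding pforms_over_def by blast

lemma tp_complete: "tp M a B \<in> complete_types M B"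
proof -
  have "PForm (srts a) \<phi> b \<in> tp M a B \<or> PForm (srts a) (Neg \<phi>) b \<in> tp M a B"
    if p: "PForm (srts a) \<phi> b \<in> pforms_over M (srts a) B" for \<phi> b
  proof -
    have "PForm (srts a) (Neg \<phi>) b \<in> pforms_over M (srts a) B" using p by (auto simp: pforms_over_def)
    then show ?thesis using p satisfies_Neg[OF p refl] by (auto simp: tp_def)
  qed
  moreover have "tp M a B \<subseteq> pforms_over M (srts a) B" by (auto simp: tp_def)
  moreover have "\<exists>a'. srts a' = srts a \<and> realizes M a' F" if "F \<subseteq> tp M a B" for F
    using that by (intro exI[of _ a]) (auto simp: realizes_def tp_def)
  ultimately have "tp M a B \<in> complete_types_in M (srts a) B" unfolding complete_types_in_def by blast
  then show ?thesis unfolding complete_types_def by blast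
qed

lemma complete_type_tp:
  assumes p: "p \<in> complete_types M A" and r: "realizes M a p"
  shows "p = tp M a A"
proof -
  obtain ss where ss: "p \<subseteq> pforms_over M ss A"
    "\<And>\<phi> b. PForm ss \<phi> b \<in> pforms_over M ss A \<Longrightarrow> PForm ss \<phi> b \<in> p \<or> PForm ss (Neg \<phi>) b \<in> p"
    using p by (auto simp: complete_types_def complete_types_in_def)
  obtain \<psi> where "\<psi> \<in> pforms_over M ss A" using definable_top[of ss A] unfolding definable_pforms by blast
  then obtain \<phi> b where "PForm ss \<phi> b \<in> pforms_over M ss A" by (auto simp: pforms_over_def)
  then obtain \<chi> where "\<chi> \<in> p" "vsorts \<chi> = ss" using ss(2) by fastforce
  then have sa: "srts a = ss" using r by (auto simp: realizes_def satisfies_def)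
  show ?thesis
  proof (intro equalityI subsetI)
    fix \<psi> assume "\<psi> \<in> p" then show "\<psi> \<in> tp M a A" using ss(1) r sa by (auto simp: tp_def realizes_def)
  next
    fix \<psi> assume "\<psi> \<in> tp M a A"
    then have \<psi>: "\<psi> \<in> pforms_over M ss A" "satisfies M a \<psi>" using sa by (auto simp: tp_def)
    obtain \<phi> b where eq: "\<psi> = PForm ss \<phi> b" using \<psi>(1) by (auto simp: pforms_over_def)
    show "\<psi> \<in> p"
    proof (rule ccontr)
      assume "\<psi> \<notin> p"
      then have "PForm ss (Neg \<phi>) b \<in> p" using ss(2)[of \<phi> b] \<psi>(1) eq by blast
      then have "satisfies M a (PForm ss (Neg \<phi>) b)" using r by (simp add: realizes_def)
      then show False using satisfies_Neg[of ss \<phi> b A a] \<psi> eq sa by simp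
    qed
  qed
qed

lemma nf_extension_tp:
  assumes "A \<subseteq> B" "small M B" "Ind (set a) A B" shows "nf_extension M (tp M a A) A (tp M a B) B"
proof -
  have sA: "small M A" using assms small_mono by blast
  have "A \<union> B = B" using assms(1) by blast
  then have "\<not> type_thorn_forks M (tp M a B) A"
    using assms(3) type_thorn_forks_tp[OF sA, of a B] unfolding Ind_set ind_def by simp
  moreover have "tp M a A \<subseteq> tp M a B" using pforms_over_mono[OF assms(1)] by (auto simp: tp_def)
  ultimately show ?thesis using assms(1,2) tp_complete by (simp add: nf_extension_def)
qed

lemma indep_family_Ind:
  "small M B \<Longrightarrow> indep_family M B I b \<longleftrightarrow> (\<forall>i\<in>I. Ind (set (b i)) B (\<Union>j\<in>I - {i}. set (b j)))"
  unfolding indep_family_def by (simp add: indep_Ind)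

lemma rudimentary_of_type:
  assumes "small M A" "rudimentarily_finite_weight M (tp M a A) A" shows "rudimentary (set a) A"
  unfolding rudimentary_def
proof (intro allI impI notI)
  fix B assume B: "A \<subseteq> B" "small M B" "Ind (set a) A B"
    and "\<exists>b :: nat \<Rightarrow> 'm list. (\<forall>i. Ind (set (b i)) B (\<Union>j\<in>UNIV - {i}. set (b j))) \<and> (\<forall>i. \<not> Ind (set a) B (set (b i)))"
  then obtain b :: "nat \<Rightarrow> 'm list" where b: "\<forall>i. Ind (set (b i)) B (\<Union>j\<in>UNIV - {i}. set (b j))" "\<forall>i. \<not> Ind (set a) B (set (b i))"
    by blast
  have "indep_family M B UNIV b" unfolding indep_family_Ind[OF B(2)] using b(1) by blast
  moreover have "\<forall>i. \<not> indep M a B (set (b i))" using b(2) by (simp add: indep_Ind[OF B(2)])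
  ultimately show False
    using assms(2) nf_extension_tp[OF B] realizes_self[of a B] unfolding rudimentarily_finite_weight_def by blast
qed

text \<open>
  A witness for the type of \<open>a\<close> involves some realization of it; an automorphism moves this
  realization to \<open>a\<close>.
\<close>

lemma weight_ge_conj:
  assumes A: "small M A" and w: "weight_ge M (tp M a A) A m"
  obtains B c where "A \<subseteq> B" "small M B" "Ind (set a) A B"
    "\<And>i. i < m \<Longrightarrow> Ind (set (c i)) B (\<Union>j\<in>{..<m} - {i}. set (c j))"
    "\<And>i. i < m \<Longrightarrow> \<not> Ind (set a) B (set (c i))"
proof -
  obtain a' B c where w: "realizes M a' (tp M a A)" "A \<subseteq> B" "small M B" "indep M a' A B"
    "indep_family M B {..<m} c" "\<forall>i<m. \<not> indep M a' B (set (c i))"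
    using w by (auto simp: weight_ge_def weight_witness_def)
  have "same_type A a' a" using w(1) realizes_tp same_type_sym by blast
  then obtain h where h: "aut A h" "map h a' = a" using same_type_aut[OF A] by blast
  have hA: "h ` A = A" using aut_image[OF h(1)] by blast
  have ha: "h ` set a' = set a" using h(2) by (metis set_map)
  show ?thesis
  proof (rule that[of "h ` B" "\<lambda>i. map h (c i)"])
    show "A \<subseteq> h ` B" using w(2) hA by blast
    show "small M (h ` B)" by (rule small_image[OF w(3)])
    show "Ind (set a) A (h ` B)" using w(4) Ind_aut[OF h(1), of "set a'" A B] ha hA A by (simp add: indep_Ind)
    fix i assume i: "i < m"
    have "Ind (set (c i)) B (\<Union>j\<in>{..<m} - {i}. set (c j))" using w(5) i unfolding indep_family_Ind[OF w(3)] by blast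
    from Ind_aut1[OF h(1) this]
    show "Ind (set (map h (c i))) (h ` B) (\<Union>j\<in>{..<m} - {i}. set (map h (c j)))" by (simp add: image_UN)
    have "\<not> Ind (set a') B (set (c i))" using w(6) i by (simp add: indep_Ind[OF w(3)])
    then show "\<not> Ind (set a) (h ` B) (set (map h (c i)))" using Ind_aut[OF h(1), of "set a'" B "set (c i)"] ha by simp
  qed
qed

text \<open>
  A witness \<open>B\<close>, \<open>c\<close> is moved over \<open>Aa\<close> until it is independent from \<open>X\<close> and \<open>bs\<close>. Over \<open>X \<union> B\<close> the tuples
  \<open>c i\<close> are then still independent and still depend on \<open>a\<close>. Hence they depend on \<open>bs\<close>, and
  \<open>weight_one_bound\<close> applies.
\<close>

lemma weight_bound:
  assumes A: "small M A" and basis: "partial_basis a A X bs"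
    and dm: "dominating X (set (concat bs)) (set a)"
    and w: "weight_ge M (tp M a A) A m"
  shows "m \<le> length bs"
proof -
  let ?U = "set (concat bs)"
  note lin = partial_basisD(5)[OF basis] and wt = partial_basisD(7)[OF basis]
  have X: "A \<subseteq> X" "small M X" "Ind (set a) A X"
    using partial_basisD(1-3)[OF basis] small_by_le[OF A] by blast+
  obtain B c where B: "A \<subseteq> B" "small M B" "Ind (set a) A B"
    "\<And>i. i < m \<Longrightarrow> Ind (set (c i)) B (\<Union>j\<in>{..<m} - {i}. set (c j))"
    "\<And>i. i < m \<Longrightarrow> \<not> Ind (set a) B (set (c i))"
    by (rule weight_ge_conj[OF A w]) blast
  let ?c = "\<Union>i<m. set (c i)"
  obtain h where h: "aut (A \<union> set a) h" "Ind (h ` (B \<union> ?c)) (A \<union> set a) (X \<union> ?U)"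
    using free_extension[of "A \<union> set a" "B \<union> ?c" "X \<union> ?U"] A B(2) X(2) by auto
  have hA: "h ` A = A" "h ` set a = set a" using aut_image[OF h(1)] by blast+
  define B' where "B' = h ` B"
  define e where "e i = map h (c i)" for i
  have sB: "small M B'" unfolding B'_def by (rule small_image[OF B(2)])
  have AB: "A \<subseteq> B'" unfolding B'_def using B(1) hA by blast
  have aB: "Ind (set a) A B'" using Ind_aut1[OF h(1) B(3)] hA by (simp add: B'_def)
  have fam: "Ind (set (e i)) B' (\<Union>j\<in>{..<m} - {i}. set (e j))" if "i < m" for i
    using Ind_aut1[OF h(1) B(4)[OF that]] by (simp add: B'_def e_def image_UN)
  have dep: "\<not> Ind (set a) B' (set (e i))" if "i < m" for i
    using B(5)[OF that] Ind_aut[OF h(1), of "set a" B "set (c i)"] hA by (simp add: B'_def e_def)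
  let ?e = "\<Union>i<m. set (e i)"
  have "h ` (B \<union> ?c) = B' \<union> ?e" by (simp add: B'_def e_def image_Un image_UN)
  then have free: "Ind (X \<union> ?U) (A \<union> set a) (B' \<union> ?e)" using h(2) A by (simp add: Ind_sym)
  have sm: "small M (B' \<union> ?e)" using sB by simp
  have Xa: "Ind X A (set a)" by (rule Ind_sym[OF A X(3)])
  have "Ind X (A \<union> set a) (B' \<union> ?e)" using free by (rule Ind_mono) auto
  then have XBe: "Ind X A (set a \<union> (B' \<union> ?e))" using A X(2) sm Xa by (rule_tac Ind_trans) simp_all
  have "B' \<subseteq> set a \<union> (B' \<union> ?e)" by blast
  then have XB: "Ind X B' (set a \<union> ?e)" using AB by (intro Ind_mono[OF Ind_base[OF XBe]]) auto
  let ?Y = "X \<union> B'"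
  have sY: "small M ?Y" using X(2) sB by simp
  have aYB: "Ind (set a \<union> ?U) X B'"
  proof -
    have "Ind B' (A \<union> set a) (X \<union> ?U)"
      by (rule Ind_sym) (use A free in \<open>auto intro: Ind_mono\<close>)
    then have "Ind B' A (set a \<union> (X \<union> ?U))" using A X(2) sB Ind_sym[OF A aB] by (rule_tac Ind_trans) simp_all
    then have "Ind B' X (set a \<union> (X \<union> ?U))" by (rule Ind_base) (use X(1) in auto)
    then have "Ind B' X (set a \<union> ?U)" by (rule Ind_mono) auto
    then show ?thesis by (rule Ind_sym[OF X(2)])
  qed
  have UY: "Ind ?U X ?Y" using aYB by (rule Ind_mono) auto
  have aB'Y: "Ind (set a) B' ?Y"
  proof -
    have "Ind X B' (set a)" using XB by (rule Ind_mono) auto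
    then have "Ind (set a) B' X" by (rule Ind_sym[OF sB])
    then show ?thesis by (rule Ind_mono) auto
  qed
  have eY: "Ind ?e B' ?Y"
  proof -
    have "Ind X B' ?e" using XB by (rule Ind_mono) auto
    then have "Ind ?e B' X" by (rule Ind_sym[OF sB])
    then show ?thesis by (rule Ind_mono) auto
  qed
  have "card {..<m} \<le> length bs"
  proof (rule weight_one_bound[OF sY, of bs "{..<m}" e])
    fix i assume i: "i < length bs"
    have sub: "set (concat (take i bs)) \<union> set (bs ! i) \<subseteq> ?U" by (rule take_nth_concat_set[OF i])
    show "Ind (set (concat (take i bs))) ?Y (set (bs ! i))"
      by (rule Ind_up[OF X(2) sY _ _ lin[OF i] Ind_mono[OF UY sub]]) auto
  next
    fix b assume b: "b \<in> set bs"
    have "Ind (set b) X ?Y" using UY by (rule Ind_mono) (use b in auto)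
    then show "weight_le_1 (set b) ?Y" by (rule weight_le_1_up[OF wt[OF b] _ sY, rotated -1]) auto
  next
    fix i assume "i \<in> {..<m}"
    then have i: "i < m" by simp
    have "Ind (set (e i) \<union> (\<Union>j\<in>{..<m} - {i}. set (e j))) B' ?Y" using eY by (rule Ind_mono) (use i in auto)
    then show "Ind (set (e i)) ?Y (\<Union>j\<in>{..<m} - {i}. set (e j))"
      by (rule Ind_up[OF sB sY _ _ fam[OF i], rotated 2]) auto
    show "\<not> Ind ?U ?Y (set (e i))"
    proof
      assume "Ind ?U ?Y (set (e i))"
      moreover have "dominating ?Y ?U (set a)" by (rule dominating_up[OF dm _ sY _ UY]) auto
      ultimately have ae: "Ind (set a) ?Y (set (e i))" by (rule_tac dominating_Ind)
      have "Ind (set a) B' (set (e i))" by (rule Ind_down[OF sY _ _ aB'Y ae]) auto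
      then show False using dep[OF i] by blast
    qed
  qed simp
  then show ?thesis by simp
qed

lemma has_weight_one:
  assumes X: "small M X" and w: "weight_le_1 (set b) X" and dep: "\<not> Ind (set b) X (set a)"
  shows "has_weight M (tp M b X) X 1"
  unfolding has_weight_def
proof (intro conjI allI impI)
  have "weight_witness M (tp M b X) X 1 b X (\<lambda>_. a)"
    unfolding weight_witness_def
    using X dep realizes_self Ind_self[OF X] Ind_mono[OF Ind_self[OF X], of "set a" "set a" "{}"]
    by (simp add: indep_Ind indep_family_Ind lessThan_Suc)
  then show "weight_ge M (tp M b X) X 1" unfolding weight_ge_def by blast
next
  fix m assume m: "weight_ge M (tp M b X) X m"
  show "m \<le> 1"
  proof (rule ccontr)
    assume "\<not> m \<le> 1"
    then have m2: "0 < m" "1 < m" by auto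
    obtain B c where B: "X \<subseteq> B" "small M B" "Ind (set b) X B"
      "\<And>i. i < m \<Longrightarrow> Ind (set (c i)) B (\<Union>j\<in>{..<m} - {i}. set (c j))"
      "\<And>i. i < m \<Longrightarrow> \<not> Ind (set b) B (set (c i))"
      by (rule weight_ge_conj[OF X m]) blast
    have "Ind (set (c 0)) B (set (c 1))" using B(4)[OF m2(1)] by (rule Ind_mono) (use m2 in auto)
    then show False using w B(1-3) B(5)[OF m2(1)] B(5)[OF m2(2)] unfolding weight_le_1_def by blast
  qed
qed

end

theorem theorem2p21:
  fixes M :: "('s, 'f, 'r, 'm, 'k) monster"
    and T :: "('s, 'f, 'r) fm set"
    and A :: "'m set"
    and p :: "('s, 'f, 'r, 'm) pform set"
  assumes "complete_theory M T"
    and "monster_model M T"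
    and "closed_under_eq M"
    and "rosy M T"
    and "small M A"
    and "p \<in> complete_types M A"
    and "\<not> algebraic_type M p"
    and "rudimentarily_finite_weight M p A"
  shows "finite_weight M p A \<and>
    (\<exists>A' n q r. small M A' \<and>
       (\<forall>i<n. q i \<in> complete_types M A' \<and> has_weight M (q i) A' 1) \<and>
       free_product M A' n q r \<and> equidominant M p A r A') \<and>
    (\<exists>a A' n b. weight_witness M p A n a A' b \<and>
       (\<forall>i<n. has_weight M (tp M (b i) A') A' 1) \<and>
       dom_equiv M A' a (concat_family n b))"
proof -
  interpret rosy_monster M T by unfold_locales (fact assms)+
  note A = \<open>small M A\<close>
  obtain a where a: "realizes M a p"
    using assms(2,5,6) by (auto simp: monster_model_def saturated_def)
  have p: "p = tp M a A" by (rule complete_type_tp[OF assms(6) a])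
  have RF: "rudimentary (set a) A" by (rule rudimentary_of_type[OF A]) (use assms(8) p in simp)
  obtain X bs where basis: "partial_basis a A X bs" and dm: "dominating X (set (concat bs)) (set a)"
    by (rule decomposition[OF A RF])
  note X = partial_basisD[OF basis]
  have sX: "small M X" by (rule small_by_le[OF A X(2)])
  let ?n = "length bs" and ?b = "\<lambda>i. bs ! i"
  have conc: "concat_family ?n ?b = concat bs" by (simp add: concat_family_def map_nth)
  have lin: "Ind (\<Union>j<i. set (bs ! j)) X (set (bs ! i))" if i: "i < ?n" for i
  proof -
    have "(\<Union>j<i. set (bs ! j)) \<subseteq> set (concat (take i bs))"
    proof
      fix x assume "x \<in> (\<Union>j<i. set (bs ! j))"
      then obtain j where j: "j < i" "x \<in> set (bs ! j)" by blast
      then have "bs ! j \<in> set (take i bs)" using i by (auto simp: in_set_conv_nth intro!: exI[of _ j])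
      then show "x \<in> set (concat (take i bs))" using j(2) by auto
    qed
    then show ?thesis using Ind_mono[OF X(5)[OF i]] by blast
  qed
  have fam: "indep_family M X {..<?n} ?b"
    unfolding indep_family_Ind[OF sX] using linear_independence[OF sX lin] by simp
  have wit: "weight_witness M p A ?n a X ?b"
    unfolding weight_witness_def using a X(1,3,6) sX fam A by (simp add: indep_Ind)
  have fin: "finite_weight M p A"
    unfolding finite_weight_def has_weight_def
  proof (intro exI[of _ ?n] conjI allI impI)
    show "weight_ge M p A ?n" using wit unfolding weight_ge_def by blast
    fix m assume "weight_ge M p A m"
    then show "m \<le> ?n" unfolding p by (rule weight_bound[OF A basis dm])
  qed
  have wt: "has_weight M (tp M (?b i) X) X 1" if i: "i < ?n" for i
    by (rule has_weight_one[OF sX, of _ a]) (use X(6,7)[of "bs ! i"] i Ind_sym[OF sX] in auto)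
  have dominating: "dom_equiv M X a (concat bs)"
    unfolding dom_equiv_def dominates_def
    using dominating_mono[OF X(4), of "set (concat bs)"] dm unfolding dominating_def by (simp add: indep_Ind[OF sX]) blast
  have free: "free_product M X ?n (\<lambda>i. tp M (?b i) X) (tp M (concat bs) X)"
    unfolding free_product_def using fam realizes_self conc by (intro exI[of _ ?b]) simp
  have eq: "equidominant M p A (tp M (concat bs) X) X"
    unfolding equidominant_def p
    using nf_extension_tp[OF X(1) sX X(3)] nf_extension_tp[OF subset_refl sX Ind_self[OF sX]] realizes_self dominating
    by (intro exI[of _ X] exI[of _ "tp M a X"] exI[of _ "tp M (concat bs) X"] exI[of _ a] exI[of _ "concat bs"]) simp
  show ?thesis
  proof (intro conjI)
    show "finite_weight M p A" by (rule fin)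
    show "\<exists>A' n q r. small M A' \<and>
       (\<forall>i<n. q i \<in> complete_types M A' \<and> has_weight M (q i) A' 1) \<and>
       free_product M A' n q r \<and> equidominant M p A r A'"
      using sX wt tp_complete free eq
      by (intro exI[of _ X] exI[of _ ?n] exI[of _ "\<lambda>i. tp M (?b i) X"] exI[of _ "tp M (concat bs) X"]) simp
    show "\<exists>a A' n b. weight_witness M p A n a A' b \<and>
       (\<forall>i<n. has_weight M (tp M (b i) A') A' 1) \<and>
       dom_equiv M A' a (concat_family n b)"
      using wit wt dominating conc by (intro exI[of _ a] exI[of _ X] exI[of _ ?n] exI[of _ ?b]) simp
  qed
qed

end
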